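(* Let $\beta_0\in(0,\infty)$, $T_0>0$, $\kappa_0,x_0\in\mathbb{R}$, and let $k$ be an integer with $k\ge k_{\beta_0}:=2+\beta_0^{-1}+\beta_0$. For all $0<\delta<1$ there exists $\epsilon>0$ such that for any real-valued $(f,g)\in H^{k+1}(\mathbb{R})\times H^k(\mathbb{R})$ with $\|(f,g)\|_{H^{k+1}(\mathbb{R})\times H^k(\mathbb{R})}\le\epsilon$ there exist parameters $\beta^*\in(0,\infty)$, $T^*>0$, $\kappa^*\in\mathbb{R}$ and a unique solution $u:\Gamma(T^*,x_0)\to\mathbb{R}$ of \[ \partial_{tt}u-\partial_{xx}u=(\partial_t u)^2-(\partial_x u)^2 \] with initial data \[ u(0,x)=u_{\beta_0,\kappa_0,T_0,x_0}(0,x)+f(x),\quad \partial_t u(0,x)=\partial_t u_{\beta_0,\kappa_0,T_0,x_0}(0,x)+g(x),\qquad x\in B_{T^*}(x_0), \] such that for all $0\le t<T^*$ \[ (T^*-t)^{-\frac12+s}\,\|u(t,\cdot)-u_{\beta^*,\kappa^*,T^*,x_0}(t,\cdot)\|_{\dot H^s(B_{T^*-t}(x_0))}\lesssim (T^*-t)^{1-\delta},\quad s=0,1,\dots,k+1, \] \[ (T^*-t)^{-\frac12+s}\,\|\partial_t u(t,\cdot)-\partial_t u_{\beta^*,\kappa^*,T^*,x_0}(t,\cdot)\|_{\dot H^{s-1}(B_{T^*-t}(x_0))}\lesssim (T^*-t)^{1-\delta},\quad s=1,\dots,k+1, \] and moreover \[ |\beta^*-\beta_0|+|\kappa^*-\kappa_0|+\Big|\frac{T^*}{T_0}-1\Big|\lesssim\epsilon.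 \]
   Context: For $\beta>0$, $T>0$, $\kappa,x_0\in\mathbb{R}$ define on $\Gamma(T,x_0):=\{(t,x)\in[0,T)\times\mathbb{R}:|x-x_0|\le T-t\}$, with $y=\frac{x-x_0}{T-t}$, \[ u_{\beta,\kappa,T,x_0}(t,x)=-\log\Big(1-\frac tT\Big)-\log\big((1+y)+\beta(1-y)\big)+\log(1+\beta)+\kappa, \] an explicit blow-up solution of $\partial_{tt}u-\partial_{xx}u=(\partial_tu)^2-(\partial_xu)^2$ (denoted $u_{1,\beta,\kappa,T,x_0}$ in the paper). $B_r(x_0)=(x_0-r,x_0+r)$. $A\lesssim B$ means $A\le CB$ for a constant $C$ independent of $t$ and of the data. *)

theory Defs
  imports "HOL-Analysis.Analysis"
begin

definition light_cone :: "real \<Rightarrow> real \<Rightarrow> (real \<times> real) set" where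
  "light_cone T x0 = {(t, x). 0 \<le> t \<and> t < T \<and> \<bar>x - x0\<bar> \<le> T - t}"

definition ubl :: "real \<Rightarrow> real \<Rightarrow> real \<Rightarrow> real \<Rightarrow> real \<Rightarrow> real \<Rightarrow> real" where
  "ubl \<beta> \<kappa> T x0 t x =
     (let y = (x - x0) / (T - t) in
      - ln (1 - t / T) - ln ((1 + y) + \<beta> * (1 - y)) + ln (1 + \<beta>) + \<kappa>)"

definition dt :: "(real \<Rightarrow> real \<Rightarrow> real) \<Rightarrow> real \<Rightarrow> real \<Rightarrow> real" where
  "dt u t x = vector_derivative (\<lambda>s. u s x) (at t within {0..})"

definition test_fun :: "real set \<Rightarrow> (real \<Rightarrow> real) \<Rightarrow> bool" where
  "test_fun B \<phi> \<longleftrightarrow>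
     (\<forall>n x. ((deriv ^^ n) \<phi>) differentiable (at x)) \<and>
     (\<exists>a b. {a..b} \<subseteq> B \<and> (\<forall>x. x \<notin> {a..b} \<longrightarrow> \<phi> x = 0))"

definition weak_deriv :: "real set \<Rightarrow> nat \<Rightarrow> (real \<Rightarrow> real) \<Rightarrow> (real \<Rightarrow> real) \<Rightarrow> bool" where
  "weak_deriv B n v w \<longleftrightarrow>
     (\<forall>a b. {a..b} \<subseteq> B \<longrightarrow> set_integrable lborel {a..b} v \<and> set_integrable lborel {a..b} w) \<and>
     (\<forall>\<phi>. test_fun B \<phi> \<longrightarrow>
        (LINT x:B|lborel. v x * (deriv ^^ n) \<phi> x) = (-1) ^ n * (LINT x:B|lborel. w x * \<phi> x))"

definition sq_int :: "real set \<Rightarrow> (real \<Rightarrow> real) \<Rightarrow> bool" where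
  "sq_int B w \<longleftrightarrow> set_borel_measurable lborel B w \<and> set_integrable lborel B (\<lambda>x. (w x)\<^sup>2)"

definition L2_norm_on :: "real set \<Rightarrow> (real \<Rightarrow> real) \<Rightarrow> real" where
  "L2_norm_on B w = sqrt (LINT x:B|lborel. (w x)\<^sup>2)"

definition has_Hdot :: "real set \<Rightarrow> nat \<Rightarrow> (real \<Rightarrow> real) \<Rightarrow> bool" where
  "has_Hdot B s v \<longleftrightarrow> (\<exists>w. weak_deriv B s v w \<and> sq_int B w)"

text \<open>The seminorm ||v||_{Hdot^s(B)} = ||d^s v||_{L^2(B)} (weak derivatives are unique a.e.).\<close>
definition Hdot_norm :: "real set \<Rightarrow> nat \<Rightarrow> (real \<Rightarrow> real) \<Rightarrow> real" where
  "Hdot_norm B s v = L2_norm_on B (SOME w. weak_deriv B s v w \<and> sq_int B w)"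

definition H_witness :: "nat \<Rightarrow> (real \<Rightarrow> real) \<Rightarrow> (nat \<Rightarrow> real \<Rightarrow> real) \<Rightarrow> bool" where
  "H_witness m f D \<longleftrightarrow> D 0 = f \<and> (\<forall>j\<le>m. weak_deriv UNIV j f (D j) \<and> sq_int UNIV (D j))"

definition H_sq :: "nat \<Rightarrow> (nat \<Rightarrow> real \<Rightarrow> real) \<Rightarrow> real" where
  "H_sq m D = (\<Sum>j\<le>m. LINT x|lborel. (D j x)\<^sup>2)"

definition data_small :: "nat \<Rightarrow> (real \<Rightarrow> real) \<Rightarrow> (real \<Rightarrow> real) \<Rightarrow> real \<Rightarrow> bool" where
  "data_small k f g \<epsilon> \<longleftrightarrow>
     (\<exists>Df Dg. H_witness (k + 1) f Df \<and> H_witness k g Dg \<and> sqrt (H_sq (k + 1) Df + H_sq k Dg) \<le> \<epsilon>)"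

text \<open>u is a C^2 (up to the boundary, derivatives taken within the light_cone) solution of
  u_tt - u_xx = u_t^2 - u_x^2 on light_cone T x0 with u(0,x) = u0 x, u_t(0,x) = u1 x for
  (almost every) x in B_T(x0). DU z = (u_t, u_x); D2U z (1,0) = (u_tt, u_xt), D2U z (0,1) = (u_tx, u_xx).\<close>
definition is_solution ::
  "real \<Rightarrow> real \<Rightarrow> (real \<Rightarrow> real \<Rightarrow> real) \<Rightarrow> (real \<Rightarrow> real) \<Rightarrow> (real \<Rightarrow> real) \<Rightarrow> bool" where
  "is_solution T x0 u u0 u1 \<longleftrightarrow>
     (\<exists>DU D2U.
        continuous_on (light_cone T x0) DU \<and>
        continuous_on (light_cone T x0) (\<lambda>z. D2U z (1, 0)) \<and>
        continuous_on (light_cone T x0) (\<lambda>z. D2U z (0, 1)) \<and>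
        (\<forall>z\<in>light_cone T x0.
           ((\<lambda>(t, x). u t x) has_derivative (\<lambda>h. DU z \<bullet> h)) (at z within light_cone T x0) \<and>
           (DU has_derivative D2U z) (at z within light_cone T x0) \<and>
           fst (D2U z (1, 0)) - snd (D2U z (0, 1)) = (fst (DU z))\<^sup>2 - (snd (DU z))\<^sup>2) \<and>
        (AE x in lborel. x \<in> ball x0 T \<longrightarrow> u 0 x = u0 x \<and> fst (DU (0, x)) = u1 x))"

end

theory Submission
  imports Defs "HOL-Library.Landau_Symbols"
begin

text \<open>
  If \<open>u\<close> solves the equation, then \<open>w = exp (- u)\<close> solves the linear wave equation, so
  \<open>w (t, x) = F (x + t) + G (x - t)\<close>, and \<open>u\<close> blows up where \<open>w\<close> vanishes. For the explicit
  solutions, \<open>F\<close> and \<open>G\<close> are affine functions of slopes \<open>p < 0 < q\<close> with \<open>\<beta> = - p / q\<close> and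
  \<open>\<kappa> = - ln (T * (q - p))\<close>. For perturbed data, \<open>F'\<close> stays negative and \<open>G'\<close> positive, hence \<open>w\<close> has
  a zero \<open>(T*, x0)\<close> with \<open>T*\<close> near \<open>T0\<close> and is positive on the backward light cone of this point. The
  parameters \<open>\<beta>*\<close> and \<open>\<kappa>*\<close> are read off from the first order Taylor polynomial \<open>w*\<close> of \<open>w\<close> at
  \<open>(T*, x0)\<close>. Since \<open>w - w*\<close> is quadratically small and \<open>w*\<close> is comparable to \<open>T* - t\<close> in the cone,
  \<open>u - u* = - ln (w / w*)\<close> is of size \<open>T* - t\<close> in the scale-invariant norms, which is better than
  the claimed power \<open>1 - \<delta>\<close>. All constants are uniform because the norms are taken of families of
  functions, indexed first by the data and then by the data together with the time.
\<close>

subsection \<open>Primitives of locally integrable functions\<close>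

definition primitive_on :: "real set \<Rightarrow> (real \<Rightarrow> real) \<Rightarrow> (real \<Rightarrow> real) \<Rightarrow> bool" where
  "primitive_on B v w \<longleftrightarrow>
     (\<forall>a b. a \<le> b \<longrightarrow> {a..b} \<subseteq> B \<longrightarrow>
        set_integrable lborel {a..b} w \<and> (LINT x:{a..b}|lborel. w x) = v b - v a)"

lemma primitive_onI:
  assumes "\<And>a b. a \<le> b \<Longrightarrow> {a..b} \<subseteq> B \<Longrightarrow> set_integrable lborel {a..b} w"
    and "\<And>a b. a \<le> b \<Longrightarrow> {a..b} \<subseteq> B \<Longrightarrow> (LINT x:{a..b}|lborel. w x) = v b - v a"
  shows "primitive_on B v w"
  using assms by (simp add: primitive_on_def)

lemma primitive_on_integral:
  assumes "primitive_on B v w" "a \<le> b" "{a..b} \<subseteq> B"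
  shows "(LINT x:{a..b}|lborel. w x) = v b - v a"
  using assms by (simp add: primitive_on_def)

lemma primitive_on_integrable:
  assumes "primitive_on B v w" "{a..b} \<subseteq> B"
  shows "set_integrable lborel {a..b} w"
  using assms by (cases "a \<le> b") (simp_all add: primitive_on_def)

lemma primitive_on_subset: "primitive_on B v w \<Longrightarrow> B' \<subseteq> B \<Longrightarrow> primitive_on B' v w"
  unfolding primitive_on_def by blast

lemma primitive_on_cong:
  assumes p: "primitive_on B v w" and v: "\<And>x. x \<in> B \<Longrightarrow> v x = v' x" and w: "\<And>x. x \<in> B \<Longrightarrow> w x = w' x"
  shows "primitive_on B v' w'"
proof (rule primitive_onI)
  fix a b :: real assume ab: "a \<le> b" "{a..b} \<subseteq> B"
  then have w': "w' x = w x" if "x \<in> {a..b}" for x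
    using w that by auto
  then show "set_integrable lborel {a..b} w'"
    using set_integrable_cong[of lborel lborel "{a..b}" "{a..b}" w' w] primitive_on_integrable[OF p ab(2)] by simp
  have "(LINT x:{a..b}|lborel. w' x) = v b - v a"
    using set_lebesgue_integral_cong[of "{a..b}" lborel w' w] w' primitive_on_integral[OF p ab] by simp
  moreover have "v' a = v a" "v' b = v b"
    using v ab by (auto simp: subset_eq)
  ultimately show "(LINT x:{a..b}|lborel. w' x) = v' b - v' a" by simp
qed

lemma primitive_on_cong_AE:
  assumes p: "primitive_on B v w" and eq: "AE x in lborel. w x = w' x"
    and meas: "w \<in> borel_measurable lborel" "w' \<in> borel_measurable lborel"
  shows "primitive_on B v w'"
proof (rule primitive_onI)
  fix a b :: real assume ab: "a \<le> b" "{a..b} \<subseteq> B"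
  have eq': "AE x\<in>{a..b} in lborel. w x = w' x"
    using eq by eventually_elim simp
  show "set_integrable lborel {a..b} w'"
    using set_integrable_cong_AE[OF meas eq'] primitive_on_integrable[OF p ab(2)] by simp
  show "(LINT x:{a..b}|lborel. w' x) = v b - v a"
    using set_lebesgue_integral_cong_AE[OF _ meas eq'] primitive_on_integral[OF p ab] by simp
qed

lemma primitive_on_FTC:
  assumes v: "\<And>x. x \<in> B \<Longrightarrow> (v has_real_derivative w x) (at x)" and w: "continuous_on B w"
  shows "primitive_on B v w"
proof (rule primitive_onI)
  fix a b :: real assume ab: "a \<le> b" "{a..b} \<subseteq> B"
  have w_continuous: "continuous_on {a..b} w"
    using w ab(2) continuous_on_subset by blast
  show "set_integrable lborel {a..b} w"
    by (rule borel_integrable_atLeastAtMost'[OF w_continuous])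
  have "(v has_vector_derivative w x) (at x within {a..b})" if "a \<le> x" "x \<le> b" for x
  proof -
    have "x \<in> B" using ab that by auto
    then show ?thesis
      using v by (simp add: has_real_derivative_iff_has_vector_derivative has_vector_derivative_at_within)
  qed
  then show "(LINT x:{a..b}|lborel. w x) = v b - v a"
    unfolding set_lebesgue_integral_def using integral_FTC_atLeastAtMost[OF ab(1) _ w_continuous] by blast
qed

lemma primitive_on_add:
  assumes "primitive_on B v w" "primitive_on B v' w'"
  shows "primitive_on B (\<lambda>x. v x + v' x) (\<lambda>x. w x + w' x)"
  using assms unfolding primitive_on_def by simp

lemma primitive_on_cmult:
  assumes "primitive_on B v w"
  shows "primitive_on B (\<lambda>x. c * v x) (\<lambda>x. c * w x)"
  using assms unfolding primitive_on_def by (simp add: right_diff_distrib)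

lemma primitive_on_add_const:
  assumes "primitive_on B v w"
  shows "primitive_on B (\<lambda>x. v x + c) w"
  using assms unfolding primitive_on_def by simp

lemma primitive_on_shift:
  assumes p: "primitive_on B v w" and B': "\<And>x. x \<in> B' \<Longrightarrow> x + \<tau> \<in> B"
  shows "primitive_on B' (\<lambda>x. v (x + \<tau>)) (\<lambda>x. w (x + \<tau>))"
proof (rule primitive_onI)
  fix a b :: real assume ab: "a \<le> b" "{a..b} \<subseteq> B'"
  have sub: "{a + \<tau>..b + \<tau>} \<subseteq> B"
  proof
    fix y assume "y \<in> {a + \<tau>..b + \<tau>}"
    then have "y - \<tau> \<in> B'" using ab by auto
    from B'[OF this] show "y \<in> B" by simp
  qed
  have shift: "(\<lambda>x. indicator {a..b} x *\<^sub>R w (x + \<tau>)) = (\<lambda>x. indicator {a + \<tau>..b + \<tau>} (\<tau> + 1 * x) *\<^sub>R w (\<tau> + 1 * x))"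
    by (auto simp: indicator_def add.commute)
  show "set_integrable lborel {a..b} (\<lambda>x. w (x + \<tau>))"
    using primitive_on_integrable[OF p sub] unfolding set_integrable_def shift
    by (rule lborel_integrable_real_affine) simp
  have "(LINT x:{a..b}|lborel. w (x + \<tau>)) = (LINT x:{a + \<tau>..b + \<tau>}|lborel. w x)"
    unfolding set_lebesgue_integral_def shift
    using lborel_integral_real_affine[of 1 "\<lambda>x. indicator {a + \<tau>..b + \<tau>} x *\<^sub>R w x" \<tau>] by simp
  then show "(LINT x:{a..b}|lborel. w (x + \<tau>)) = v (b + \<tau>) - v (a + \<tau>)"
    using primitive_on_integral[OF p _ sub] ab(1) by simp
qed

lemma primitive_on_exists:
  assumes B: "convex B" "c \<in> B" and w: "\<And>a b. {a..b} \<subseteq> B \<Longrightarrow> set_integrable lborel {a..b} w"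
  obtains V where "primitive_on B V w" "V c = d"
proof -
  define V where "V x = (LBINT y=ereal c..ereal x. w y) + d" for x
  have "primitive_on B V w"
  proof (rule primitive_onI)
    fix a b :: real assume ab: "a \<le> b" "{a..b} \<subseteq> B"
    show "set_integrable lborel {a..b} w" by (rule w[OF ab(2)])
    define l u where "l = min c a" and "u = max c b"
    have "l \<in> B" "u \<in> B"
      using B(2) ab by (auto simp: l_def u_def min_def max_def)
    moreover have lu: "l \<le> u" using ab(1) by (simp add: l_def u_def)
    ultimately have "{l..u} \<subseteq> B"
      using closed_segment_subset[of l B u] B(1) by (simp add: closed_segment_eq_real_ivl)
    from w[OF this] have "set_integrable lborel (einterval (ereal l) (ereal u)) w"
      by (rule set_integrable_subset) auto
    moreover have "min (ereal c) (min (ereal a) (ereal b)) = ereal l" "max (ereal c) (max (ereal a) (ereal b)) = ereal u"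
      using ab(1) by (auto simp: l_def u_def min_def max_def)
    ultimately have "interval_lebesgue_integrable lborel (min (ereal c) (min (ereal a) (ereal b))) (max (ereal c) (max (ereal a) (ereal b))) w"
      using lu by (simp add: interval_lebesgue_integrable_def)
    then have "(LBINT y=c..a. w y) + (LBINT y=a..b. w y) = (LBINT y=c..b. w y)"
      by (rule interval_integral_sum)
    then show "(LINT y:{a..b}|lborel. w y) = V b - V a"
      using interval_integral_Icc[OF ab(1), of w] by (simp add: V_def)
  qed
  then show thesis
    by (rule that) (simp add: V_def)
qed

lemma primitive_on_continuous_Icc:
  assumes p: "primitive_on B v w" and ab: "{a..b} \<subseteq> B"
  shows "continuous_on {a..b} v"
proof (rule continuous_on_eq)
  show "continuous_on {a..b} (\<lambda>x. v a + integral {a..x} w)"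
    by (intro continuous_intros indefinite_integral_continuous_1 set_borel_integral_eq_integral
        primitive_on_integrable[OF p ab])
  show "v a + integral {a..x} w = v x" if "x \<in> {a..b}" for x
  proof -
    have "{a..x} \<subseteq> B" using that ab by auto
    then show ?thesis
      using that primitive_on_integral[OF p, of a x] primitive_on_integrable[OF p, of a x]
      by (simp add: set_borel_integral_eq_integral(2))
  qed
qed

lemma open_imp_Icc_neighbourhood:
  fixes B :: "real set"
  assumes "open B" "x \<in> B"
  obtains e where "e > 0" "{x - e..x + e} \<subseteq> B"
  using assms open_contains_cball by (metis cball_eq_atLeastAtMost)

lemma primitive_on_continuous:
  assumes p: "primitive_on B v w" and B: "open B"
  shows "continuous_on B v"
proof (rule continuous_at_imp_continuous_on, rule ballI)
  fix x assume "x \<in> B"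
  then obtain e where "e > 0" "{x - e..x + e} \<subseteq> B"
    using open_imp_Icc_neighbourhood[OF B] by blast
  then show "isCont v x"
    using continuous_on_interior[OF primitive_on_continuous_Icc[OF p], of "x - e" "x + e" x] by simp
qed

lemma primitive_on_has_derivative:
  assumes p: "primitive_on B v w" and B: "open B" and w: "continuous_on B w" and x: "x \<in> B"
  shows "(v has_real_derivative w x) (at x)"
proof -
  obtain e where e: "e > 0" and sub: "{x - e..x + e} \<subseteq> B"
    using open_imp_Icc_neighbourhood[OF B x] by blast
  have "((\<lambda>y. integral {x - e..y} w) has_vector_derivative w x) (at x within {x - e..x + e})"
    using e w sub by (intro integral_has_vector_derivative) (auto intro: continuous_on_subset)
  then have "((\<lambda>y. v (x - e) + integral {x - e..y} w) has_vector_derivative w x) (at x within {x - e..x + e})"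
    by (auto intro!: derivative_eq_intros)
  then have "(v has_vector_derivative w x) (at x within {x - e..x + e})"
  proof (rule has_vector_derivative_transform[rotated 2])
    show "v y = v (x - e) + integral {x - e..y} w" if "y \<in> {x - e..x + e}" for y
    proof -
      have "{x - e..y} \<subseteq> B" using that sub by auto
      then show ?thesis
        using that primitive_on_integral[OF p, of "x - e" y] primitive_on_integrable[OF p, of "x - e" y]
        by (simp add: set_borel_integral_eq_integral(2))
    qed
  qed (use e in auto)
  then show ?thesis
    using e at_within_interior[of x "{x - e..x + e}"]
    by (simp add: has_real_derivative_iff_has_vector_derivative)
qed

lemma set_integral_Icc_combine:
  fixes w :: "real \<Rightarrow> real"
  assumes w: "set_integrable lborel {a..c} w" and abc: "a \<le> b" "b \<le> c"
  shows "(LINT x:{a..c}|lborel. w x) = (LINT x:{a..b}|lborel. w x) + (LINT x:{b..c}|lborel. w x)"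
proof -
  have "set_integrable lborel {a..b} w" "set_integrable lborel {b..c} w"
    using assms by (auto intro: set_integrable_subset)
  then show ?thesis
    using w Henstock_Kurzweil_Integration.integral_combine[OF abc, of w]
    by (simp add: set_borel_integral_eq_integral)
qed

lemma set_borel_measurable_mult:
  fixes f g :: "'a \<Rightarrow> real"
  assumes "set_borel_measurable M A f" "set_borel_measurable M A g"
  shows "set_borel_measurable M A (\<lambda>x. f x * g x)"
proof -
  have "(\<lambda>x. indicator A x *\<^sub>R (f x * g x)) = (\<lambda>x. (indicator A x *\<^sub>R f x) * (indicator A x *\<^sub>R g x))"
    by (auto simp: indicator_def)
  then show ?thesis
    using assms unfolding set_borel_measurable_def by simp
qed

lemma set_integrable_imp_set_borel_measurable: "set_integrable M A f \<Longrightarrow> set_borel_measurable M A f"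
  unfolding set_integrable_def set_borel_measurable_def by (rule borel_measurable_integrable)

lemma set_borel_measurable_continuous_on:
  fixes f :: "'a::euclidean_space \<Rightarrow> real"
  assumes "continuous_on A f" "A \<in> sets borel"
  shows "set_borel_measurable lborel A f"
  using set_measurable_continuous_on[OF assms(2,1)] unfolding set_borel_measurable_def by simp

lemma set_integrable_mult_continuous:
  fixes w h :: "real \<Rightarrow> real"
  assumes w: "set_integrable lborel {a..b} w" and h: "continuous_on {a..b} h"
  shows "set_integrable lborel {a..b} (\<lambda>x. h x * w x)"
proof -
  obtain K where K: "\<And>x. x \<in> {a..b} \<Longrightarrow> \<bar>h x\<bar> \<le> K"
    using compact_imp_bounded[OF compact_continuous_image[OF h compact_Icc]]
    unfolding bounded_iff by (metis imageI real_norm_def)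
  show ?thesis
  proof (rule set_integrable_bound)
    show "set_integrable lborel {a..b} (\<lambda>x. K * w x)" using w by simp
    show "set_borel_measurable lborel {a..b} (\<lambda>x. h x * w x)"
      using h w by (intro set_borel_measurable_mult set_borel_measurable_continuous_on
          set_integrable_imp_set_borel_measurable) auto
    show "AE x in lborel. x \<in> {a..b} \<longrightarrow> norm (h x * w x) \<le> norm (K * w x)"
      using K by (force simp: abs_mult intro!: AE_I2 mult_right_mono)
  qed
qed

subsection \<open>The chain rule for primitives\<close>

lemma MVT_closed_segment:
  fixes H H' :: "real \<Rightarrow> real"
  assumes H: "\<And>y. y \<in> closed_segment p q \<Longrightarrow> (H has_real_derivative H' y) (at y)"
  obtains \<xi> where "\<xi> \<in> closed_segment p q" "H q - H p = H' \<xi> * (q - p)"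
proof (cases p q rule: linorder_cases)
  case less
  have "(H has_real_derivative H' y) (at y)" if "p \<le> y" "y \<le> q" for y
    using H that by (simp add: closed_segment_eq_real_ivl)
  then obtain z where "p < z" "z < q" "H q - H p = (q - p) * H' z"
    using MVT2[OF less] by blast
  then show thesis
    using that[of z] by (simp add: closed_segment_eq_real_ivl mult.commute)
next
  case equal
  then show thesis using that[of p] by simp
next
  case greater
  have "(H has_real_derivative H' y) (at y)" if "q \<le> y" "y \<le> p" for y
    using H that by (simp add: closed_segment_eq_real_ivl)
  then obtain z where "q < z" "z < p" "H p - H q = (p - q) * H' z"
    using MVT2[OF greater] by blast
  then show thesis
    using that[of z] by (simp add: closed_segment_eq_real_ivl algebra_simps)
qed

text \<open>A primitive of a merely integrable function need not be differentiable at a given point. The chain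
  rule holds because its defect on an interval is additive over adjacent intervals and locally
  arbitrarily small compared with the integral of \<open>\<bar>w\<bar>\<close>.\<close>

lemma additive_eq_zero_if_locally_small:
  fixes D m :: "real \<Rightarrow> real \<Rightarrow> real"
  assumes ab: "a \<le> b"
    and D: "\<And>x y z. a \<le> x \<Longrightarrow> x \<le> y \<Longrightarrow> y \<le> z \<Longrightarrow> z \<le> b \<Longrightarrow> D x z = D x y + D y z"
    and m: "\<And>x y z. a \<le> x \<Longrightarrow> x \<le> y \<Longrightarrow> y \<le> z \<Longrightarrow> z \<le> b \<Longrightarrow> m x z = m x y + m y z"
    and small: "\<And>x e. x \<in> {a..b} \<Longrightarrow> e > 0 \<Longrightarrow>
      \<exists>d>0. \<forall>y z. a \<le> y \<and> y \<le> x \<and> x \<le> z \<and> z \<le> b \<and> z - y < d \<longrightarrow> \<bar>D y z\<bar> \<le> e * m y z"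
  shows "D a b = 0"
proof -
  have D_le: "\<bar>D a b\<bar> \<le> e * m a b" if e: "e > 0" for e
  proof -
    define P where "P x z \<longleftrightarrow> (a \<le> x \<longrightarrow> z \<le> b \<longrightarrow> \<bar>D x z\<bar> \<le> e * m x z)" for x z
    have "P a b"
      using ab
    proof (induction rule: Bolzano)
      case (trans x y z)
      show ?case
        unfolding P_def
      proof (intro impI)
        assume xz: "a \<le> x" "z \<le> b"
        then have "\<bar>D x y\<bar> \<le> e * m x y" "\<bar>D y z\<bar> \<le> e * m y z"
          using trans by (auto simp: P_def)
        then show "\<bar>D x z\<bar> \<le> e * m x z"
          using D[OF xz(1) trans(3,4) xz(2)] m[OF xz(1) trans(3,4) xz(2)] by (simp add: distrib_left)
      qed
    next
      case (local x)
      then show ?case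
        using small[OF _ e, of x] unfolding P_def atLeastAtMost_iff by blast
    qed
    then show ?thesis by (simp add: P_def)
  qed
  have "\<bar>D a b\<bar> \<le> 0 + e" if "e > 0" for e
  proof -
    have "\<bar>D a b\<bar> \<le> e / (\<bar>m a b\<bar> + 1) * m a b"
      by (rule D_le) (use that in \<open>auto intro!: divide_pos_pos\<close>)
    also have "\<dots> \<le> e / (\<bar>m a b\<bar> + 1) * (\<bar>m a b\<bar> + 1)" using that by (intro mult_left_mono) auto
    finally show ?thesis by simp
  qed
  then show ?thesis using field_le_epsilon[of "\<bar>D a b\<bar>" 0] by simp
qed

lemma primitive_comp_defect_le:
  assumes p: "primitive_on {y..z} v w" and yz: "y \<le> z"
    and H: "\<And>\<xi>. \<xi> \<in> closed_segment (v y) (v z) \<Longrightarrow> (H has_real_derivative H' \<xi>) (at \<xi>)"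
    and cont: "continuous_on {y..z} (\<lambda>x. H' (v x))"
    and osc: "\<And>\<xi> x. \<xi> \<in> closed_segment (v y) (v z) \<Longrightarrow> x \<in> {y..z} \<Longrightarrow> \<bar>H' \<xi> - H' (v x)\<bar> \<le> e"
  shows "\<bar>H (v z) - H (v y) - (LINT x:{y..z}|lborel. H' (v x) * w x)\<bar> \<le> e * (LINT x:{y..z}|lborel. \<bar>w x\<bar>)"
proof -
  obtain \<xi> where \<xi>: "\<xi> \<in> closed_segment (v y) (v z)" "H (v z) - H (v y) = H' \<xi> * (v z - v y)"
    using MVT_closed_segment[of "v y" "v z" H H'] H by blast
  have integrable_w: "set_integrable lborel {y..z} w"
    by (rule primitive_on_integrable[OF p]) simp
  have integrable_Hw: "set_integrable lborel {y..z} (\<lambda>x. H' (v x) * w x)"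
    by (rule set_integrable_mult_continuous[OF integrable_w cont])
  have integrable_diff: "set_integrable lborel {y..z} (\<lambda>x. H' \<xi> * w x - H' (v x) * w x)"
    using integrable_w integrable_Hw by (intro set_integral_diff) auto
  have "H (v z) - H (v y) - (LINT x:{y..z}|lborel. H' (v x) * w x)
      = (LINT x:{y..z}|lborel. H' \<xi> * w x - H' (v x) * w x)"
    using primitive_on_integral[OF p yz] integrable_w integrable_Hw \<xi>(2) by simp
  also have "\<bar>\<dots>\<bar> \<le> (LINT x:{y..z}|lborel. \<bar>H' \<xi> * w x - H' (v x) * w x\<bar>)"
    using set_integral_norm_bound[OF integrable_diff] by simp
  also have "\<dots> \<le> (LINT x:{y..z}|lborel. e * \<bar>w x\<bar>)"
  proof (rule set_integral_mono[OF set_integrable_abs[OF integrable_diff]])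
    show "set_integrable lborel {y..z} (\<lambda>x. e * \<bar>w x\<bar>)"
      using set_integrable_abs[OF integrable_w] by simp
    show "\<bar>H' \<xi> * w x - H' (v x) * w x\<bar> \<le> e * \<bar>w x\<bar>" if "x \<in> {y..z}" for x
      using mult_right_mono[OF osc[OF \<xi>(1) that], of "\<bar>w x\<bar>"]
      by (simp add: abs_mult left_diff_distrib[symmetric])
  qed
  finally show ?thesis by simp
qed

lemma primitive_comp_defect_small:
  assumes p: "primitive_on B v w" and J: "convex J"
    and H: "\<And>y. y \<in> J \<Longrightarrow> (H has_real_derivative H' y) (at y)" and H': "continuous_on J H'"
    and vJ: "\<And>x. x \<in> B \<Longrightarrow> v x \<in> J" and ab: "{a..b} \<subseteq> B" and x: "x \<in> {a..b}" and e: "0 < e"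
  shows "\<exists>d>0. \<forall>y z. a \<le> y \<and> y \<le> x \<and> x \<le> z \<and> z \<le> b \<and> z - y < d \<longrightarrow>
    \<bar>H (v z) - H (v y) - (LINT s:{y..z}|lborel. H' (v s) * w s)\<bar> \<le> e * (LINT s:{y..z}|lborel. \<bar>w s\<bar>)"
proof -
  have v: "continuous_on {a..b} v" by (rule primitive_on_continuous_Icc[OF p ab])
  have H'v_continuous: "continuous_on {a..b} (\<lambda>x. H' (v x))"
    by (rule continuous_on_compose2[OF H' v]) (use vJ ab in auto)
  obtain \<eta> where \<eta>: "\<eta> > 0" "\<And>\<xi>. \<xi> \<in> J \<Longrightarrow> \<bar>\<xi> - v x\<bar> < \<eta> \<Longrightarrow> \<bar>H' \<xi> - H' (v x)\<bar> < e / 2"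
    using H' vJ x ab e unfolding continuous_on_iff dist_real_def by (metis half_gt_zero subsetD)
  obtain d where d: "d > 0" "\<And>s. s \<in> {a..b} \<Longrightarrow> \<bar>s - x\<bar> < d \<Longrightarrow> \<bar>v s - v x\<bar> < \<eta>"
    using v x \<eta>(1) unfolding continuous_on_iff dist_real_def by metis
  define U where "U = J \<inter> ball (v x) \<eta>"
  have osc: "\<bar>H' \<xi> - H' \<zeta>\<bar> \<le> e" if "\<xi> \<in> U" "\<zeta> \<in> U" for \<xi> \<zeta>
  proof -
    have "\<bar>H' \<xi> - H' (v x)\<bar> < e / 2" "\<bar>H' \<zeta> - H' (v x)\<bar> < e / 2"
      using that by (auto simp: U_def dist_real_def abs_minus_commute intro!: \<eta>(2) simp del: less_divide_eq_numeral1)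
    then show ?thesis by linarith
  qed
  show ?thesis
  proof (intro exI[of _ d] conjI d(1) allI impI)
    fix y z assume yz: "a \<le> y \<and> y \<le> x \<and> x \<le> z \<and> z \<le> b \<and> z - y < d"
    then have sub: "{y..z} \<subseteq> {a..b}" by auto
    have U: "v s \<in> U" if "s \<in> {y..z}" for s
    proof -
      have "s \<in> {a..b}" "\<bar>s - x\<bar> < d" using that yz by auto
      then have "v s \<in> J" "\<bar>v s - v x\<bar> < \<eta>" using vJ ab d(2) by blast+
      then show ?thesis by (simp add: U_def dist_real_def abs_minus_commute)
    qed
    have "convex U" unfolding U_def using J by (intro convex_Int) auto
    then have seg: "closed_segment (v y) (v z) \<subseteq> U"
      using U yz by (intro closed_segment_subset) auto
    show "\<bar>H (v z) - H (v y) - (LINT s:{y..z}|lborel. H' (v s) * w s)\<bar> \<le> e * (LINT s:{y..z}|lborel. \<bar>w s\<bar>)"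
    proof (rule primitive_comp_defect_le)
      show "continuous_on {y..z} (\<lambda>x. H' (v x))" by (rule continuous_on_subset[OF H'v_continuous sub])
      show "primitive_on {y..z} v w"
        by (rule primitive_on_subset[OF p]) (use sub ab in blast)
      show "y \<le> z" using yz by simp
      show "(H has_real_derivative H' \<xi>) (at \<xi>)" if "\<xi> \<in> closed_segment (v y) (v z)" for \<xi>
        by (rule H) (use that seg in \<open>auto simp: U_def\<close>)
      show "\<bar>H' \<xi> - H' (v s)\<bar> \<le> e" if "\<xi> \<in> closed_segment (v y) (v z)" "s \<in> {y..z}" for \<xi> s
        by (rule osc) (use that seg U in auto)
    qed
  qed
qed

lemma primitive_on_comp:
  fixes H H' :: "real \<Rightarrow> real"
  assumes p: "primitive_on B v w" and J: "convex J"
    and H: "\<And>y. y \<in> J \<Longrightarrow> (H has_real_derivative H' y) (at y)" and H': "continuous_on J H'"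
    and vJ: "\<And>x. x \<in> B \<Longrightarrow> v x \<in> J"
  shows "primitive_on B (\<lambda>x. H (v x)) (\<lambda>x. H' (v x) * w x)"
proof (rule primitive_onI)
  fix a b :: real assume ab: "a \<le> b" "{a..b} \<subseteq> B"
  have v: "continuous_on {a..b} v" by (rule primitive_on_continuous_Icc[OF p ab(2)])
  have H'v_continuous: "continuous_on {a..b} (\<lambda>x. H' (v x))"
    by (rule continuous_on_compose2[OF H' v]) (use vJ ab in auto)
  have w: "set_integrable lborel {a..b} w" by (rule primitive_on_integrable[OF p ab(2)])
  show integrable_H'w: "set_integrable lborel {a..b} (\<lambda>x. H' (v x) * w x)"
    by (rule set_integrable_mult_continuous[OF w H'v_continuous])
  have "H (v b) - H (v a) - (LINT x:{a..b}|lborel. H' (v x) * w x) = 0"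
  proof (rule additive_eq_zero_if_locally_small[where a = a and b = b and
        D = "\<lambda>y z. H (v z) - H (v y) - (LINT x:{y..z}|lborel. H' (v x) * w x)" and
        m = "\<lambda>y z. LINT x:{y..z}|lborel. \<bar>w x\<bar>"])
    fix x y z assume xyz: "a \<le> x" "x \<le> y" "y \<le> z" "z \<le> b"
    then have sub: "{x..z} \<subseteq> {a..b}" by auto
    show "H (v z) - H (v x) - (LINT s:{x..z}|lborel. H' (v s) * w s) =
        H (v y) - H (v x) - (LINT s:{x..y}|lborel. H' (v s) * w s) +
        (H (v z) - H (v y) - (LINT s:{y..z}|lborel. H' (v s) * w s))"
      using set_integral_Icc_combine[OF set_integrable_subset[OF integrable_H'w _ sub] xyz(2,3)] by simp
    show "(LINT s:{x..z}|lborel. \<bar>w s\<bar>) = (LINT s:{x..y}|lborel. \<bar>w s\<bar>) + (LINT s:{y..z}|lborel. \<bar>w s\<bar>)"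
      by (rule set_integral_Icc_combine[OF set_integrable_subset[OF set_integrable_abs[OF w] _ sub] xyz(2,3)]) simp
  next
    show "\<exists>d>0. \<forall>y z. a \<le> y \<and> y \<le> x \<and> x \<le> z \<and> z \<le> b \<and> z - y < d \<longrightarrow>
        \<bar>H (v z) - H (v y) - (LINT s:{y..z}|lborel. H' (v s) * w s)\<bar> \<le> e * (LINT s:{y..z}|lborel. \<bar>w s\<bar>)"
      if "x \<in> {a..b}" "0 < e" for x e
      by (rule primitive_comp_defect_small[OF p J H H' vJ ab(2) that])
  qed (rule ab(1))
  then show "(LINT x:{a..b}|lborel. H' (v x) * w x) = H (v b) - H (v a)" by simp
qed

lemma primitive_on_mult:
  assumes v: "primitive_on B v w" and v': "primitive_on B v' w'"
  shows "primitive_on B (\<lambda>x. v x * v' x) (\<lambda>x. w x * v' x + v x * w' x)"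
proof -
  have square: "primitive_on B (\<lambda>x. (z x)\<^sup>2) (\<lambda>x. 2 * z x * y x)" if "primitive_on B z y" for z y
    by (rule primitive_on_comp[OF that, of UNIV "\<lambda>x. x\<^sup>2" "\<lambda>x. 2 * x"])
       (auto intro!: derivative_eq_intros continuous_intros)
  have "primitive_on B (\<lambda>x. v x + (-1) * v' x) (\<lambda>x. w x + (-1) * w' x)"
    by (intro primitive_on_add primitive_on_cmult v v')
  from primitive_on_add[OF primitive_on_cmult[OF square[OF primitive_on_add[OF v v']], of "1 / 4"]
    primitive_on_cmult[OF square[OF this], of "- (1 / 4)"]]
  show ?thesis
    by (rule primitive_on_cong) (simp_all add: power2_eq_square algebra_simps)
qed

subsection \<open>Test functions\<close>

primrec times_differentiable :: "nat \<Rightarrow> (real \<Rightarrow> real) \<Rightarrow> bool" where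
  "times_differentiable 0 f \<longleftrightarrow> True"
| "times_differentiable (Suc n) f \<longleftrightarrow> (\<forall>x. f differentiable (at x)) \<and> times_differentiable n (deriv f)"

lemma times_differentiable_iff:
  "times_differentiable n f \<longleftrightarrow> (\<forall>i<n. \<forall>x. ((deriv ^^ i) f) differentiable (at x))"
proof (induction n arbitrary: f)
  case (Suc n)
  have "(deriv ^^ Suc i) f = (deriv ^^ i) (deriv f)" for i by (simp add: funpow_swap1)
  then have "times_differentiable (Suc n) f \<longleftrightarrow> (\<forall>x. ((deriv ^^ 0) f) differentiable (at x)) \<and>
      (\<forall>i<n. \<forall>x. ((deriv ^^ Suc i) f) differentiable (at x))"
    by (simp add: Suc.IH)
  then show ?case by (auto simp: less_Suc_eq_0_disj simp del: funpow.simps(2))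
qed simp

lemma times_differentiable_SucI:
  assumes "\<And>x. (f has_real_derivative f' x) (at x)" "times_differentiable n f'"
  shows "times_differentiable (Suc n) f"
proof -
  have "deriv f = f'" using assms(1) DERIV_imp_deriv by blast
  then show ?thesis using assms by (auto simp: real_differentiable_def)
qed

lemma times_differentiable_SucE:
  assumes "times_differentiable (Suc n) f"
  obtains f' where "\<And>x. (f has_real_derivative f' x) (at x)" "times_differentiable n f'"
  using assms that[of "deriv f"] by (auto simp: DERIV_deriv_iff_real_differentiable)

lemma times_differentiable_SucD: "times_differentiable (Suc n) f \<Longrightarrow> times_differentiable n f"
  by (simp add: times_differentiable_iff)

lemma times_differentiable_add:
  "times_differentiable n f \<Longrightarrow> times_differentiable n g \<Longrightarrow> times_differentiable n (\<lambda>x. f x + g x)"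
proof (induction n arbitrary: f g)
  case (Suc n)
  obtain f' where f': "\<And>x. (f has_real_derivative f' x) (at x)" "times_differentiable n f'"
    using times_differentiable_SucE[OF Suc.prems(1)] by blast
  obtain g' where g': "\<And>x. (g has_real_derivative g' x) (at x)" "times_differentiable n g'"
    using times_differentiable_SucE[OF Suc.prems(2)] by blast
  show ?case
    by (rule times_differentiable_SucI[where f' = "\<lambda>x. f' x + g' x"])
       (auto intro!: derivative_eq_intros f' g' Suc.IH)
qed simp

lemma times_differentiable_cmult:
  "times_differentiable n f \<Longrightarrow> times_differentiable n (\<lambda>x. c * f x)"
proof (induction n arbitrary: f)
  case (Suc n)
  obtain f' where f': "\<And>x. (f has_real_derivative f' x) (at x)" "times_differentiable n f'"
    using times_differentiable_SucE[OF Suc.prems(1)] by blast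
  show ?case
    by (rule times_differentiable_SucI[where f' = "\<lambda>x. c * f' x"])
       (auto intro!: derivative_eq_intros f' Suc.IH)
qed simp

lemma times_differentiable_mult:
  "times_differentiable n f \<Longrightarrow> times_differentiable n g \<Longrightarrow> times_differentiable n (\<lambda>x. f x * g x)"
proof (induction n arbitrary: f g)
  case (Suc n)
  obtain f' where f': "\<And>x. (f has_real_derivative f' x) (at x)" "times_differentiable n f'"
    using times_differentiable_SucE[OF Suc.prems(1)] by blast
  obtain g' where g': "\<And>x. (g has_real_derivative g' x) (at x)" "times_differentiable n g'"
    using times_differentiable_SucE[OF Suc.prems(2)] by blast
  show ?case
  proof (rule times_differentiable_SucI)
    show "((\<lambda>x. f x * g x) has_real_derivative f' x * g x + f x * g' x) (at x)" for x
      by (auto intro!: derivative_eq_intros f' g')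
    show "times_differentiable n (\<lambda>x. f' x * g x + f x * g' x)"
      by (intro times_differentiable_add Suc.IH f' g' Suc.prems[THEN times_differentiable_SucD])
  qed
qed simp

lemma times_differentiable_affine:
  "times_differentiable n f \<Longrightarrow> times_differentiable n (\<lambda>x. f (c * x + d))"
proof (induction n arbitrary: f)
  case (Suc n)
  obtain f' where f': "\<And>x. (f has_real_derivative f' x) (at x)" "times_differentiable n f'"
    using times_differentiable_SucE[OF Suc.prems(1)] by blast
  show ?case
  proof (rule times_differentiable_SucI)
    show "((\<lambda>x. f (c * x + d)) has_real_derivative c * f' (c * x + d)) (at x)" for x
      by (rule DERIV_cong[OF DERIV_chain2[OF f'(1)]]) (auto intro!: derivative_eq_intros)
    show "times_differentiable n (\<lambda>x. c * f' (c * x + d))"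
      by (intro times_differentiable_cmult Suc.IH f')
  qed
qed simp

definition flat :: "nat \<Rightarrow> real \<Rightarrow> real" where
  "flat n x = (if x > 0 then (1 / x) ^ n * exp (- (1 / x)) else 0)"

lemma flat_tendsto_0: "(flat n \<longlongrightarrow> 0) (at 0)"
proof -
  have left: "(flat n \<longlongrightarrow> 0) (at_left 0)"
    by (rule tendsto_eventually) (auto simp: flat_def eventually_at_filter)
  have "((\<lambda>x::real. (inverse x) ^ n / exp (inverse x)) \<longlongrightarrow> 0) (at_right 0)"
    by (rule filterlim_compose[OF tendsto_power_div_exp_0 filterlim_inverse_at_top_right])
  then have right: "(flat n \<longlongrightarrow> 0) (at_right 0)"
    by (rule Lim_transform_eventually)
       (auto simp: flat_def eventually_at_filter exp_minus divide_inverse)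
  show ?thesis using filterlim_split_at[OF left right] .
qed

lemma flat_has_real_derivative:
  "(flat n has_real_derivative (- real n * flat (n + 1) x + flat (n + 2) x)) (at x)"
proof -
  consider (pos) "x > 0" | (neg) "x < 0" | (zero) "x = 0" by linarith
  then show ?thesis
  proof cases
    case pos
    have "((\<lambda>x. (1 / x) ^ n * exp (- (1 / x))) has_real_derivative
       (- real n * flat (n + 1) x + flat (n + 2) x)) (at x)"
    proof (cases n)
      case 0
      then show ?thesis using pos
        by (auto intro!: derivative_eq_intros simp: flat_def power2_eq_square field_simps)
    next
      case (Suc m)
      then show ?thesis using pos
        by (auto intro!: derivative_eq_intros simp: flat_def field_simps) (cases m; simp)
    qed
    moreover have "eventually (\<lambda>y. flat n y = (1 / y) ^ n * exp (- (1 / y))) (nhds x)"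
      using eventually_nhds_in_open[of "{0<..}" x] pos
      by (auto elim!: eventually_mono simp: flat_def)
    ultimately show ?thesis by (subst DERIV_cong_ev[OF refl _ refl])
  next
    case neg
    have "eventually (\<lambda>y. flat n y = 0) (nhds x)"
      using eventually_nhds_in_open[of "{..<0}" x] neg
      by (auto elim!: eventually_mono simp: flat_def)
    moreover have "((\<lambda>x. 0) has_real_derivative
       (- real n * flat (n + 1) x + flat (n + 2) x)) (at x)"
      using neg by (auto simp: flat_def)
    ultimately show ?thesis by (subst DERIV_cong_ev[OF refl _ refl])
  next
    case zero
    have "((\<lambda>h. (flat n (0 + h) - flat n 0) / h) \<longlongrightarrow> 0) (at 0)"
      by (rule Lim_transform_eventually[OF flat_tendsto_0[of "Suc n"]])
         (auto simp: flat_def eventually_at_filter)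
    then show ?thesis using zero by (simp add: DERIV_def) (simp add: flat_def)
  qed
qed

lemma times_differentiable_flat: "times_differentiable m (flat n)"
proof (induction m arbitrary: n)
  case (Suc m)
  show ?case
    by (rule times_differentiable_SucI[OF flat_has_real_derivative])
       (intro times_differentiable_add times_differentiable_cmult Suc)
qed simp

definition bump :: "nat \<Rightarrow> real \<Rightarrow> real \<Rightarrow> real \<Rightarrow> real" where
  "bump n a b x = flat 0 (real (Suc n) * (x - a)) * flat 0 (real (Suc n) * (b - x))"

lemma times_differentiable_bump: "times_differentiable m (bump n a b)"
proof -
  have "times_differentiable m (\<lambda>x. flat 0 (real (Suc n) * x + (- real (Suc n) * a)) *
      flat 0 ((- real (Suc n)) * x + real (Suc n) * b))"
    by (intro times_differentiable_mult times_differentiable_affine times_differentiable_flat)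
  then show ?thesis unfolding bump_def[abs_def] by (simp add: algebra_simps)
qed

lemma flat_0_bounds: "0 \<le> flat 0 x" "flat 0 x \<le> 1" by (auto simp: flat_def)

lemma bump_bounds: "0 \<le> bump n a b x" "bump n a b x \<le> 1"
  unfolding bump_def by (auto intro!: mult_nonneg_nonneg mult_le_one flat_0_bounds)

lemma bump_eq_0: "x \<notin> {a<..<b} \<Longrightarrow> bump n a b x = 0"
  by (auto simp: bump_def flat_def zero_less_mult_iff)

lemma bump_pos: "x \<in> {a<..<b} \<Longrightarrow> bump n a b x > 0"
  by (auto simp: bump_def flat_def)

lemma bump_tendsto:
  assumes "x \<in> {a<..<b}"
  shows "(\<lambda>n. bump n a b x) \<longlonglongrightarrow> 1"
proof -
  have exp_tendsto_1: "(\<lambda>n. exp (- (1 / (real (Suc n) * y)))) \<longlonglongrightarrow> 1" if "y > 0" for y :: real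
  proof -
    have "(\<lambda>n. exp (- ((1 / y) * inverse (real (Suc n))))) \<longlonglongrightarrow> exp (- ((1/y) * 0))"
      by (intro tendsto_intros LIMSEQ_inverse_real_of_nat)
    then show ?thesis by (simp add: divide_inverse mult.commute)
  qed
  have "(\<lambda>n. exp (- (1 / (real (Suc n) * (x - a)))) * exp (- (1 / (real (Suc n) * (b - x))))) \<longlonglongrightarrow> 1 * 1"
    by (intro tendsto_mult exp_tendsto_1) (use assms in auto)
  then show ?thesis using assms by (simp add: bump_def flat_def)
qed

lemma test_fun_iff:
  "test_fun B \<phi> \<longleftrightarrow> (\<forall>n. times_differentiable n \<phi>) \<and> (\<exists>a b. {a..b} \<subseteq> B \<and> (\<forall>x. x \<notin> {a..b} \<longrightarrow> \<phi> x = 0))"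
proof -
  have "(\<forall>n. times_differentiable n \<phi>) \<longleftrightarrow> (\<forall>n x. ((deriv ^^ n) \<phi>) differentiable (at x))"
    unfolding times_differentiable_iff by (blast intro: lessI)
  then show ?thesis unfolding test_fun_def by simp
qed

lemma test_fun_times_differentiable: "test_fun B \<phi> \<Longrightarrow> times_differentiable n \<phi>"
  by (simp add: test_fun_iff)

lemma test_funE:
  assumes "test_fun B \<phi>"
  obtains a b where "{a..b} \<subseteq> B" "\<And>x. x \<notin> {a..b} \<Longrightarrow> \<phi> x = 0"
  using assms unfolding test_fun_iff by blast

lemma test_fun_bump:
  assumes "{a..b} \<subseteq> B"
  shows "test_fun B (bump n a b)"
proof -
  have "\<forall>x. x \<notin> {a..b} \<longrightarrow> bump n a b x = 0"
    by (intro allI impI bump_eq_0) auto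
  then show ?thesis unfolding test_fun_iff using times_differentiable_bump assms by blast
qed

lemma test_fun_UNIV_add_cmult:
  assumes \<phi>: "test_fun UNIV \<phi>" and \<psi>: "test_fun UNIV \<psi>"
  shows "test_fun UNIV (\<lambda>x. \<phi> x + c * \<psi> x)"
proof -
  obtain a b a' b' where "\<And>x. x \<notin> {a..b} \<Longrightarrow> \<phi> x = 0" "\<And>x. x \<notin> {a'..b'} \<Longrightarrow> \<psi> x = 0"
    using test_funE[OF \<phi>] test_funE[OF \<psi>] by metis
  then have "\<phi> x + c * \<psi> x = 0" if "x \<notin> {min a a'..max b b'}" for x
    using that by (auto simp: min_le_iff_disj le_max_iff_disj)
  moreover have "times_differentiable n (\<lambda>x. \<phi> x + c * \<psi> x)" for n
    by (intro times_differentiable_add times_differentiable_cmult test_fun_times_differentiable[OF \<phi>]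
        test_fun_times_differentiable[OF \<psi>])
  ultimately show ?thesis unfolding test_fun_iff by blast
qed

lemma test_fun_has_real_derivative:
  assumes "test_fun B \<phi>"
  shows "(\<phi> has_real_derivative deriv \<phi> x) (at x)"
  using test_fun_times_differentiable[OF assms, of 1] by (simp add: DERIV_deriv_iff_real_differentiable)

lemma test_fun_continuous: "test_fun B \<phi> \<Longrightarrow> continuous_on A \<phi>"
  by (intro continuous_at_imp_continuous_on ballI DERIV_isCont[OF test_fun_has_real_derivative])

lemma test_fun_eq_0_at_endpoints:
  assumes t: "test_fun B \<phi>" and zero: "\<And>x. x \<notin> {a..b} \<Longrightarrow> \<phi> x = 0"
  shows "\<phi> a = 0" "\<phi> b = 0"
proof -
  show "\<phi> a = 0"
    by (rule continuous_constant_on_closure[of "{..<a}", OF test_fun_continuous[OF t]]) (auto intro: zero)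
  show "\<phi> b = 0"
    by (rule continuous_constant_on_closure[of "{b<..}", OF test_fun_continuous[OF t]]) (auto intro: zero)
qed

lemma deriv_eq_0_outside_Icc:
  fixes \<phi> :: "real \<Rightarrow> real"
  assumes zero: "\<And>x. x \<notin> {a..b} \<Longrightarrow> \<phi> x = 0" and x: "x \<notin> {a..b}"
  shows "deriv \<phi> x = 0"
proof -
  have "eventually (\<lambda>y. y \<in> - {a..b}) (nhds x)"
    using x by (intro eventually_nhds_in_open) auto
  then have "eventually (\<lambda>y. \<phi> y = 0) (nhds x)"
    by eventually_elim (use zero in blast)
  then have "(\<phi> has_real_derivative 0) (at x)"
    by (subst DERIV_cong_ev[OF refl _ refl]) auto
  then show ?thesis by (rule DERIV_imp_deriv)
qed

lemma test_fun_deriv: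
  assumes "test_fun B \<phi>"
  shows "test_fun B (deriv \<phi>)"
proof -
  have "times_differentiable n (deriv \<phi>)" for n
    using test_fun_times_differentiable[OF assms, of "Suc n"] by simp
  moreover obtain a b where "{a..b} \<subseteq> B" "\<And>x. x \<notin> {a..b} \<Longrightarrow> \<phi> x = 0"
    using test_funE[OF assms] by blast
  ultimately show ?thesis
    unfolding test_fun_iff using deriv_eq_0_outside_Icc[of a b \<phi>] by blast
qed

lemma test_fun_deriv_funpow: "test_fun B \<phi> \<Longrightarrow> test_fun B ((deriv ^^ n) \<phi>)"
  by (induction n) (auto intro: test_fun_deriv)

lemma set_integral_mult_supported:
  fixes w \<phi> :: "real \<Rightarrow> real"
  assumes "{a..b} \<subseteq> B" "\<And>x. x \<notin> {a..b} \<Longrightarrow> \<phi> x = 0"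
  shows "(LINT x:B|lborel. w x * \<phi> x) = (LINT x:{a..b}|lborel. w x * \<phi> x)"
    and "set_integrable lborel B (\<lambda>x. w x * \<phi> x) \<longleftrightarrow> set_integrable lborel {a..b} (\<lambda>x. w x * \<phi> x)"
proof -
  have "(\<lambda>x. indicator B x *\<^sub>R (w x * \<phi> x)) = (\<lambda>x. indicator {a..b} x *\<^sub>R (w x * \<phi> x))"
    using assms by (auto simp: indicator_def fun_eq_iff subset_eq)
  then show "(LINT x:B|lborel. w x * \<phi> x) = (LINT x:{a..b}|lborel. w x * \<phi> x)"
    "set_integrable lborel B (\<lambda>x. w x * \<phi> x) \<longleftrightarrow> set_integrable lborel {a..b} (\<lambda>x. w x * \<phi> x)"
    unfolding set_lebesgue_integral_def set_integrable_def by simp_all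
qed

lemma set_integrable_mult_test_fun:
  assumes t: "test_fun B \<phi>" and w: "\<And>a b. {a..b} \<subseteq> B \<Longrightarrow> set_integrable lborel {a..b} w"
  shows "set_integrable lborel B (\<lambda>x. w x * \<phi> x)"
proof -
  obtain a b where ab: "{a..b} \<subseteq> B" "\<And>x. x \<notin> {a..b} \<Longrightarrow> \<phi> x = 0"
    using test_funE[OF t] by blast
  have "set_integrable lborel {a..b} (\<lambda>x. w x * \<phi> x)"
    using set_integrable_mult_continuous[OF w[OF ab(1)] test_fun_continuous[OF t]] by (simp add: mult.commute)
  then show ?thesis
    using set_integral_mult_supported(2)[of a b B \<phi> w] ab by blast
qed

lemma primitive_on_integral_by_parts:
  assumes p: "primitive_on B v w" and t: "test_fun B \<phi>"
  shows "(LINT x:B|lborel. v x * deriv \<phi> x) = - (LINT x:B|lborel. w x * \<phi> x)"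
proof -
  obtain a b where ab: "{a..b} \<subseteq> B" "\<And>x. x \<notin> {a..b} \<Longrightarrow> \<phi> x = 0"
    using test_funE[OF t] by blast
  have "(LINT x:{a..b}|lborel. v x * deriv \<phi> x) = - (LINT x:{a..b}|lborel. w x * \<phi> x)"
  proof (cases "a \<le> b")
    case True
    have "primitive_on B \<phi> (deriv \<phi>)"
      by (rule primitive_on_FTC[OF test_fun_has_real_derivative[OF t] test_fun_continuous[OF test_fun_deriv[OF t]]])
    from primitive_on_integral[OF primitive_on_mult[OF p this] True ab(1)]
    have "(LINT x:{a..b}|lborel. w x * \<phi> x + v x * deriv \<phi> x) = 0"
      using test_fun_eq_0_at_endpoints[OF t ab(2)] by simp
    moreover have "set_integrable lborel {a..b} (\<lambda>x. w x * \<phi> x)"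
      using set_integrable_mult_continuous[OF primitive_on_integrable[OF p ab(1)] test_fun_continuous[OF t]]
      by (simp add: mult.commute)
    moreover have "set_integrable lborel {a..b} (\<lambda>x. v x * deriv \<phi> x)"
      by (intro borel_integrable_atLeastAtMost' continuous_on_mult primitive_on_continuous_Icc[OF p ab(1)]
          test_fun_continuous[OF test_fun_deriv[OF t]])
    ultimately show ?thesis by simp
  qed (simp add: set_lebesgue_integral_def)
  moreover have "(LINT x:B|lborel. w x * \<phi> x) = (LINT x:{a..b}|lborel. w x * \<phi> x)"
    by (rule set_integral_mult_supported(1)[OF ab])
  moreover have "(LINT x:B|lborel. v x * deriv \<phi> x) = (LINT x:{a..b}|lborel. v x * deriv \<phi> x)"
    by (rule set_integral_mult_supported(1)[OF ab(1) deriv_eq_0_outside_Icc[OF ab(2)]])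
  ultimately show ?thesis by simp
qed

subsection \<open>The fundamental lemma of the calculus of variations\<close>

lemma set_integral_eq_0_if_annihilates_test_funs:
  assumes ab: "{a..b} \<subseteq> B" and h: "set_integrable lborel {a..b} h"
    and zero: "\<And>\<phi>. test_fun B \<phi> \<Longrightarrow> (LINT x:B|lborel. h x * \<phi> x) = 0"
  shows "(LINT x:{a..b}|lborel. h x) = 0"
proof -
  have bump_zero: "(LINT x|lborel. indicator {a..b} x *\<^sub>R (h x * bump n a b x)) = 0" for n
  proof -
    have "bump n a b x = 0" if "x \<notin> {a..b}" for x
      by (rule bump_eq_0) (use that in auto)
    then show ?thesis
      using zero[OF test_fun_bump[OF ab]] set_integral_mult_supported(1)[OF ab, of "bump n a b" h]
      by (simp add: set_lebesgue_integral_def)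
  qed
  have "(\<lambda>n. LINT x|lborel. indicator {a..b} x *\<^sub>R (h x * bump n a b x)) \<longlonglongrightarrow> (LINT x|lborel. indicator {a..b} x *\<^sub>R h x)"
  proof (rule integral_dominated_convergence[where w = "\<lambda>x. indicator {a..b} x *\<^sub>R \<bar>h x\<bar>"])
    show "(\<lambda>x. indicator {a..b} x *\<^sub>R h x) \<in> borel_measurable lborel"
      using set_integrable_imp_set_borel_measurable[OF h] unfolding set_borel_measurable_def .
    have "set_borel_measurable lborel {a..b} (\<lambda>x. h x * bump n a b x)" for n
      by (intro set_borel_measurable_mult set_integrable_imp_set_borel_measurable[OF h]
          set_borel_measurable_continuous_on test_fun_continuous[OF test_fun_bump[OF ab]]) simp
    then show "(\<lambda>x. indicator {a..b} x *\<^sub>R (h x * bump n a b x)) \<in> borel_measurable lborel" for n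
      unfolding set_borel_measurable_def .
    show "integrable lborel (\<lambda>x. indicator {a..b} x *\<^sub>R \<bar>h x\<bar>)"
      using set_integrable_abs[OF h] unfolding set_integrable_def .
    show "AE x in lborel. (\<lambda>n. indicator {a..b} x *\<^sub>R (h x * bump n a b x)) \<longlonglongrightarrow> indicator {a..b} x *\<^sub>R h x"
      using AE_lborel_singleton[of a] AE_lborel_singleton[of b]
    proof eventually_elim
      case (elim x)
      show ?case
      proof (cases "x \<in> {a<..<b}")
        case True
        from tendsto_mult_left[OF bump_tendsto[OF True], of "h x"] True show ?thesis by simp
      next
        case False
        then show ?thesis using elim by (auto simp: indicator_def)
      qed
    qed
    show "AE x in lborel. norm (indicator {a..b} x *\<^sub>R (h x * bump n a b x)) \<le> indicator {a..b} x *\<^sub>R \<bar>h x\<bar>" for n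
      using bump_bounds[of n a b] by (auto simp: indicator_def abs_mult intro!: AE_I2 mult_right_le_one_le)
  qed
  then show ?thesis
    using bump_zero by (simp add: set_lebesgue_integral_def LIMSEQ_const_iff)
qed

lemma AE_lborel_not_in_negligible:
  assumes "negligible N"
  shows "AE x in lborel. x \<notin> N"
  using assms AE_not_in[of N lebesgue] by (simp add: negligible_iff_null_sets AE_completion_iff)

lemma AE_eq_0_if_Icc_integrals_eq_0:
  fixes h :: "real \<Rightarrow> real"
  assumes h: "set_integrable lborel {a..b} h"
    and zero: "\<And>c d. a \<le> c \<Longrightarrow> d \<le> b \<Longrightarrow> (LINT x:{c..d}|lborel. h x) = 0"
  shows "AE x in lborel. x \<in> {a<..<b} \<longrightarrow> h x = 0"
proof -
  define g where "g x = indicator {a..b} x *\<^sub>R h x" for x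
  have "integrable lborel g"
    using h unfolding set_integrable_def g_def .
  then have "g integrable_on cbox c d" for c d
    using integrable_on_lborel integrable_on_subcbox by blast
  then obtain N where N: "negligible N" and lim: "\<And>x e. x \<notin> N \<Longrightarrow> 0 < e \<Longrightarrow>
      \<exists>d>0. \<forall>h. 0 < h \<and> h < d \<longrightarrow> norm (integral (cbox x (x + h *\<^sub>R One)) g /\<^sub>R h ^ DIM(real) - g x) < e"
    using integrable_ccontinuous_explicit by blast
  have h_eq_0: "h x = 0" if x: "x \<notin> N" "x \<in> {a<..<b}" for x
  proof (rule ccontr)
    assume "h x \<noteq> 0"
    moreover have "g x = h x" using x(2) by (simp add: g_def)
    ultimately obtain d where d: "d > 0" "\<And>t. 0 < t \<Longrightarrow> t < d \<Longrightarrow> \<bar>integral {x..x + t} g / t - g x\<bar> < \<bar>g x\<bar>"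
      using lim[OF x(1), of "\<bar>g x\<bar>"] by (auto simp: divide_inverse mult.commute)
    define t where "t = min (d / 2) (b - x)"
    have t: "0 < t" "t < d" "x + t \<le> b" "a \<le> x" using d(1) x(2) by (auto simp: t_def)
    have "integral {x..x + t} g = integral {x..x + t} h"
      by (rule integral_cong) (use t in \<open>auto simp: g_def\<close>)
    also have "\<dots> = (LINT y:{x..x + t}|lborel. h y)"
      using t by (intro set_borel_integral_eq_integral(2)[symmetric] set_integrable_subset[OF h]) auto
    also have "\<dots> = 0" using t by (intro zero)
    finally show False using d(2)[OF t(1,2)] by simp
  qed
  show ?thesis
    using AE_lborel_not_in_negligible[OF N] by eventually_elim (use h_eq_0 in blast)
qed

lemma AE_if_AE_on_Ioo:
  fixes B :: "real set"
  assumes B: "open B" and loc: "\<And>a b. {a..b} \<subseteq> B \<Longrightarrow> AE x in lborel. x \<in> {a<..<b} \<longrightarrow> P x"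
  shows "AE x in lborel. x \<in> B \<longrightarrow> P x"
proof -
  have "AE x in lborel. \<forall>q::rat \<times> rat. {of_rat (fst q)..of_rat (snd q)} \<subseteq> B \<longrightarrow>
      x \<in> {of_rat (fst q)<..<of_rat (snd q)} \<longrightarrow> P x"
    unfolding AE_all_countable using loc by auto
  then show ?thesis
  proof eventually_elim
    case (elim x)
    show ?case
    proof
      assume "x \<in> B"
      then obtain e where e: "e > 0" "{x - e..x + e} \<subseteq> B"
        using open_imp_Icc_neighbourhood[OF B] by blast
      obtain a where a: "x - e < of_rat a" "of_rat a < x" using of_rat_dense[of "x - e" x] e by auto
      obtain b where b: "x < of_rat b" "of_rat b < x + e" using of_rat_dense[of x "x + e"] e by auto
      have "{of_rat a..of_rat b} \<subseteq> B" using a b e(2) by force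
      then show "P x" using elim[rule_format, of "(a, b)"] a b by auto
    qed
  qed
qed

lemma fundamental_lemma_calculus_of_variations:
  assumes B: "open B" and h: "\<And>a b. {a..b} \<subseteq> B \<Longrightarrow> set_integrable lborel {a..b} h"
    and zero: "\<And>\<phi>. test_fun B \<phi> \<Longrightarrow> (LINT x:B|lborel. h x * \<phi> x) = 0"
  shows "AE x in lborel. x \<in> B \<longrightarrow> h x = 0"
proof (rule AE_if_AE_on_Ioo[OF B], rule AE_eq_0_if_Icc_integrals_eq_0)
  fix a b c d :: real assume ab: "{a..b} \<subseteq> B" "a \<le> c" "d \<le> b"
  then have "{c..d} \<subseteq> B" by (meson atLeastatMost_subset_iff order_trans)
  then show "(LINT x:{c..d}|lborel. h x) = 0"
    using set_integral_eq_0_if_annihilates_test_funs h zero by blast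
qed (rule h)

subsection \<open>Weak derivatives\<close>

lemma weak_deriv_unique:
  assumes B: "open B" and w: "weak_deriv B n v w" and w': "weak_deriv B n v w'"
  shows "AE x in lborel. x \<in> B \<longrightarrow> w x = w' x"
proof -
  have integrable: "set_integrable lborel {a..b} w" "set_integrable lborel {a..b} w'" if "{a..b} \<subseteq> B" for a b
    using w w' that unfolding weak_deriv_def by auto
  have "AE x in lborel. x \<in> B \<longrightarrow> w x - w' x = 0"
  proof (rule fundamental_lemma_calculus_of_variations[OF B])
    show "set_integrable lborel {a..b} (\<lambda>x. w x - w' x)" if "{a..b} \<subseteq> B" for a b
      using integrable[OF that] by simp
    fix \<phi> assume t: "test_fun B \<phi>"
    have "(-1) ^ n * (LINT x:B|lborel. w x * \<phi> x) = (-1) ^ n * (LINT x:B|lborel. w' x * \<phi> x)"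
      using w w' t unfolding weak_deriv_def by simp
    then show "(LINT x:B|lborel. (w x - w' x) * \<phi> x) = 0"
      using set_integrable_mult_test_fun[OF t integrable(1)] set_integrable_mult_test_fun[OF t integrable(2)]
      by (simp add: left_diff_distrib)
  qed
  then show ?thesis by simp
qed

lemma weak_deriv_Suc:
  assumes p: "primitive_on B v v'" and w: "weak_deriv B n v' w"
  shows "weak_deriv B (Suc n) v w"
  unfolding weak_deriv_def
proof (intro conjI allI impI)
  fix a b assume ab: "{a..b} \<subseteq> B"
  show "set_integrable lborel {a..b} v"
    by (rule borel_integrable_atLeastAtMost'[OF primitive_on_continuous_Icc[OF p ab]])
  show "set_integrable lborel {a..b} w"
    using w ab unfolding weak_deriv_def by blast
next
  fix \<phi> assume t: "test_fun B \<phi>"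
  have "(LINT x:B|lborel. v x * (deriv ^^ Suc n) \<phi> x) = - (LINT x:B|lborel. v' x * (deriv ^^ n) \<phi> x)"
    using primitive_on_integral_by_parts[OF p test_fun_deriv_funpow[OF t]] by simp
  also have "\<dots> = (-1) ^ Suc n * (LINT x:B|lborel. w x * \<phi> x)"
    using w t unfolding weak_deriv_def by simp
  finally show "(LINT x:B|lborel. v x * (deriv ^^ Suc n) \<phi> x) = (-1) ^ Suc n * (LINT x:B|lborel. w x * \<phi> x)" .
qed

lemma set_integrable_if_sq_int:
  assumes w: "sq_int B w" and ab: "{a..b} \<subseteq> B"
  shows "set_integrable lborel {a..b} w"
proof (rule set_integrable_bound)
  have "set_integrable lborel {a..b} (\<lambda>x. (w x)\<^sup>2)"
    using w ab unfolding sq_int_def by (auto intro: set_integrable_subset)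
  moreover have "set_integrable lborel {a..b} (\<lambda>_. 1 :: real)"
    by (rule borel_integrable_atLeastAtMost') simp
  ultimately show "set_integrable lborel {a..b} (\<lambda>x. 1 + (w x)\<^sup>2)" by simp
  show "set_borel_measurable lborel {a..b} w"
    using w ab unfolding sq_int_def by (auto intro: set_borel_measurable_subset)
  have "\<bar>y\<bar> \<le> 1 + y\<^sup>2" for y :: real
    using zero_le_power2[of "\<bar>y\<bar> - 1"] unfolding power2_diff power2_abs by simp
  then show "AE x in lborel. x \<in> {a..b} \<longrightarrow> norm (w x) \<le> norm (1 + (w x)\<^sup>2)"
    by (auto simp: abs_of_nonneg)
qed

lemma weak_deriv_0: "sq_int B v \<Longrightarrow> weak_deriv B 0 v v"
  by (simp add: weak_deriv_def set_integrable_if_sq_int)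

lemma Hdot_norm_eq_L2_norm_on:
  assumes B: "open B" and w: "weak_deriv B s v w" "sq_int B w"
  shows "Hdot_norm B s v = L2_norm_on B w"
proof -
  define w' where "w' = (SOME w. weak_deriv B s v w \<and> sq_int B w)"
  have w': "weak_deriv B s v w'" "sq_int B w'"
    using someI[of "\<lambda>w. weak_deriv B s v w \<and> sq_int B w" w] w by (auto simp: w'_def)
  have "(LINT x:B|lborel. (w' x)\<^sup>2) = (LINT x:B|lborel. (w x)\<^sup>2)"
    unfolding set_lebesgue_integral_def
  proof (rule integral_cong_AE)
    show "AE x in lborel. indicator B x *\<^sub>R (w' x)\<^sup>2 = indicator B x *\<^sub>R (w x)\<^sup>2"
      using weak_deriv_unique[OF B w'(1) w(1)] by eventually_elim (auto simp: indicator_def)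
  qed (use w(2) w'(2) borel_measurable_integrable in \<open>unfold sq_int_def set_integrable_def, blast+\<close>)
  then show ?thesis
    by (simp add: Hdot_norm_def w'_def[symmetric] L2_norm_on_def)
qed

subsection \<open>Continuous representatives of weakly differentiable functions\<close>

lemma test_fun_antiderivative:
  assumes t: "test_fun UNIV \<zeta>" and mean_zero: "(LINT x|lborel. \<zeta> x) = 0"
  obtains \<Phi> where "test_fun UNIV \<Phi>" "deriv \<Phi> = \<zeta>"
proof -
  obtain a b where ab: "\<And>x. x \<notin> {a..b} \<Longrightarrow> \<zeta> x = 0"
    using test_funE[OF t] by metis
  obtain \<Phi> where p: "primitive_on UNIV \<Phi> \<zeta>" and \<Phi>a: "\<Phi> a = 0"
    using primitive_on_exists[of UNIV a \<zeta> 0] borel_integrable_atLeastAtMost'[OF test_fun_continuous[OF t]]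
    by auto
  have deriv_\<Phi>: "(\<Phi> has_real_derivative \<zeta> x) (at x)" for x
    by (rule primitive_on_has_derivative[OF p]) (auto intro: test_fun_continuous[OF t])
  have "times_differentiable n \<Phi>" for n
    using times_differentiable_SucI[OF deriv_\<Phi> test_fun_times_differentiable[OF t]] times_differentiable_SucD by blast
  moreover have "\<Phi> x = 0" if "x \<notin> {a..max a b}" for x
  proof (cases "x < a")
    case True
    have "(LINT y:{x..a}|lborel. \<zeta> y) = (LINT y:{x..a}|lborel. 0)"
      by (rule set_lebesgue_integral_cong)
        (use ab test_fun_eq_0_at_endpoints[OF t ab] in \<open>auto simp: le_less\<close>)
    then show ?thesis using primitive_on_integral[OF p, of x a] True \<Phi>a by simp
  next
    case False
    then have x: "a \<le> x" "b < x" using that by auto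
    have "(LINT y:{a..x}|lborel. 1 * \<zeta> y) = (LINT y:UNIV|lborel. 1 * \<zeta> y)"
      by (rule set_integral_mult_supported(1)[symmetric]) (use ab x in auto)
    then have "(LINT y:{a..x}|lborel. \<zeta> y) = 0"
      using mean_zero by (simp add: set_lebesgue_integral_def)
    then show ?thesis using primitive_on_integral[OF p x(1)] \<Phi>a by simp
  qed
  ultimately have "test_fun UNIV \<Phi>" unfolding test_fun_iff by blast
  moreover have "deriv \<Phi> = \<zeta>" using deriv_\<Phi> DERIV_imp_deriv by blast
  ultimately show thesis by (rule that)
qed

lemma test_fun_integrable: "test_fun UNIV \<phi> \<Longrightarrow> integrable lborel \<phi>"
  using set_integrable_mult_test_fun[of UNIV \<phi> "\<lambda>_. 1"] borel_integrable_atLeastAtMost'[of _ _ "\<lambda>_. 1::real"]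
  by (simp add: set_integrable_def)

lemma integral_bump_pos:
  assumes ab: "a < b"
  shows "0 < (LINT x|lborel. bump n a b x)"
proof -
  have integrable_bump: "integrable lborel (bump n a b)"
    by (rule test_fun_integrable[OF test_fun_bump]) simp
  have "(LINT x|lborel. bump n a b x) \<noteq> 0"
  proof
    assume "(LINT x|lborel. bump n a b x) = 0"
    then have "AE x in lborel. bump n a b x = 0"
      using integral_nonneg_eq_0_iff_AE[OF integrable_bump] bump_bounds by auto
    then have "AE x in lborel. x \<notin> {a<..<b}"
      by eventually_elim (metis bump_pos less_irrefl)
    then have "emeasure lborel {a<..<b} = 0"
      by (subst (asm) AE_iff_measurable[of "{a<..<b}"]) auto
    then show False using ab by simp
  qed
  then show ?thesis
    using Bochner_Integration.integral_nonneg[of lborel "bump n a b"] bump_bounds by (simp add: less_le)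
qed

lemma AE_constant_if_annihilates_derivs:
  fixes h :: "real \<Rightarrow> real"
  assumes h: "\<And>a b. set_integrable lborel {a..b} h"
    and zero: "\<And>\<phi>. test_fun UNIV \<phi> \<Longrightarrow> (LINT x:UNIV|lborel. h x * deriv \<phi> x) = 0"
  obtains c where "AE x in lborel. h x = c"
proof -
  define \<eta> where "\<eta> x = bump 0 0 1 x" for x
  have \<eta>: "test_fun UNIV \<eta>" unfolding \<eta>_def by (rule test_fun_bump) simp
  have \<eta>_pos: "0 < (LINT x|lborel. \<eta> x)" unfolding \<eta>_def by (rule integral_bump_pos) simp
  define c where "c = (LINT x:UNIV|lborel. h x * \<eta> x) / (LINT x|lborel. \<eta> x)"
  have "AE x in lborel. x \<in> UNIV \<longrightarrow> h x - c = 0"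
  proof (rule fundamental_lemma_calculus_of_variations)
    show "set_integrable lborel {a..b} (\<lambda>x. h x - c)" for a b
      by (intro set_integral_diff(1) h borel_integrable_atLeastAtMost') auto
    fix \<psi> assume \<psi>: "test_fun UNIV \<psi>"
    define a where "a = - (LINT x|lborel. \<psi> x) / (LINT x|lborel. \<eta> x)"
    note integrable = test_fun_integrable[OF \<psi>] test_fun_integrable[OF \<eta>]
      set_integrable_mult_test_fun[OF \<psi> h, unfolded set_integrable_def]
      set_integrable_mult_test_fun[OF \<eta> h, unfolded set_integrable_def]
    have "(LINT x|lborel. \<psi> x + a * \<eta> x) = 0"
      using integrable \<eta>_pos by (simp add: a_def)
    then obtain \<Phi> where \<Phi>: "test_fun UNIV \<Phi>" "deriv \<Phi> = (\<lambda>x. \<psi> x + a * \<eta> x)"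
      using test_fun_antiderivative[OF test_fun_UNIV_add_cmult[OF \<psi> \<eta>]] by blast
    have "0 = (LINT x|lborel. h x * \<psi> x + a * (h x * \<eta> x))"
      using zero[OF \<Phi>(1)] unfolding \<Phi>(2) by (simp add: set_lebesgue_integral_def algebra_simps)
    also have "\<dots> = (LINT x|lborel. h x * \<psi> x) + a * (LINT x|lborel. h x * \<eta> x)"
      using integrable by simp
    also have "\<dots> = (LINT x|lborel. h x * \<psi> x - c * \<psi> x)"
      using integrable by (simp add: a_def c_def set_lebesgue_integral_def)
    finally show "(LINT x:UNIV|lborel. (h x - c) * \<psi> x) = 0"
      by (simp add: set_lebesgue_integral_def left_diff_distrib)
  qed simp
  then have "AE x in lborel. h x = c" by simp
  then show thesis by (rule that)
qed

lemma du_Bois_Reymond: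
  assumes v: "\<And>a b. set_integrable lborel {a..b} v" and w: "\<And>a b. set_integrable lborel {a..b} w"
    and weak: "\<And>\<phi>. test_fun UNIV \<phi> \<Longrightarrow> (LINT x:UNIV|lborel. v x * deriv \<phi> x) = - (LINT x:UNIV|lborel. w x * \<phi> x)"
  obtains V where "primitive_on UNIV V w" "AE x in lborel. v x = V x"
proof -
  obtain V where V: "primitive_on UNIV V w"
    by (rule primitive_on_exists[of UNIV 0 w]) (use w in auto)
  have integrable_V: "set_integrable lborel {a..b} V" for a b
    by (rule borel_integrable_atLeastAtMost'[OF primitive_on_continuous_Icc[OF V]]) simp
  obtain c where "AE x in lborel. v x - V x = c"
  proof (rule AE_constant_if_annihilates_derivs)
    show "set_integrable lborel {a..b} (\<lambda>x. v x - V x)" for a b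
      using v integrable_V by simp
    show "(LINT x:UNIV|lborel. (v x - V x) * deriv \<phi> x) = 0" if t: "test_fun UNIV \<phi>" for \<phi>
      using weak[OF t] primitive_on_integral_by_parts[OF V t]
        set_integrable_mult_test_fun[OF test_fun_deriv[OF t] v] set_integrable_mult_test_fun[OF test_fun_deriv[OF t] integrable_V]
      by (simp add: left_diff_distrib)
  qed
  then have "AE x in lborel. v x = V x + c" by eventually_elim simp
  then show thesis using that primitive_on_add_const[OF V] by blast
qed

lemma weak_deriv_Suc_representative:
  assumes v: "weak_deriv UNIV n f v" and w: "weak_deriv UNIV (Suc n) f w"
  obtains V where "primitive_on UNIV V w" "AE x in lborel. v x = V x"
proof (rule du_Bois_Reymond)
  show "set_integrable lborel {a..b} v" "set_integrable lborel {a..b} w" for a b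
    using v w unfolding weak_deriv_def by auto
  fix \<phi> assume t: "test_fun UNIV \<phi>"
  have "(-1) ^ n * (LINT x:UNIV|lborel. v x * deriv \<phi> x) = (LINT x:UNIV|lborel. f x * (deriv ^^ n) (deriv \<phi>) x)"
    using v test_fun_deriv[OF t] unfolding weak_deriv_def by simp
  also have "\<dots> = (-1) ^ Suc n * (LINT x:UNIV|lborel. w x * \<phi> x)"
    using w t unfolding weak_deriv_def by (simp add: funpow_swap1)
  also have "\<dots> = (-1) ^ n * (- (LINT x:UNIV|lborel. w x * \<phi> x))" by simp
  finally show "(LINT x:UNIV|lborel. v x * deriv \<phi> x) = - (LINT x:UNIV|lborel. w x * \<phi> x)"
    by (simp only: mult_cancel_left) simp
qed (rule that)

subsection \<open>Square integrable functions\<close>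

lemma sq_int_add:
  assumes v: "sq_int B v" and z: "sq_int B z"
  shows "sq_int B (\<lambda>x. v x + z x)"
    and "(LINT x:B|lborel. (v x + z x)\<^sup>2) \<le> 2 * (LINT x:B|lborel. (v x)\<^sup>2) + 2 * (LINT x:B|lborel. (z x)\<^sup>2)"
proof -
  have measurable: "set_borel_measurable lborel B (\<lambda>x. v x + z x)"
    using v z unfolding sq_int_def set_borel_measurable_def scaleR_add_right by (intro borel_measurable_add) auto
  have dominated: "set_integrable lborel B (\<lambda>x. 2 * (v x)\<^sup>2 + 2 * (z x)\<^sup>2)"
    using v z by (intro set_integral_add) (auto simp: sq_int_def)
  have power2_le: "(v x + z x)\<^sup>2 \<le> 2 * (v x)\<^sup>2 + 2 * (z x)\<^sup>2" for x
    using zero_le_power2[of "v x - z x"] unfolding power2_diff power2_sum by linarith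
  have integrable: "set_integrable lborel B (\<lambda>x. (v x + z x)\<^sup>2)"
    by (rule set_integrable_bound[OF dominated set_borel_measurable_mult[OF measurable measurable, folded power2_eq_square]])
      (use power2_le in \<open>auto simp: abs_of_nonneg\<close>)
  show "sq_int B (\<lambda>x. v x + z x)" using measurable integrable by (simp add: sq_int_def)
  have "(LINT x:B|lborel. (v x + z x)\<^sup>2) \<le> (LINT x:B|lborel. 2 * (v x)\<^sup>2 + 2 * (z x)\<^sup>2)"
    by (rule set_integral_mono[OF integrable dominated power2_le])
  also have "\<dots> = 2 * (LINT x:B|lborel. (v x)\<^sup>2) + 2 * (LINT x:B|lborel. (z x)\<^sup>2)"
    using v z by (simp add: sq_int_def)
  finally show "(LINT x:B|lborel. (v x + z x)\<^sup>2) \<le> 2 * (LINT x:B|lborel. (v x)\<^sup>2) + 2 * (LINT x:B|lborel. (z x)\<^sup>2)" .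
qed

lemma set_integral_power2_nonneg [simp]: "0 \<le> (LINT x:A|M. (f x :: real)\<^sup>2)"
  unfolding set_lebesgue_integral_def by (intro Bochner_Integration.integral_nonneg) simp

lemma sq_int_cmult:
  assumes "sq_int B v"
  shows "sq_int B (\<lambda>x. a * v x)"
proof -
  have indicator_mult: "(\<lambda>x. indicator B x *\<^sub>R (a * v x)) = (\<lambda>x. a * (indicator B x *\<^sub>R v x))"
    by (simp add: mult.left_commute)
  have "set_borel_measurable lborel B (\<lambda>x. a * v x)"
    unfolding set_borel_measurable_def indicator_mult
    using assms by (intro borel_measurable_times borel_measurable_const) (simp add: sq_int_def set_borel_measurable_def)
  then show ?thesis
    using assms by (simp add: sq_int_def power_mult_distrib)
qed

lemma sq_int_mult_bounded:
  assumes v: "sq_int B v" and z: "set_borel_measurable lborel B z" "\<And>x. x \<in> B \<Longrightarrow> \<bar>z x\<bar> \<le> K"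
  shows "sq_int B (\<lambda>x. v x * z x)"
    and "(LINT x:B|lborel. (v x * z x)\<^sup>2) \<le> K\<^sup>2 * (LINT x:B|lborel. (v x)\<^sup>2)"
proof -
  have measurable: "set_borel_measurable lborel B (\<lambda>x. v x * z x)"
    using v z(1) by (auto simp: sq_int_def intro: set_borel_measurable_mult)
  have dominated: "set_integrable lborel B (\<lambda>x. K\<^sup>2 * (v x)\<^sup>2)"
    using v by (auto simp: sq_int_def)
  have power2_le: "(v x * z x)\<^sup>2 \<le> K\<^sup>2 * (v x)\<^sup>2" if "x \<in> B" for x
    using power_mono[OF z(2)[OF that], of 2] mult_right_mono[of "(z x)\<^sup>2" "K\<^sup>2" "(v x)\<^sup>2"]
    by (simp add: power_mult_distrib mult.commute)
  have integrable: "set_integrable lborel B (\<lambda>x. (v x * z x)\<^sup>2)"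
    by (rule set_integrable_bound[OF dominated set_borel_measurable_mult[OF measurable measurable, folded power2_eq_square]])
      (use power2_le in \<open>auto intro!: AE_I2\<close>)
  show "sq_int B (\<lambda>x. v x * z x)" using measurable integrable by (simp add: sq_int_def)
  have "(LINT x:B|lborel. (v x * z x)\<^sup>2) \<le> (LINT x:B|lborel. K\<^sup>2 * (v x)\<^sup>2)"
    by (rule set_integral_mono[OF integrable dominated power2_le])
  then show "(LINT x:B|lborel. (v x * z x)\<^sup>2) \<le> K\<^sup>2 * (LINT x:B|lborel. (v x)\<^sup>2)" by simp
qed

lemma sq_int_ball_bounded:
  fixes v :: "real \<Rightarrow> real"
  assumes v: "set_borel_measurable lborel (ball c r) v" "\<And>x. x \<in> ball c r \<Longrightarrow> \<bar>v x\<bar> \<le> K" and r: "0 < r"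
  shows "sq_int (ball c r) v" and "(LINT x:ball c r|lborel. (v x)\<^sup>2) \<le> K\<^sup>2 * (2 * r)"
proof -
  have emeasure_ball: "emeasure lborel (ball c r) = ennreal (2 * r)"
    using r by (simp add: ball_eq_greaterThanLessThan)
  have sq_int_1: "sq_int (ball c r) (\<lambda>_. 1)"
    using emeasure_ball by (auto simp: sq_int_def set_integrable_def set_borel_measurable_def intro!: borel_measurable_indicator)
  show "sq_int (ball c r) v"
    using sq_int_mult_bounded(1)[OF sq_int_1 v] by simp
  show "(LINT x:ball c r|lborel. (v x)\<^sup>2) \<le> K\<^sup>2 * (2 * r)"
    using sq_int_mult_bounded(2)[OF sq_int_1 v] emeasure_ball r by (simp add: set_lebesgue_integral_def measure_def)
qed

lemma sq_int_shift:
  assumes v: "sq_int B v" and B': "B' \<in> sets borel" "\<And>x. x \<in> B' \<Longrightarrow> x + \<tau> \<in> B"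
  shows "sq_int B' (\<lambda>x. v (x + \<tau>))"
    and "(LINT x:B'|lborel. (v (x + \<tau>))\<^sup>2) \<le> (LINT x:B|lborel. (v x)\<^sup>2)"
proof -
  define g where "g x = indicator B x *\<^sub>R (v x)\<^sup>2" for x
  have "(\<lambda>x. indicator B x *\<^sub>R v x) \<in> borel_measurable borel"
    using v by (simp add: sq_int_def set_borel_measurable_def)
  from measurable_compose[OF _ this, of "\<lambda>x. x + \<tau>" borel]
  have "(\<lambda>x. indicator B' x *\<^sub>R (indicator B (x + \<tau>) *\<^sub>R v (x + \<tau>))) \<in> borel_measurable borel"
    by (intro borel_measurable_scaleR[OF borel_measurable_indicator[OF B'(1)]]) simp
  also have "(\<lambda>x. indicator B' x *\<^sub>R (indicator B (x + \<tau>) *\<^sub>R v (x + \<tau>))) = (\<lambda>x. indicator B' x *\<^sub>R v (x + \<tau>))"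
    using B'(2) by (fastforce simp: indicator_def)
  finally have measurable: "set_borel_measurable lborel B' (\<lambda>x. v (x + \<tau>))"
    by (simp add: set_borel_measurable_def)
  have integrable_g: "integrable lborel (\<lambda>x. g (\<tau> + 1 * x))"
    using v unfolding sq_int_def set_integrable_def g_def[symmetric]
    by (subst lborel_integrable_real_affine_iff) auto
  have le_g: "indicator B' x *\<^sub>R (v (x + \<tau>))\<^sup>2 \<le> g (\<tau> + 1 * x)" for x
    using B'(2)[of x] by (auto simp: g_def indicator_def add.commute)
  have integrable: "integrable lborel (\<lambda>x. indicator B' x *\<^sub>R (v (x + \<tau>))\<^sup>2)"
    by (rule Bochner_Integration.integrable_bound[OF integrable_g])
      (use le_g set_borel_measurable_mult[OF measurable measurable] in
        \<open>auto intro!: AE_I2 simp: g_def set_borel_measurable_def power2_eq_square\<close>)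
  show "sq_int B' (\<lambda>x. v (x + \<tau>))" using measurable integrable by (simp add: sq_int_def set_integrable_def)
  have "(LINT x:B'|lborel. (v (x + \<tau>))\<^sup>2) \<le> (LINT x|lborel. g (\<tau> + 1 * x))"
    unfolding set_lebesgue_integral_def by (rule integral_mono[OF integrable integrable_g le_g])
  also have "\<dots> = (LINT x:B|lborel. (v x)\<^sup>2)"
    using lborel_integral_real_affine[of 1 g \<tau>] by (simp add: g_def set_lebesgue_integral_def)
  finally show "(LINT x:B'|lborel. (v (x + \<tau>))\<^sup>2) \<le> (LINT x:B|lborel. (v x)\<^sup>2)" .
qed

subsection \<open>Derivatives of the reciprocal\<close>

definition inverse_deriv :: "nat \<Rightarrow> real \<Rightarrow> real" where
  "inverse_deriv n y = (-1) ^ n * fact n * inverse y ^ Suc n"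

lemma inverse_deriv_has_real_derivative:
  assumes "y \<noteq> 0"
  shows "(inverse_deriv n has_real_derivative inverse_deriv (Suc n) y) (at y)"
proof -
  have "((\<lambda>y. inverse y ^ Suc n) has_real_derivative - (real (Suc n) * inverse y ^ Suc (Suc n))) (at y)"
    using DERIV_power_Suc[OF DERIV_inverse[OF assms], of n] by (simp add: algebra_simps)
  from DERIV_cmult[OF this, of "(-1) ^ n * fact n"] show ?thesis
    by (simp add: inverse_deriv_def[abs_def] algebra_simps)
qed

lemma bounded_inverse_deriv:
  assumes "a > 0"
  shows "bounded (inverse_deriv n ` {a..})"
  unfolding bounded_iff
proof (intro exI ballI)
  fix z assume "z \<in> inverse_deriv n ` {a..}"
  then obtain y where y: "a \<le> y" "z = inverse_deriv n y" by auto
  have "inverse y ^ Suc n \<le> inverse a ^ Suc n"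
    using assms y(1) by (intro power_mono le_imp_inverse_le) auto
  then show "norm z \<le> fact n * inverse a ^ Suc n"
    using assms y by (simp add: inverse_deriv_def abs_mult power_abs del: power_Suc)
qed

subsection \<open>Uniform scale-invariant Sobolev bounds\<close>

lemma principal_bigo_iff:
  fixes a b :: "'i \<Rightarrow> real"
  shows "a \<in> O[principal I](b) \<longleftrightarrow> (\<exists>C>0. \<forall>i\<in>I. \<bar>a i\<bar> \<le> C * \<bar>b i\<bar>)"
  unfolding bigo_def by (simp add: eventually_principal)

lemma principal_bigoI:
  fixes a b :: "'i \<Rightarrow> real"
  assumes "\<And>i. i \<in> I \<Longrightarrow> \<bar>a i\<bar> \<le> C * \<bar>b i\<bar>"
  shows "a \<in> O[principal I](b)"
  using assms by (intro bigoI[of _ C]) (simp add: eventually_principal)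

lemma principal_bigo_reindex:
  fixes a b :: "'i \<Rightarrow> real"
  assumes "a \<in> O[principal I](b)" "\<And>j. j \<in> J \<Longrightarrow> \<pi> j \<in> I"
  shows "(\<lambda>j. a (\<pi> j)) \<in> O[principal J](\<lambda>j. b (\<pi> j))"
  using assms unfolding principal_bigo_iff by blast

context
  fixes I :: "'i set" and c r :: "'i \<Rightarrow> real"
begin

definition sup_bigo :: "('i \<Rightarrow> real \<Rightarrow> real) \<Rightarrow> ('i \<Rightarrow> real) \<Rightarrow> bool" where
  "sup_bigo v \<rho> \<longleftrightarrow> (\<lambda>p. v (fst p) (snd p)) \<in> O[principal (SIGMA i:I. ball (c i) (r i))](\<lambda>p. \<rho> (fst p))"

text \<open>\<open>sobolev_bigo I c r m v \<rho>\<close> says that, uniformly in \<open>i \<in> I\<close>, on the ball of radius \<open>r i\<close> about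
  \<open>c i\<close> the function \<open>(r i) ^ j\<close> times the \<open>j\<close>-th derivative of \<open>v i\<close> is \<open>O(\<rho> i)\<close> for \<open>j < m\<close>, and
  \<open>(r i) powr (m - 1/2)\<close> times the \<open>L2\<close> norm of the \<open>m\<close>-th weak derivative is \<open>O(\<rho> i)\<close>.\<close>

primrec sobolev_bigo :: "nat \<Rightarrow> ('i \<Rightarrow> real \<Rightarrow> real) \<Rightarrow> ('i \<Rightarrow> real) \<Rightarrow> bool" where
  "sobolev_bigo 0 v \<rho> \<longleftrightarrow> (\<forall>i\<in>I. sq_int (ball (c i) (r i)) (v i)) \<and>
     (\<lambda>i. LINT x:ball (c i) (r i)|lborel. (v i x)\<^sup>2) \<in> O[principal I](\<lambda>i. (\<rho> i)\<^sup>2 * r i)"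
| "sobolev_bigo (Suc m) v \<rho> \<longleftrightarrow> sup_bigo v \<rho> \<and>
     (\<exists>w. (\<forall>i\<in>I. primitive_on (ball (c i) (r i)) (v i) (w i)) \<and> sobolev_bigo m w (\<lambda>i. \<rho> i / r i))"

declare sobolev_bigo.simps(2) [simp del]

lemma sup_bigoI:
  assumes "\<And>i x. i \<in> I \<Longrightarrow> x \<in> ball (c i) (r i) \<Longrightarrow> \<bar>v i x\<bar> \<le> C * \<bar>\<rho> i\<bar>"
  shows "sup_bigo v \<rho>"
  unfolding sup_bigo_def by (rule principal_bigoI) (use assms in auto)

lemma sup_bigo_iff:
  "sup_bigo v \<rho> \<longleftrightarrow> (\<exists>C>0. \<forall>i\<in>I. \<forall>x\<in>ball (c i) (r i). \<bar>v i x\<bar> \<le> C * \<bar>\<rho> i\<bar>)"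
  unfolding sup_bigo_def principal_bigo_iff by (simp add: split_paired_Ball_Sigma)

lemma sup_bigo_add: "sup_bigo v \<rho> \<Longrightarrow> sup_bigo z \<rho> \<Longrightarrow> sup_bigo (\<lambda>i x. v i x + z i x) \<rho>"
  unfolding sup_bigo_def by (rule sum_in_bigo)

lemma sup_bigo_mult:
  "sup_bigo v \<rho> \<Longrightarrow> sup_bigo z \<sigma> \<Longrightarrow> sup_bigo (\<lambda>i x. v i x * z i x) (\<lambda>i. \<rho> i * \<sigma> i)"
  unfolding sup_bigo_def by (rule landau_o.big.mult)

lemma sup_bigo_const: "a \<in> O[principal I](\<rho>) \<Longrightarrow> sup_bigo (\<lambda>i _. a i) \<rho>"
  by (auto simp: principal_bigo_iff sup_bigo_iff)

lemma sup_bigo_trans: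
  assumes v: "sup_bigo v \<rho>" and \<rho>: "\<rho> \<in> O[principal I](\<sigma>)"
  shows "sup_bigo v \<sigma>"
  using v sup_bigo_const[OF \<rho>] unfolding sup_bigo_def by (rule landau_o.big_trans)

lemma sobolev_bigo_SucI:
  assumes "sup_bigo v \<rho>" "\<And>i. i \<in> I \<Longrightarrow> primitive_on (ball (c i) (r i)) (v i) (w i)"
    and "sobolev_bigo m w (\<lambda>i. \<rho> i / r i)"
  shows "sobolev_bigo (Suc m) v \<rho>"
  using assms by (auto simp: sobolev_bigo.simps(2))

lemma sobolev_bigo_SucE:
  assumes "sobolev_bigo (Suc m) v \<rho>"
  obtains w where "\<And>i. i \<in> I \<Longrightarrow> primitive_on (ball (c i) (r i)) (v i) (w i)" "sobolev_bigo m w (\<lambda>i. \<rho> i / r i)"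
  using assms by (auto simp: sobolev_bigo.simps(2))

lemma sobolev_bigo_sup: "sobolev_bigo (Suc m) v \<rho> \<Longrightarrow> sup_bigo v \<rho>"
  by (simp add: sobolev_bigo.simps(2))

lemma sobolev_bigo_continuous:
  "sobolev_bigo (Suc m) v \<rho> \<Longrightarrow> i \<in> I \<Longrightarrow> continuous_on (ball (c i) (r i)) (v i)"
  by (erule sobolev_bigo_SucE) (auto intro: primitive_on_continuous)

lemma sobolev_bigo_cong:
  assumes v: "sobolev_bigo m v \<rho>" and eq: "\<And>i x. i \<in> I \<Longrightarrow> x \<in> ball (c i) (r i) \<Longrightarrow> v i x = v' i x"
  shows "sobolev_bigo m v' \<rho>"
proof (cases m)
  case 0
  have indicator_eq: "(\<lambda>x. indicator (ball (c i) (r i)) x *\<^sub>R v' i x) = (\<lambda>x. indicator (ball (c i) (r i)) x *\<^sub>R v i x)"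
    "(\<lambda>x. indicator (ball (c i) (r i)) x *\<^sub>R (v' i x)\<^sup>2) = (\<lambda>x. indicator (ball (c i) (r i)) x *\<^sub>R (v i x)\<^sup>2)"
    if "i \<in> I" for i
    using eq[OF that] by (auto simp: indicator_def)
  have "sq_int (ball (c i) (r i)) (v' i)" if "i \<in> I" for i
    using v 0 that unfolding sq_int_def set_borel_measurable_def set_integrable_def indicator_eq[OF that]
    by (auto simp: sq_int_def set_borel_measurable_def set_integrable_def)
  moreover have "(\<lambda>i. LINT x:ball (c i) (r i)|lborel. (v' i x)\<^sup>2) \<in> O[principal I](\<lambda>i. (\<rho> i)\<^sup>2 * r i) \<longleftrightarrow>
      (\<lambda>i. LINT x:ball (c i) (r i)|lborel. (v i x)\<^sup>2) \<in> O[principal I](\<lambda>i. (\<rho> i)\<^sup>2 * r i)"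
  proof (rule landau_o.big.in_cong)
    show "\<forall>\<^sub>F i in principal I. (LINT x:ball (c i) (r i)|lborel. (v' i x)\<^sup>2) = (LINT x:ball (c i) (r i)|lborel. (v i x)\<^sup>2)"
      unfolding eventually_principal set_lebesgue_integral_def by (intro ballI arg_cong[where f = "integral\<^sup>L lborel"] indicator_eq(2))
  qed
  ultimately show ?thesis using v 0 by simp
next
  case (Suc n)
  with v obtain w where w: "\<And>i. i \<in> I \<Longrightarrow> primitive_on (ball (c i) (r i)) (v i) (w i)"
      "sobolev_bigo n w (\<lambda>i. \<rho> i / r i)"
    using sobolev_bigo_SucE by blast
  obtain C where C: "\<And>i x. i \<in> I \<Longrightarrow> x \<in> ball (c i) (r i) \<Longrightarrow> \<bar>v i x\<bar> \<le> C * \<bar>\<rho> i\<bar>"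
    using sobolev_bigo_sup v unfolding Suc sup_bigo_iff by blast
  show ?thesis
    unfolding Suc
  proof (rule sobolev_bigo_SucI[OF _ _ w(2)])
    show "sup_bigo v' \<rho>"
      by (rule sup_bigoI[of _ C]) (use C eq in force)
    show "primitive_on (ball (c i) (r i)) (v' i) (w i)" if "i \<in> I" for i
      by (rule primitive_on_cong[OF w(1)[OF that]]) (use eq[OF that] in auto)
  qed
qed

lemma sobolev_bigo_trans:
  "sobolev_bigo m v \<rho> \<Longrightarrow> \<rho> \<in> O[principal I](\<sigma>) \<Longrightarrow> sobolev_bigo m v \<sigma>"
proof (induction m arbitrary: v \<rho> \<sigma>)
  case 0
  have "(\<lambda>i. (\<rho> i)\<^sup>2 * r i) \<in> O[principal I](\<lambda>i. (\<sigma> i)\<^sup>2 * r i)"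
    by (intro landau_o.big.mult_right landau_o.big_power 0)
  then show ?case
    using 0(1) landau_o.big_trans by auto
next
  case (Suc m)
  obtain w where w: "\<And>i. i \<in> I \<Longrightarrow> primitive_on (ball (c i) (r i)) (v i) (w i)" "sobolev_bigo m w (\<lambda>i. \<rho> i / r i)"
    using sobolev_bigo_SucE[OF Suc.prems(1)] by blast
  have "(\<lambda>i. \<rho> i / r i) \<in> O[principal I](\<lambda>i. \<sigma> i / r i)"
    unfolding divide_inverse by (rule landau_o.big.mult_right[OF Suc.prems(2)])
  from Suc.IH[OF w(2) this] show ?case
    using sobolev_bigo_SucI[OF sup_bigo_trans[OF sobolev_bigo_sup[OF Suc.prems(1)] Suc.prems(2)] w(1)] by blast
qed

lemma sobolev_bigo_add:
  "sobolev_bigo m v \<rho> \<Longrightarrow> sobolev_bigo m z \<rho> \<Longrightarrow> sobolev_bigo m (\<lambda>i x. v i x + z i x) \<rho>"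
proof (induction m arbitrary: v z \<rho>)
  case 0
  let ?S = "\<lambda>v i. LINT x:ball (c i) (r i)|lborel. (v i x)\<^sup>2"
  have vz: "sq_int (ball (c i) (r i)) (v i)" "sq_int (ball (c i) (r i)) (z i)" if "i \<in> I" for i
    using 0 that by auto
  have "(\<lambda>i. ?S (\<lambda>i x. v i x + z i x) i) \<in> O[principal I](\<lambda>i. ?S v i + ?S z i)"
    by (rule principal_bigoI[of _ _ 2]) (use sq_int_add(2)[OF vz] in \<open>simp add: distrib_left\<close>)
  also have "(\<lambda>i. ?S v i + ?S z i) \<in> O[principal I](\<lambda>i. (\<rho> i)\<^sup>2 * r i)"
    using 0 by (intro sum_in_bigo) auto
  finally show ?case
    using sq_int_add(1)[OF vz] by simp
next
  case (Suc m)
  obtain w where w: "\<And>i. i \<in> I \<Longrightarrow> primitive_on (ball (c i) (r i)) (v i) (w i)" "sobolev_bigo m w (\<lambda>i. \<rho> i / r i)"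
    using sobolev_bigo_SucE[OF Suc.prems(1)] by blast
  obtain y where y: "\<And>i. i \<in> I \<Longrightarrow> primitive_on (ball (c i) (r i)) (z i) (y i)" "sobolev_bigo m y (\<lambda>i. \<rho> i / r i)"
    using sobolev_bigo_SucE[OF Suc.prems(2)] by blast
  show ?case
    by (rule sobolev_bigo_SucI[OF sup_bigo_add primitive_on_add[OF w(1) y(1)] Suc.IH[OF w(2) y(2)]])
      (use Suc.prems sobolev_bigo_sup in auto)
qed

lemma sobolev_bigo_scale:
  "sobolev_bigo m v \<rho> \<Longrightarrow> sobolev_bigo m (\<lambda>i x. a i * v i x) (\<lambda>i. a i * \<rho> i)"
proof (induction m arbitrary: v \<rho>)
  case 0
  let ?S = "\<lambda>v i. LINT x:ball (c i) (r i)|lborel. (v i x)\<^sup>2"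
  have "sq_int (ball (c i) (r i)) (\<lambda>x. a i * v i x)" if "i \<in> I" for i
    using 0 that by (auto intro: sq_int_cmult)
  moreover have "(\<lambda>i. (a i)\<^sup>2 * ?S v i) \<in> O[principal I](\<lambda>i. (a i)\<^sup>2 * ((\<rho> i)\<^sup>2 * r i))"
    using 0 by (intro landau_o.big.mult_left) simp
  ultimately show ?case by (simp add: power_mult_distrib mult.assoc)
next
  case (Suc m)
  obtain w where w: "\<And>i. i \<in> I \<Longrightarrow> primitive_on (ball (c i) (r i)) (v i) (w i)" "sobolev_bigo m w (\<lambda>i. \<rho> i / r i)"
    using sobolev_bigo_SucE[OF Suc.prems] by blast
  show ?case
  proof (rule sobolev_bigo_SucI)
    show "sup_bigo (\<lambda>i x. a i * v i x) (\<lambda>i. a i * \<rho> i)"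
      by (intro sup_bigo_mult sup_bigo_const sobolev_bigo_sup[OF Suc.prems]) simp
    show "primitive_on (ball (c i) (r i)) (\<lambda>x. a i * v i x) (\<lambda>x. a i * w i x)" if "i \<in> I" for i
      by (rule primitive_on_cmult[OF w(1)[OF that]])
    show "sobolev_bigo m (\<lambda>i x. a i * w i x) (\<lambda>i. a i * \<rho> i / r i)"
      using Suc.IH[OF w(2)] by simp
  qed
qed

lemma sobolev_bigo_diff:
  assumes "sobolev_bigo m v \<rho>" "sobolev_bigo m z \<rho>"
  shows "sobolev_bigo m (\<lambda>i x. v i x - z i x) \<rho>"
proof -
  have "sobolev_bigo m (\<lambda>i x. (-1) * z i x) \<rho>"
    by (rule sobolev_bigo_trans[OF sobolev_bigo_scale[OF assms(2)]]) (simp add: principal_bigoI[of _ _ 1])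
  from sobolev_bigo_add[OF assms(1) this] show ?thesis by simp
qed

lemma sobolev_bigo_zero: "sobolev_bigo m (\<lambda>_ _. 0) \<rho>"
proof (induction m arbitrary: \<rho>)
  case 0
  show ?case by (simp add: sq_int_def set_borel_measurable_def set_integrable_def)
next
  case (Suc m)
  show ?case
    by (rule sobolev_bigo_SucI[OF _ primitive_on_FTC Suc]) (auto intro: sup_bigoI[of _ 1])
qed

context
  assumes r_pos: "\<And>i. i \<in> I \<Longrightarrow> 0 < r i"
begin

lemma sobolev_bigo_0I:
  assumes cont: "\<And>i. i \<in> I \<Longrightarrow> continuous_on (ball (c i) (r i)) (v i)" and sup: "sup_bigo v \<rho>"
  shows "sobolev_bigo 0 v \<rho>"
proof -
  obtain C where "C > 0" and C: "\<And>i x. i \<in> I \<Longrightarrow> x \<in> ball (c i) (r i) \<Longrightarrow> \<bar>v i x\<bar> \<le> C * \<bar>\<rho> i\<bar>"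
    using sup unfolding sup_bigo_iff by blast
  have measurable: "set_borel_measurable lborel (ball (c i) (r i)) (v i)" if "i \<in> I" for i
    by (rule set_borel_measurable_continuous_on[OF cont[OF that]]) simp
  have "(\<lambda>i. LINT x:ball (c i) (r i)|lborel. (v i x)\<^sup>2) \<in> O[principal I](\<lambda>i. (\<rho> i)\<^sup>2 * r i)"
  proof (rule principal_bigoI)
    fix i assume i: "i \<in> I"
    have "(LINT x:ball (c i) (r i)|lborel. (v i x)\<^sup>2) \<le> (C * \<bar>\<rho> i\<bar>)\<^sup>2 * (2 * r i)"
      by (rule sq_int_ball_bounded(2)[OF measurable[OF i] C[OF i] r_pos[OF i]])
    also have "\<dots> = (2 * C\<^sup>2) * \<bar>(\<rho> i)\<^sup>2 * r i\<bar>"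
      using r_pos[OF i] by (simp add: power_mult_distrib abs_mult)
    finally show "\<bar>LINT x:ball (c i) (r i)|lborel. (v i x)\<^sup>2\<bar> \<le> (2 * C\<^sup>2) * \<bar>(\<rho> i)\<^sup>2 * r i\<bar>"
      by (simp add: set_lebesgue_integral_def)
  qed
  then show ?thesis
    using sq_int_ball_bounded(1)[OF measurable C r_pos] by simp
qed

lemma sobolev_bigo_lower: "sobolev_bigo (Suc m) v \<rho> \<Longrightarrow> sobolev_bigo m v \<rho>"
proof (induction m arbitrary: v \<rho>)
  case 0
  show ?case
    by (rule sobolev_bigo_0I[OF sobolev_bigo_continuous[OF 0] sobolev_bigo_sup[OF 0]])
next
  case (Suc m)
  obtain w where "\<And>i. i \<in> I \<Longrightarrow> primitive_on (ball (c i) (r i)) (v i) (w i)" "sobolev_bigo (Suc m) w (\<lambda>i. \<rho> i / r i)"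
    using sobolev_bigo_SucE[OF Suc.prems] by blast
  then show ?case
    using sobolev_bigo_SucI[OF sobolev_bigo_sup[OF Suc.prems]] Suc.IH by blast
qed

lemma sobolev_bigo_lower_0: "sobolev_bigo m v \<rho> \<Longrightarrow> sobolev_bigo 0 v \<rho>"
  by (induction m) (auto dest: sobolev_bigo_lower)

lemma sobolev_bigo_const: "sobolev_bigo m (\<lambda>i _. a i) a"
proof (cases m)
  case 0
  show ?thesis
    unfolding 0 by (rule sobolev_bigo_0I) (auto intro: sup_bigo_const)
next
  case (Suc n)
  show ?thesis
    unfolding Suc by (rule sobolev_bigo_SucI[OF sup_bigo_const primitive_on_FTC sobolev_bigo_zero]) auto
qed

lemma sobolev_bigo_affine:
  assumes a: "a \<in> O[principal I](\<rho>)" and b: "(\<lambda>i. b i * r i) \<in> O[principal I](\<rho>)"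
  shows "sobolev_bigo m (\<lambda>i x. a i + b i * (x - c i)) \<rho>"
proof (rule sobolev_bigo_lower, rule sobolev_bigo_SucI)
  have "sup_bigo (\<lambda>i x. b i * (x - c i)) (\<lambda>i. b i * r i)"
    by (rule sup_bigoI[of _ 1]) (auto simp: abs_mult dist_real_def intro!: mult_left_mono)
  then show "sup_bigo (\<lambda>i x. a i + b i * (x - c i)) \<rho>"
    by (intro sup_bigo_add sup_bigo_const a sup_bigo_trans[OF _ b])
  show "primitive_on (ball (c i) (r i)) (\<lambda>x. a i + b i * (x - c i)) (\<lambda>_. b i)" if "i \<in> I" for i
    by (rule primitive_on_FTC) (auto intro!: derivative_eq_intros)
  have "b \<in> O[principal I](\<lambda>i. b i * r i / r i)"
    by (rule principal_bigoI[of _ _ 1]) (use r_pos in force)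
  also have "(\<lambda>i. b i * r i / r i) \<in> O[principal I](\<lambda>i. \<rho> i / r i)"
    using landau_o.big.mult_right[OF b, of "\<lambda>i. inverse (r i)"] by (simp add: divide_inverse)
  finally show "sobolev_bigo m (\<lambda>i _. b i) (\<lambda>i. \<rho> i / r i)"
    by (rule sobolev_bigo_trans[OF sobolev_bigo_const])
qed

lemma sobolev_bigo_mult_continuous:
  "sobolev_bigo m v \<rho> \<Longrightarrow> sobolev_bigo m z \<sigma> \<Longrightarrow> (\<And>i. i \<in> I \<Longrightarrow> continuous_on (ball (c i) (r i)) (z i)) \<Longrightarrow>
    sup_bigo z \<sigma> \<Longrightarrow> sobolev_bigo m (\<lambda>i x. v i x * z i x) (\<lambda>i. \<rho> i * \<sigma> i)"
proof (induction m arbitrary: v z \<rho> \<sigma>)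
  case 0
  let ?S = "\<lambda>v i. LINT x:ball (c i) (r i)|lborel. (v i x)\<^sup>2"
  obtain C where "C > 0" and C: "\<And>i x. i \<in> I \<Longrightarrow> x \<in> ball (c i) (r i) \<Longrightarrow> \<bar>z i x\<bar> \<le> C * \<bar>\<sigma> i\<bar>"
    using 0(4) unfolding sup_bigo_iff by blast
  have v: "sq_int (ball (c i) (r i)) (v i)" if "i \<in> I" for i
    using 0(1) that by simp
  have z: "set_borel_measurable lborel (ball (c i) (r i)) (z i)" if "i \<in> I" for i
    by (rule set_borel_measurable_continuous_on[OF 0(3)[OF that]]) simp
  have "(\<lambda>i. ?S (\<lambda>i x. v i x * z i x) i) \<in> O[principal I](\<lambda>i. (\<sigma> i)\<^sup>2 * ?S v i)"
  proof (rule principal_bigoI)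
    fix i assume i: "i \<in> I"
    have "?S (\<lambda>i x. v i x * z i x) i \<le> (C * \<bar>\<sigma> i\<bar>)\<^sup>2 * ?S v i"
      by (rule sq_int_mult_bounded(2)[OF v[OF i] z[OF i] C[OF i]])
    then show "\<bar>?S (\<lambda>i x. v i x * z i x) i\<bar> \<le> C\<^sup>2 * \<bar>(\<sigma> i)\<^sup>2 * ?S v i\<bar>"
      by (simp add: power_mult_distrib mult.assoc set_lebesgue_integral_def)
  qed
  also have "(\<lambda>i. (\<sigma> i)\<^sup>2 * ?S v i) \<in> O[principal I](\<lambda>i. (\<sigma> i)\<^sup>2 * ((\<rho> i)\<^sup>2 * r i))"
    using 0(1) by (intro landau_o.big.mult_left) simp
  finally show ?case
    using sq_int_mult_bounded(1)[OF v z C] by (simp add: power_mult_distrib mult_ac)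
next
  case (Suc m)
  obtain w where w: "\<And>i. i \<in> I \<Longrightarrow> primitive_on (ball (c i) (r i)) (v i) (w i)" "sobolev_bigo m w (\<lambda>i. \<rho> i / r i)"
    using sobolev_bigo_SucE[OF Suc.prems(1)] by blast
  obtain y where y: "\<And>i. i \<in> I \<Longrightarrow> primitive_on (ball (c i) (r i)) (z i) (y i)" "sobolev_bigo m y (\<lambda>i. \<sigma> i / r i)"
    using sobolev_bigo_SucE[OF Suc.prems(2)] by blast
  have "sobolev_bigo m (\<lambda>i x. w i x * z i x) (\<lambda>i. \<rho> i / r i * \<sigma> i)"
    by (rule Suc.IH[OF w(2) sobolev_bigo_lower[OF Suc.prems(2)] Suc.prems(3,4)])
  moreover have "sobolev_bigo m (\<lambda>i x. y i x * v i x) (\<lambda>i. \<sigma> i / r i * \<rho> i)"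
    by (rule Suc.IH[OF y(2) sobolev_bigo_lower[OF Suc.prems(1)] sobolev_bigo_continuous[OF Suc.prems(1)]
          sobolev_bigo_sup[OF Suc.prems(1)]])
  ultimately have "sobolev_bigo m (\<lambda>i x. w i x * z i x + v i x * y i x) (\<lambda>i. \<rho> i * \<sigma> i / r i)"
    using sobolev_bigo_add by (simp add: mult.commute)
  then show ?case
    using sobolev_bigo_SucI[OF sup_bigo_mult[OF sobolev_bigo_sup[OF Suc.prems(1)] Suc.prems(4)]
          primitive_on_mult[OF w(1) y(1)]] by blast
qed

lemma sobolev_bigo_mult_Suc:
  assumes "sobolev_bigo m v \<rho>" "sobolev_bigo (Suc m) z \<sigma>"
  shows "sobolev_bigo m (\<lambda>i x. v i x * z i x) (\<lambda>i. \<rho> i * \<sigma> i)"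
  by (rule sobolev_bigo_mult_continuous[OF assms(1) sobolev_bigo_lower[OF assms(2)]
        sobolev_bigo_continuous[OF assms(2)] sobolev_bigo_sup[OF assms(2)]])

lemma sobolev_bigo_mult:
  assumes "sobolev_bigo (Suc m) v \<rho>" "sobolev_bigo (Suc m) z \<sigma>"
  shows "sobolev_bigo (Suc m) (\<lambda>i x. v i x * z i x) (\<lambda>i. \<rho> i * \<sigma> i)"
  by (rule sobolev_bigo_mult_continuous[OF assms sobolev_bigo_continuous[OF assms(2)] sobolev_bigo_sup[OF assms(2)]])

lemma sup_bigo_comp_bounded:
  assumes vJ: "\<And>i x. i \<in> I \<Longrightarrow> x \<in> ball (c i) (r i) \<Longrightarrow> v i x \<in> J" and bdd: "bounded (H ` J)"
  shows "sup_bigo (\<lambda>i x. H (v i x)) (\<lambda>_. 1)"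
proof -
  obtain K where "\<forall>z\<in>H ` J. norm z \<le> K"
    using bdd unfolding bounded_iff by blast
  then show ?thesis
    using vJ by (intro sup_bigoI[of _ K]) auto
qed

lemma sobolev_bigo_comp:
  assumes J: "convex J" and vJ: "\<And>i x. i \<in> I \<Longrightarrow> x \<in> ball (c i) (r i) \<Longrightarrow> v i x \<in> J"
    and cont: "\<And>i. i \<in> I \<Longrightarrow> continuous_on (ball (c i) (r i)) (v i)"
  shows "(\<And>n y. y \<in> J \<Longrightarrow> (H n has_real_derivative H (Suc n) y) (at y)) \<Longrightarrow> (\<And>n. bounded (H n ` J)) \<Longrightarrow>
    sobolev_bigo m v (\<lambda>_. 1) \<Longrightarrow> sobolev_bigo m (\<lambda>i x. H (0 :: nat) (v i x)) (\<lambda>_. 1)"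
proof (induction m arbitrary: H)
  case 0
  have "continuous_on J (H 0)"
    by (rule DERIV_continuous_on[OF has_field_derivative_at_within[OF 0(1)]])
  then have "continuous_on (ball (c i) (r i)) (\<lambda>x. H 0 (v i x))" if "i \<in> I" for i
    by (rule continuous_on_compose2[OF _ cont[OF that]]) (use vJ that in auto)
  then show ?case
    by (rule sobolev_bigo_0I[OF _ sup_bigo_comp_bounded[OF vJ 0(2)]])
next
  case (Suc m)
  obtain w where w: "\<And>i. i \<in> I \<Longrightarrow> primitive_on (ball (c i) (r i)) (v i) (w i)" "sobolev_bigo m w (\<lambda>i. 1 / r i)"
    using sobolev_bigo_SucE[OF Suc.prems(3)] by blast
  have H'_cont: "continuous_on J (H (Suc 0))"
    by (rule DERIV_continuous_on[OF has_field_derivative_at_within[OF Suc.prems(1)]])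
  have "sobolev_bigo m (\<lambda>i x. w i x * H (Suc 0) (v i x)) (\<lambda>i. 1 / r i * 1)"
  proof (rule sobolev_bigo_mult_continuous[OF w(2)])
    show "sobolev_bigo m (\<lambda>i x. H (Suc 0) (v i x)) (\<lambda>_. 1)"
      by (rule Suc.IH[of "\<lambda>n. H (Suc n)", OF Suc.prems(1,2) sobolev_bigo_lower[OF Suc.prems(3)]])
    show "continuous_on (ball (c i) (r i)) (\<lambda>x. H (Suc 0) (v i x))" if "i \<in> I" for i
      by (rule continuous_on_compose2[OF H'_cont cont[OF that]]) (use vJ that in auto)
  qed (rule sup_bigo_comp_bounded[OF vJ Suc.prems(2)])
  then have derivative: "sobolev_bigo m (\<lambda>i x. H (Suc 0) (v i x) * w i x) (\<lambda>i. 1 / r i)"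
    by (simp add: mult.commute)
  show ?case
  proof (rule sobolev_bigo_SucI[OF _ _ derivative])
    show "sup_bigo (\<lambda>i x. H 0 (v i x)) (\<lambda>_. 1)"
      by (rule sup_bigo_comp_bounded[OF vJ Suc.prems(2)])
    show "primitive_on (ball (c i) (r i)) (\<lambda>x. H 0 (v i x)) (\<lambda>x. H (Suc 0) (v i x) * w i x)" if "i \<in> I" for i
      by (rule primitive_on_comp[OF w(1)[OF that] J Suc.prems(1) H'_cont]) (use vJ that in auto)
  qed
qed

lemma sobolev_bigo_comp_vanishing:
  assumes J: "convex J" "0 \<in> J" and vJ: "\<And>i x. i \<in> I \<Longrightarrow> x \<in> ball (c i) (r i) \<Longrightarrow> v i x \<in> J"
    and H: "H 0 0 = 0" "\<And>n y. y \<in> J \<Longrightarrow> (H n has_real_derivative H (Suc n) y) (at y)" "\<And>n. bounded (H (Suc n) ` J)"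
    and v: "sobolev_bigo (Suc m) v \<rho>" and \<rho>: "\<rho> \<in> O[principal I](\<lambda>_. 1)"
  shows "sobolev_bigo (Suc m) (\<lambda>i x. H (0 :: nat) (v i x)) \<rho>"
proof -
  have v_bigo_1: "sobolev_bigo (Suc m) v (\<lambda>_. 1)" by (rule sobolev_bigo_trans[OF v \<rho>])
  have H'_bigo: "sobolev_bigo (Suc m) (\<lambda>i x. H (Suc 0) (v i x)) (\<lambda>_. 1)"
    by (rule sobolev_bigo_comp[of J v "\<lambda>n. H (Suc n)", OF J(1) vJ sobolev_bigo_continuous[OF v_bigo_1] H(2,3) v_bigo_1])
  obtain w where w: "\<And>i. i \<in> I \<Longrightarrow> primitive_on (ball (c i) (r i)) (v i) (w i)" "sobolev_bigo m w (\<lambda>i. \<rho> i / r i)"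
    using sobolev_bigo_SucE[OF v] by blast
  show ?thesis
  proof (rule sobolev_bigo_SucI)
    obtain K where K: "\<forall>z\<in>H (Suc 0) ` J. norm z \<le> K"
      using H(3)[of 0] unfolding bounded_iff by blast
    obtain C where C: "C > 0" "\<And>i x. i \<in> I \<Longrightarrow> x \<in> ball (c i) (r i) \<Longrightarrow> \<bar>v i x\<bar> \<le> C * \<bar>\<rho> i\<bar>"
      using sobolev_bigo_sup[OF v] unfolding sup_bigo_iff by blast
    show "sup_bigo (\<lambda>i x. H 0 (v i x)) \<rho>"
    proof (rule sup_bigoI)
      fix i x assume ix: "i \<in> I" "x \<in> ball (c i) (r i)"
      have seg: "closed_segment 0 (v i x) \<subseteq> J"
        using J vJ[OF ix] by (intro closed_segment_subset) auto
      then obtain \<xi> where \<xi>: "\<xi> \<in> J" "H 0 (v i x) - H 0 0 = H (Suc 0) \<xi> * (v i x - 0)"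
        using MVT_closed_segment[of 0 "v i x" "H 0" "H (Suc 0)"] H(2) by blast
      then have "\<bar>H 0 (v i x)\<bar> = \<bar>H (Suc 0) \<xi>\<bar> * \<bar>v i x\<bar>"
        using H(1) by (simp add: abs_mult)
      also have "\<dots> \<le> K * (C * \<bar>\<rho> i\<bar>)"
        using K \<xi>(1) C(2)[OF ix] by (intro mult_mono) auto
      finally show "\<bar>H 0 (v i x)\<bar> \<le> (K * C) * \<bar>\<rho> i\<bar>" by simp
    qed
    show "primitive_on (ball (c i) (r i)) (\<lambda>x. H 0 (v i x)) (\<lambda>x. H (Suc 0) (v i x) * w i x)" if "i \<in> I" for i
      by (rule primitive_on_comp[OF w(1)[OF that] J(1) H(2)
            DERIV_continuous_on[OF has_field_derivative_at_within[OF H(2)]]]) (use vJ that in auto)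
    show "sobolev_bigo m (\<lambda>i x. H (Suc 0) (v i x) * w i x) (\<lambda>i. \<rho> i / r i)"
      using sobolev_bigo_mult_Suc[OF w(2) H'_bigo] by (simp add: mult.commute)
  qed
qed

lemma sobolev_bigo_exp_minus_1:
  assumes v: "sobolev_bigo (Suc m) v \<rho>" and \<rho>: "\<rho> \<in> O[principal I](\<lambda>_. 1)"
  shows "sobolev_bigo (Suc m) (\<lambda>i x. exp (v i x) - 1) \<rho>"
proof -
  obtain C where C: "C > 0" "\<And>i x. i \<in> I \<Longrightarrow> x \<in> ball (c i) (r i) \<Longrightarrow> \<bar>v i x\<bar> \<le> C * \<bar>1\<bar>"
    using sup_bigo_trans[OF sobolev_bigo_sup[OF v] \<rho>] unfolding sup_bigo_iff by blast
  define H where "H n y = (if n = 0 then exp y - 1 else exp y)" for n :: nat and y :: real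
  have "sobolev_bigo (Suc m) (\<lambda>i x. H 0 (v i x)) \<rho>"
  proof (rule sobolev_bigo_comp_vanishing[where J = "{..C}", OF _ _ _ _ _ _ v \<rho>])
    show "v i x \<in> {..C}" if "i \<in> I" "x \<in> ball (c i) (r i)" for i x
      using C(2)[OF that] by simp
    show "(H n has_real_derivative H (Suc n) y) (at y)" for n y
      by (cases n) (auto simp: H_def[abs_def] intro!: derivative_eq_intros)
    show "bounded (H (Suc n) ` {..C})" for n
      by (auto simp: H_def bounded_iff intro!: exI[of _ "exp C"])
  qed (use C(1) in \<open>auto simp: H_def\<close>)
  then show ?thesis by (simp add: H_def)
qed

lemma sobolev_bigo_inverse:
  assumes v: "sobolev_bigo (Suc m) v \<rho>" and \<rho>: "\<And>i. i \<in> I \<Longrightarrow> 0 < \<rho> i" and a: "a > 0"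
    and lower: "\<And>i x. i \<in> I \<Longrightarrow> x \<in> ball (c i) (r i) \<Longrightarrow> a * \<rho> i \<le> v i x"
  shows "sobolev_bigo (Suc m) (\<lambda>i x. inverse (v i x)) (\<lambda>i. inverse (\<rho> i))"
proof -
  define u where "u i x = inverse (\<rho> i) * v i x" for i x
  have u: "sobolev_bigo (Suc m) u (\<lambda>_. 1)"
    unfolding u_def
    by (rule sobolev_bigo_trans[OF sobolev_bigo_scale[OF v] principal_bigoI[of _ _ 1]]) (use \<rho> in force)
  have uJ: "u i x \<in> {a..}" if "i \<in> I" "x \<in> ball (c i) (r i)" for i x
    using lower[OF that] \<rho>[OF that(1)] by (simp add: u_def field_simps)
  have "sobolev_bigo (Suc m) (\<lambda>i x. inverse_deriv 0 (u i x)) (\<lambda>_. 1)"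
    by (rule sobolev_bigo_comp[where J = "{a..}" and H = inverse_deriv, OF _ uJ sobolev_bigo_continuous[OF u]])
      (use a u in \<open>auto intro: inverse_deriv_has_real_derivative bounded_inverse_deriv\<close>)
  from sobolev_bigo_scale[OF this, of "\<lambda>i. inverse (\<rho> i)"]
  have "sobolev_bigo (Suc m) (\<lambda>i x. inverse (\<rho> i) * inverse_deriv 0 (u i x)) (\<lambda>i. inverse (\<rho> i))" by simp
  then show ?thesis
    by (rule sobolev_bigo_cong) (use \<rho> in \<open>force simp: inverse_deriv_def u_def\<close>)
qed

lemma sobolev_bigo_ln_1_plus:
  assumes v: "sobolev_bigo (Suc m) v \<rho>" and \<rho>: "\<rho> \<in> O[principal I](\<lambda>_. 1)" and a: "a > 0"
    and lower: "\<And>i x. i \<in> I \<Longrightarrow> x \<in> ball (c i) (r i) \<Longrightarrow> a \<le> 1 + v i x"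
  shows "sobolev_bigo (Suc m) (\<lambda>i x. ln (1 + v i x)) \<rho>"
proof -
  define b where "b = min a 1"
  have b: "0 < b" "b \<le> 1" "b \<le> a" using a by (auto simp: b_def)
  define H where "H n y = (case n of 0 \<Rightarrow> ln (1 + y) | Suc n \<Rightarrow> inverse_deriv n (1 + y))" for n y
  have "sobolev_bigo (Suc m) (\<lambda>i x. H 0 (v i x)) \<rho>"
  proof (rule sobolev_bigo_comp_vanishing[where J = "{b - 1..}", OF _ _ _ _ _ _ v \<rho>])
    show "v i x \<in> {b - 1..}" if "i \<in> I" "x \<in> ball (c i) (r i)" for i x
      using lower[OF that] b(3) by simp
    show "(H n has_real_derivative H (Suc n) y) (at y)" if y: "y \<in> {b - 1..}" for n y
    proof (cases n)
      case 0
      then show ?thesis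
        using y b(1) by (auto simp: H_def[abs_def] inverse_deriv_def divide_inverse intro!: derivative_eq_intros)
    next
      case (Suc k)
      have "((\<lambda>y. inverse_deriv k (1 + y)) has_real_derivative inverse_deriv (Suc k) (1 + y) * 1) (at y)"
        using y b(1) by (intro DERIV_chain2[OF inverse_deriv_has_real_derivative]) (auto intro!: derivative_eq_intros)
      then show ?thesis by (simp add: Suc H_def[abs_def])
    qed
    have "H (Suc n) ` {b - 1..} \<subseteq> inverse_deriv n ` {b..}" for n
      by (auto simp: H_def intro!: imageI)
    then show "bounded (H (Suc n) ` {b - 1..})" for n
      using bounded_inverse_deriv[OF b(1)] bounded_subset by blast
  qed (use b in \<open>auto simp: H_def\<close>)
  then show ?thesis by (simp add: H_def)
qed

lemma sobolev_bigo_weak_deriv_0: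
  assumes "sobolev_bigo m v \<rho>"
  shows "\<exists>C. \<forall>i\<in>I. weak_deriv (ball (c i) (r i)) 0 (v i) (v i) \<and> sq_int (ball (c i) (r i)) (v i) \<and>
    r i powr (real 0 - 1 / 2) * L2_norm_on (ball (c i) (r i)) (v i) \<le> C * \<bar>\<rho> i\<bar>"
proof -
  have v: "sobolev_bigo 0 v \<rho>" by (rule sobolev_bigo_lower_0[OF assms])
  then obtain C where C: "C > 0" "\<And>i. i \<in> I \<Longrightarrow>
      \<bar>LINT x:ball (c i) (r i)|lborel. (v i x)\<^sup>2\<bar> \<le> C * \<bar>(\<rho> i)\<^sup>2 * r i\<bar>"
    unfolding sobolev_bigo.simps(1) principal_bigo_iff by blast
  have "r i powr (real 0 - 1 / 2) * L2_norm_on (ball (c i) (r i)) (v i) \<le> sqrt C * \<bar>\<rho> i\<bar>" if i: "i \<in> I" for i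
  proof -
    have "L2_norm_on (ball (c i) (r i)) (v i) \<le> sqrt (C * ((\<rho> i)\<^sup>2 * r i))"
      unfolding L2_norm_on_def using C(2)[OF i] r_pos[OF i] by (simp add: abs_mult)
    also have "\<dots> = sqrt C * \<bar>\<rho> i\<bar> * sqrt (r i)"
      by (simp add: real_sqrt_mult)
    finally show ?thesis
      using r_pos[OF i] by (simp add: powr_minus powr_half_sqrt field_simps)
  qed
  then show ?thesis
    using v by (intro exI[of _ "sqrt C"]) (auto simp: weak_deriv_0)
qed

lemma sobolev_bigo_weak_deriv:
  "sobolev_bigo m v \<rho> \<Longrightarrow> s \<le> m \<Longrightarrow> \<exists>C. \<forall>i\<in>I. \<exists>w. weak_deriv (ball (c i) (r i)) s (v i) w \<and>
    sq_int (ball (c i) (r i)) w \<and> r i powr (real s - 1 / 2) * L2_norm_on (ball (c i) (r i)) w \<le> C * \<bar>\<rho> i\<bar>"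
proof (induction s arbitrary: m v \<rho>)
  case 0
  show ?case using sobolev_bigo_weak_deriv_0[OF 0(1)] by blast
next
  case (Suc s)
  then obtain n where n: "m = Suc n" "s \<le> n" by (cases m) auto
  obtain w where w: "\<And>i. i \<in> I \<Longrightarrow> primitive_on (ball (c i) (r i)) (v i) (w i)" "sobolev_bigo n w (\<lambda>i. \<rho> i / r i)"
    using sobolev_bigo_SucE Suc.prems(1) unfolding n(1) by blast
  obtain C where C: "\<And>i. i \<in> I \<Longrightarrow> \<exists>y. weak_deriv (ball (c i) (r i)) s (w i) y \<and>
      sq_int (ball (c i) (r i)) y \<and> r i powr (real s - 1 / 2) * L2_norm_on (ball (c i) (r i)) y \<le> C * \<bar>\<rho> i / r i\<bar>"
    using Suc.IH[OF w(2) n(2)] by blast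
  have "\<exists>y. weak_deriv (ball (c i) (r i)) (Suc s) (v i) y \<and> sq_int (ball (c i) (r i)) y \<and>
      r i powr (real (Suc s) - 1 / 2) * L2_norm_on (ball (c i) (r i)) y \<le> C * \<bar>\<rho> i\<bar>" if i: "i \<in> I" for i
  proof -
    obtain y where y: "weak_deriv (ball (c i) (r i)) s (w i) y" "sq_int (ball (c i) (r i)) y"
        "r i powr (real s - 1 / 2) * L2_norm_on (ball (c i) (r i)) y \<le> C * \<bar>\<rho> i / r i\<bar>"
      using C[OF i] by blast
    have "r i powr (real (Suc s) - 1 / 2) = r i * r i powr (real s - 1 / 2)"
      using r_pos[OF i] powr_add[of "r i" 1 "real s - 1 / 2"] by simp
    then have "r i powr (real (Suc s) - 1 / 2) * L2_norm_on (ball (c i) (r i)) y \<le> r i * (C * \<bar>\<rho> i / r i\<bar>)"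
      using mult_left_mono[OF y(3), of "r i"] r_pos[OF i] by (simp only: mult.assoc)
    also have "\<dots> = C * \<bar>\<rho> i\<bar>" using r_pos[OF i] by simp
    finally show ?thesis
      using weak_deriv_Suc[OF w(1)[OF i] y(1)] y(2) by blast
  qed
  then show ?case by blast
qed

lemma sobolev_bigo_Hdot:
  assumes "sobolev_bigo m v \<rho>"
  obtains C where "\<And>i s. i \<in> I \<Longrightarrow> s \<le> m \<Longrightarrow> has_Hdot (ball (c i) (r i)) s (v i)"
    and "\<And>i s. i \<in> I \<Longrightarrow> s \<le> m \<Longrightarrow> r i powr (real s - 1 / 2) * Hdot_norm (ball (c i) (r i)) s (v i) \<le> C * \<bar>\<rho> i\<bar>"
proof -
  have "\<forall>s\<in>{..m}. \<exists>C. \<forall>i\<in>I. \<exists>w. weak_deriv (ball (c i) (r i)) s (v i) w \<and> sq_int (ball (c i) (r i)) w \<and>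
      r i powr (real s - 1 / 2) * L2_norm_on (ball (c i) (r i)) w \<le> C * \<bar>\<rho> i\<bar>"
    using sobolev_bigo_weak_deriv[OF assms] by simp
  then obtain C where C: "\<forall>s\<in>{..m}. \<forall>i\<in>I. \<exists>w. weak_deriv (ball (c i) (r i)) s (v i) w \<and> sq_int (ball (c i) (r i)) w \<and>
      r i powr (real s - 1 / 2) * L2_norm_on (ball (c i) (r i)) w \<le> C s * \<bar>\<rho> i\<bar>"
    by (rule bchoice[THEN exE])
  show thesis
  proof (rule that)
    fix i s assume i: "i \<in> I" and s: "s \<le> m"
    obtain w where w: "weak_deriv (ball (c i) (r i)) s (v i) w" "sq_int (ball (c i) (r i)) w"
        "r i powr (real s - 1 / 2) * L2_norm_on (ball (c i) (r i)) w \<le> C s * \<bar>\<rho> i\<bar>"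
      using C i s by blast
    then show "has_Hdot (ball (c i) (r i)) s (v i)"
      unfolding has_Hdot_def by blast
    have "C s * \<bar>\<rho> i\<bar> \<le> Max (C ` {..m}) * \<bar>\<rho> i\<bar>"
      using s by (intro mult_right_mono Max_ge) auto
    then show "r i powr (real s - 1 / 2) * Hdot_norm (ball (c i) (r i)) s (v i) \<le> Max (C ` {..m}) * \<bar>\<rho> i\<bar>"
      using w(3) Hdot_norm_eq_L2_norm_on[OF open_ball w(1,2)] by simp
  qed
qed

end

end

context
  fixes \<pi> :: "'j \<Rightarrow> 'i" and I :: "'i set" and J :: "'j set" and c r :: "'i \<Rightarrow> real" and d s \<tau> :: "'j \<Rightarrow> real"
  assumes \<pi>: "\<And>j. j \<in> J \<Longrightarrow> \<pi> j \<in> I" and s: "\<And>j. j \<in> J \<Longrightarrow> 0 < s j" "\<And>j. j \<in> J \<Longrightarrow> s j \<le> r (\<pi> j)"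
    and sub: "\<And>j x. j \<in> J \<Longrightarrow> x \<in> ball (d j) (s j) \<Longrightarrow> x + \<tau> j \<in> ball (c (\<pi> j)) (r (\<pi> j))"
begin

lemma sobolev_bigo_0_localize:
  assumes v: "sobolev_bigo I c r 0 v \<rho>"
  shows "sobolev_bigo J d s 0 (\<lambda>j x. v (\<pi> j) (x + \<tau> j)) (\<lambda>j. \<rho> (\<pi> j) * sqrt (r (\<pi> j) / s j))"
proof -
  obtain C where C: "\<And>i. i \<in> I \<Longrightarrow> \<bar>LINT x:ball (c i) (r i)|lborel. (v i x)\<^sup>2\<bar> \<le> C * \<bar>(\<rho> i)\<^sup>2 * r i\<bar>"
    using v unfolding sobolev_bigo.simps(1) principal_bigo_iff by blast
  have sq_int_v: "sq_int (ball (c (\<pi> j)) (r (\<pi> j))) (v (\<pi> j))" if "j \<in> J" for j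
    using v \<pi>[OF that] by simp
  have "(\<lambda>j. LINT x:ball (d j) (s j)|lborel. (v (\<pi> j) (x + \<tau> j))\<^sup>2)
      \<in> O[principal J](\<lambda>j. (\<rho> (\<pi> j) * sqrt (r (\<pi> j) / s j))\<^sup>2 * s j)"
  proof (rule principal_bigoI)
    fix j assume j: "j \<in> J"
    have "(LINT x:ball (d j) (s j)|lborel. (v (\<pi> j) (x + \<tau> j))\<^sup>2) \<le> (LINT x:ball (c (\<pi> j)) (r (\<pi> j))|lborel. (v (\<pi> j) x)\<^sup>2)"
      by (rule sq_int_shift(2)[OF sq_int_v[OF j]]) (use sub[OF j] in auto)
    also have "\<dots> \<le> C * ((\<rho> (\<pi> j))\<^sup>2 * r (\<pi> j))"
      using C[OF \<pi>[OF j]] s[OF j] by (simp add: abs_mult)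
    also have "(\<rho> (\<pi> j))\<^sup>2 * r (\<pi> j) = \<bar>(\<rho> (\<pi> j) * sqrt (r (\<pi> j) / s j))\<^sup>2 * s j\<bar>"
      using s[OF j] by (simp add: power_mult_distrib)
    finally show "\<bar>LINT x:ball (d j) (s j)|lborel. (v (\<pi> j) (x + \<tau> j))\<^sup>2\<bar>
        \<le> C * \<bar>(\<rho> (\<pi> j) * sqrt (r (\<pi> j) / s j))\<^sup>2 * s j\<bar>" by simp
  qed
  moreover have "sq_int (ball (d j) (s j)) (\<lambda>x. v (\<pi> j) (x + \<tau> j))" if "j \<in> J" for j
    by (rule sq_int_shift(1)[OF sq_int_v[OF that]]) (use sub[OF that] in auto)
  ultimately show ?thesis by simp
qed

lemma sobolev_bigo_localize_weak:
  "sobolev_bigo I c r m v \<rho> \<Longrightarrow>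
    sobolev_bigo J d s m (\<lambda>j x. v (\<pi> j) (x + \<tau> j)) (\<lambda>j. \<rho> (\<pi> j) * sqrt (r (\<pi> j) / s j))"
proof (induction m arbitrary: v \<rho>)
  case 0
  then show ?case by (rule sobolev_bigo_0_localize)
next
  case (Suc m)
  obtain w where w: "\<And>i. i \<in> I \<Longrightarrow> primitive_on (ball (c i) (r i)) (v i) (w i)" "sobolev_bigo I c r m w (\<lambda>i. \<rho> i / r i)"
    using sobolev_bigo_SucE[OF Suc.prems] by blast
  obtain C where C: "C > 0" "\<And>i x. i \<in> I \<Longrightarrow> x \<in> ball (c i) (r i) \<Longrightarrow> \<bar>v i x\<bar> \<le> C * \<bar>\<rho> i\<bar>"
    using sobolev_bigo_sup[OF Suc.prems] unfolding sup_bigo_iff by blast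
  show ?case
  proof (rule sobolev_bigo_SucI)
    show "sup_bigo J d s (\<lambda>j x. v (\<pi> j) (x + \<tau> j)) (\<lambda>j. \<rho> (\<pi> j) * sqrt (r (\<pi> j) / s j))"
    proof (rule sup_bigoI)
      fix j x assume j: "j \<in> J" and x: "x \<in> ball (d j) (s j)"
      have "\<bar>v (\<pi> j) (x + \<tau> j)\<bar> \<le> C * \<bar>\<rho> (\<pi> j)\<bar>" by (rule C(2)[OF \<pi>[OF j] sub[OF j x]])
      also have "\<dots> \<le> C * (\<bar>\<rho> (\<pi> j)\<bar> * sqrt (r (\<pi> j) / s j))"
        using C(1) s[OF j] by (intro mult_left_mono mult_le_cancel_left1[THEN iffD2]) (auto simp: real_sqrt_ge_1_iff)
      finally show "\<bar>v (\<pi> j) (x + \<tau> j)\<bar> \<le> C * \<bar>\<rho> (\<pi> j) * sqrt (r (\<pi> j) / s j)\<bar>"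
        using s[OF j] by (simp add: abs_mult)
    qed
    show "primitive_on (ball (d j) (s j)) (\<lambda>x. v (\<pi> j) (x + \<tau> j)) (\<lambda>x. w (\<pi> j) (x + \<tau> j))" if "j \<in> J" for j
      by (rule primitive_on_shift[OF w(1)[OF \<pi>[OF that]] sub[OF that]])
    show "sobolev_bigo J d s m (\<lambda>j x. w (\<pi> j) (x + \<tau> j)) (\<lambda>j. \<rho> (\<pi> j) * sqrt (r (\<pi> j) / s j) / s j)"
    proof (rule sobolev_bigo_trans[OF Suc.IH[OF w(2)]], rule principal_bigoI)
      fix j assume j: "j \<in> J"
      have "\<bar>\<rho> (\<pi> j) * sqrt (r (\<pi> j) / s j)\<bar> / r (\<pi> j) \<le> \<bar>\<rho> (\<pi> j) * sqrt (r (\<pi> j) / s j)\<bar> / s j"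
        using s[OF j] by (intro divide_left_mono) auto
      then show "\<bar>\<rho> (\<pi> j) / r (\<pi> j) * sqrt (r (\<pi> j) / s j)\<bar> \<le> 1 * \<bar>\<rho> (\<pi> j) * sqrt (r (\<pi> j) / s j) / s j\<bar>"
        using s[OF j] by (simp add: abs_mult)
    qed
  qed
qed

text \<open>The factor \<open>sqrt (r / s)\<close> of the weak version is absorbed by the gain \<open>s / r\<close> of one derivative.\<close>

lemma sobolev_bigo_localize:
  assumes v: "sobolev_bigo I c r (Suc m) v \<rho>"
  shows "sobolev_bigo J d s (Suc m) (\<lambda>j x. v (\<pi> j) (x + \<tau> j)) (\<lambda>j. \<rho> (\<pi> j))"
proof -
  obtain w where w: "\<And>i. i \<in> I \<Longrightarrow> primitive_on (ball (c i) (r i)) (v i) (w i)" "sobolev_bigo I c r m w (\<lambda>i. \<rho> i / r i)"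
    using sobolev_bigo_SucE[OF v] by blast
  obtain C where C: "\<And>i x. i \<in> I \<Longrightarrow> x \<in> ball (c i) (r i) \<Longrightarrow> \<bar>v i x\<bar> \<le> C * \<bar>\<rho> i\<bar>"
    using sobolev_bigo_sup[OF v] unfolding sup_bigo_iff by blast
  show ?thesis
  proof (rule sobolev_bigo_SucI)
    show "sup_bigo J d s (\<lambda>j x. v (\<pi> j) (x + \<tau> j)) (\<lambda>j. \<rho> (\<pi> j))"
      by (rule sup_bigoI[of _ _ _ _ C]) (use C \<pi> sub in blast)
    show "primitive_on (ball (d j) (s j)) (\<lambda>x. v (\<pi> j) (x + \<tau> j)) (\<lambda>x. w (\<pi> j) (x + \<tau> j))" if "j \<in> J" for j
      by (rule primitive_on_shift[OF w(1)[OF \<pi>[OF that]] sub[OF that]])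
    have "sobolev_bigo J d s m (\<lambda>j x. w (\<pi> j) (x + \<tau> j)) (\<lambda>j. \<rho> (\<pi> j) / r (\<pi> j) * sqrt (r (\<pi> j) / s j))"
      by (rule sobolev_bigo_localize_weak[OF w(2)])
    then show "sobolev_bigo J d s m (\<lambda>j x. w (\<pi> j) (x + \<tau> j)) (\<lambda>j. \<rho> (\<pi> j) / s j)"
    proof (rule sobolev_bigo_trans, intro principal_bigoI)
      fix j assume j: "j \<in> J"
      have "1 \<le> r (\<pi> j) / s j" using s[OF j] by simp
      then have "sqrt (r (\<pi> j) / s j) \<le> r (\<pi> j) / s j"
        by (intro real_le_lsqrt self_le_power) auto
      then have "\<bar>\<rho> (\<pi> j) / r (\<pi> j)\<bar> * sqrt (r (\<pi> j) / s j) \<le> \<bar>\<rho> (\<pi> j) / r (\<pi> j)\<bar> * (r (\<pi> j) / s j)"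
        by (intro mult_left_mono) auto
      also have "\<dots> = \<bar>\<rho> (\<pi> j) / s j\<bar>" using s[OF j] by (simp add: abs_divide)
      finally show "\<bar>\<rho> (\<pi> j) / r (\<pi> j) * sqrt (r (\<pi> j) / s j)\<bar> \<le> 1 * \<bar>\<rho> (\<pi> j) / s j\<bar>"
        using s[OF j] by (simp add: abs_mult)
    qed
  qed
qed

end

lemma sobolev_bigo_subset:
  assumes r: "\<And>i. i \<in> J \<Longrightarrow> 0 < r i" and v: "sobolev_bigo I c r (Suc m) v \<rho>" and J: "J \<subseteq> I"
  shows "sobolev_bigo J c r (Suc m) v \<rho>"
  using sobolev_bigo_localize[where \<pi> = id and s = r and \<tau> = "\<lambda>_. 0" and d = c, OF _ r _ _ v] J by auto

lemma sobolev_bigo_if_minus_const: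
  assumes r: "\<And>i. i \<in> I \<Longrightarrow> 0 < r i" and v: "sobolev_bigo I c r m (\<lambda>i x. v i x - b) \<rho>"
    and \<rho>: "\<rho> \<in> O[principal I](\<lambda>_. 1)"
  shows "sobolev_bigo I c r m v (\<lambda>_. 1)"
proof -
  have "sobolev_bigo I c r m (\<lambda>_ _. b) (\<lambda>_. 1)"
    by (rule sobolev_bigo_trans[OF sobolev_bigo_const[OF r]]) (auto intro: principal_bigoI[of _ _ "\<bar>b\<bar>"])
  from sobolev_bigo_add[OF sobolev_bigo_trans[OF v \<rho>] this] show ?thesis by simp
qed

lemma sobolev_bigo_has_real_derivative:
  assumes v': "sobolev_bigo I c r (Suc m) v' \<rho>" and v: "\<And>i. i \<in> I \<Longrightarrow> primitive_on (ball (c i) (r i)) (v i) (v' i)"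
    and iy: "i \<in> I" "y \<in> ball (c i) (r i)"
  shows "(v i has_real_derivative v' i y) (at y)"
  by (rule primitive_on_has_derivative[OF v[OF iy(1)] open_ball sobolev_bigo_continuous[OF v' iy(1)] iy(2)])

subsection \<open>Regular representatives of Sobolev functions\<close>

lemma set_lebesgue_integral_le_integral:
  fixes f :: "'a \<Rightarrow> real"
  assumes f: "integrable M f" "\<And>x. 0 \<le> f x" and A: "A \<in> sets M"
  shows "(LINT x:A|M. f x) \<le> (LINT x|M. f x)"
  unfolding set_lebesgue_integral_def
  by (intro integral_mono integrable_mult_indicator A f) (auto simp: indicator_def f)

lemma primitive_on_power2_increment_le:
  assumes p: "primitive_on UNIV V W" and V: "sq_int UNIV V" and W: "sq_int UNIV W" and xy: "x \<le> y"
  shows "(V x)\<^sup>2 \<le> (V y)\<^sup>2 + ((LINT s|lborel. (V s)\<^sup>2) + (LINT s|lborel. (W s)\<^sup>2))"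
proof -
  have integrable: "integrable lborel (\<lambda>s. (V s)\<^sup>2)" "integrable lborel (\<lambda>s. (W s)\<^sup>2)"
    using V W by (auto simp: sq_int_def set_integrable_def)
  have primitive_square: "primitive_on UNIV (\<lambda>s. (-1) * (V s * V s)) (\<lambda>s. (-1) * (W s * V s + V s * W s))"
    by (intro primitive_on_cmult primitive_on_mult p)
  have "(V x)\<^sup>2 - (V y)\<^sup>2 = (LINT s:{x..y}|lborel. (-1) * (W s * V s + V s * W s))"
    using primitive_on_integral[OF primitive_square xy] by (simp add: power2_eq_square)
  also have "\<dots> \<le> (LINT s:{x..y}|lborel. (V s)\<^sup>2 + (W s)\<^sup>2)"
  proof (rule set_integral_mono)
    show "set_integrable lborel {x..y} (\<lambda>s. (-1) * (W s * V s + V s * W s))"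
      by (rule primitive_on_integrable[OF primitive_square]) simp
    show "set_integrable lborel {x..y} (\<lambda>s. (V s)\<^sup>2 + (W s)\<^sup>2)"
      using integrable unfolding set_integrable_def by (intro integrable_mult_indicator) auto
    show "(-1) * (W s * V s + V s * W s) \<le> (V s)\<^sup>2 + (W s)\<^sup>2" for s
      using zero_le_power2[of "V s + W s"] unfolding power2_sum by (simp add: algebra_simps)
  qed
  also have "\<dots> \<le> (LINT s|lborel. (V s)\<^sup>2 + (W s)\<^sup>2)"
    by (rule set_lebesgue_integral_le_integral) (use integrable in auto)
  finally show ?thesis
    using integrable by simp
qed

lemma primitive_on_power2_le:
  assumes p: "primitive_on UNIV V W" and V: "sq_int UNIV V" and W: "sq_int UNIV W"
  shows "(V x)\<^sup>2 \<le> 2 * (LINT y|lborel. (V y)\<^sup>2) + (LINT y|lborel. (W y)\<^sup>2)"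
proof -
  define K where "K = (LINT s|lborel. (V s)\<^sup>2) + (LINT s|lborel. (W s)\<^sup>2)"
  have integrable: "integrable lborel (\<lambda>y. (V y)\<^sup>2)"
    using V by (simp add: sq_int_def set_integrable_def)
  have integrable_const: "set_integrable lborel {x..x + 1} (\<lambda>_. a)" for a :: real
    by (rule borel_integrable_atLeastAtMost') simp
  have integrable_Icc: "set_integrable lborel {x..x + 1} (\<lambda>y. (V y)\<^sup>2)"
    using integrable unfolding set_integrable_def by (intro integrable_mult_indicator) auto
  have "(V x)\<^sup>2 = (LINT y:{x..x + 1}|lborel. (V x)\<^sup>2)"
    by (simp add: set_lebesgue_integral_def)
  also have "\<dots> \<le> (LINT y:{x..x + 1}|lborel. (V y)\<^sup>2 + K)"
    unfolding K_def using primitive_on_power2_increment_le[OF p V W]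
    by (intro set_integral_mono integrable_const set_integral_add integrable_Icc) auto
  also have "\<dots> = (LINT y:{x..x + 1}|lborel. (V y)\<^sup>2) + (LINT y:{x..x + 1}|lborel. K)"
    by (rule set_integral_add(2)[OF integrable_Icc integrable_const])
  also have "\<dots> \<le> (LINT y|lborel. (V y)\<^sup>2) + K"
    using set_lebesgue_integral_le_integral[OF integrable, of "{x..x + 1}"] by (simp add: set_lebesgue_integral_def)
  finally show ?thesis by (simp add: K_def)
qed

lemma sq_int_UNIV_cong_AE:
  assumes v: "sq_int UNIV v" and eq: "AE x in lborel. v x = v' x" and v'_measurable: "v' \<in> borel_measurable lborel"
  shows "sq_int UNIV v'" "(LINT x|lborel. (v' x)\<^sup>2) = (LINT x|lborel. (v x)\<^sup>2)"
proof -
  have v_measurable: "v \<in> borel_measurable lborel"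
    using v by (simp add: sq_int_def set_borel_measurable_def)
  have "integrable lborel (\<lambda>x. (v' x)\<^sup>2) \<longleftrightarrow> integrable lborel (\<lambda>x. (v x)\<^sup>2)"
    using eq v_measurable v'_measurable by (intro integrable_cong_AE) auto
  then show "sq_int UNIV v'"
    using v v'_measurable by (simp add: sq_int_def set_integrable_def set_borel_measurable_def)
  show "(LINT x|lborel. (v' x)\<^sup>2) = (LINT x|lborel. (v x)\<^sup>2)"
    using eq v_measurable v'_measurable by (intro integral_cong_AE) auto
qed

lemma H_witness_primitive_chain:
  assumes H: "H_witness m f D"
  shows "\<exists>F. (AE x in lborel. f x = F 0 x) \<and> (\<forall>j<m. primitive_on UNIV (F j) (F (Suc j))) \<and>
    (\<forall>j\<le>m. sq_int UNIV (F j) \<and> (LINT x|lborel. (F j x)\<^sup>2) \<le> H_sq m D)"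
proof -
  have D: "weak_deriv UNIV j f (D j)" "sq_int UNIV (D j)" if "j \<le> m" for j
    using H that unfolding H_witness_def by auto
  have D_measurable: "D j \<in> borel_measurable lborel" if "j \<le> m" for j
    using D(2)[OF that] by (simp add: sq_int_def set_borel_measurable_def)
  have "\<exists>V. primitive_on UNIV V (D (Suc j)) \<and> (AE x in lborel. D j x = V x)" if "j < m" for j
    using weak_deriv_Suc_representative[OF D(1) D(1), of j] that by (metis Suc_leI less_imp_le)
  then obtain V where V: "\<And>j. j < m \<Longrightarrow> primitive_on UNIV (V j) (D (Suc j))"
      "\<And>j. j < m \<Longrightarrow> AE x in lborel. D j x = V j x"
    by metis
  define F where "F j = (if j < m then V j else D j)" for j
  have F_measurable: "F j \<in> borel_measurable lborel" if "j \<le> m" for j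
    using D_measurable[OF that] primitive_on_continuous[OF V(1)]
    by (auto simp: F_def borel_measurable_continuous_onI)
  have D_eq_F: "AE x in lborel. D j x = F j x" for j
    using V(2) by (auto simp: F_def)
  show ?thesis
  proof (intro exI[of _ F] conjI allI impI)
    show "AE x in lborel. f x = F 0 x"
      using D_eq_F[of 0] H by (simp add: H_witness_def)
    show "primitive_on UNIV (F j) (F (Suc j))" if "j < m" for j
    proof (rule primitive_on_cong_AE[OF _ D_eq_F])
      show "primitive_on UNIV (F j) (D (Suc j))"
        using V(1)[OF that] that by (simp add: F_def)
    qed (use that D_measurable F_measurable in auto)
    show "sq_int UNIV (F j)" if "j \<le> m" for j
      by (rule sq_int_UNIV_cong_AE(1)[OF D(2)[OF that] D_eq_F F_measurable[OF that]])
    show "(LINT x|lborel. (F j x)\<^sup>2) \<le> H_sq m D" if "j \<le> m" for j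
    proof -
      have "(LINT x|lborel. (D j x)\<^sup>2) \<le> H_sq m D"
        unfolding H_sq_def using that by (intro member_le_sum) auto
      then show ?thesis
        by (simp add: sq_int_UNIV_cong_AE(2)[OF D(2)[OF that] D_eq_F F_measurable[OF that]])
    qed
  qed
qed

lemma sq_int_UNIV_sobolev_bigo_0:
  assumes R: "R > 0" and sq_int: "\<And>i. i \<in> I \<Longrightarrow> sq_int UNIV (v i)" and norm_le: "\<And>i. i \<in> I \<Longrightarrow> (LINT x|lborel. (v i x)\<^sup>2) \<le> (\<rho> i)\<^sup>2"
  shows "sobolev_bigo I c (\<lambda>_. R) 0 v \<rho>"
proof -
  have "sq_int (ball (c i) R) (v i)" if "i \<in> I" for i
    using sq_int[OF that] unfolding sq_int_def
    by (auto intro: set_borel_measurable_subset set_integrable_subset)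
  moreover have "(\<lambda>i. LINT x:ball (c i) R|lborel. (v i x)\<^sup>2) \<in> O[principal I](\<lambda>i. (\<rho> i)\<^sup>2 * R)"
  proof (rule principal_bigoI)
    fix i assume i: "i \<in> I"
    have "(LINT x:ball (c i) R|lborel. (v i x)\<^sup>2) \<le> (LINT x|lborel. (v i x)\<^sup>2)"
      by (rule set_lebesgue_integral_le_integral) (use sq_int[OF i] in \<open>auto simp: sq_int_def set_integrable_def\<close>)
    then show "\<bar>LINT x:ball (c i) R|lborel. (v i x)\<^sup>2\<bar> \<le> (1 / R) * \<bar>(\<rho> i)\<^sup>2 * R\<bar>"
      using norm_le[OF i] R by (simp add: abs_mult)
  qed
  ultimately show ?thesis by simp
qed

lemma sobolev_bigo_primitive_chain:
  assumes R: "R > 0"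
  shows "(\<And>i j. i \<in> I \<Longrightarrow> j < m \<Longrightarrow> primitive_on UNIV (F i j) (F i (Suc j))) \<Longrightarrow>
    (\<And>i j. i \<in> I \<Longrightarrow> j \<le> m \<Longrightarrow> sq_int UNIV (F i j)) \<Longrightarrow>
    (\<And>i j. i \<in> I \<Longrightarrow> j \<le> m \<Longrightarrow> (LINT x|lborel. (F i j x)\<^sup>2) \<le> (\<rho> i)\<^sup>2) \<Longrightarrow>
    sobolev_bigo I c (\<lambda>_. R) m (\<lambda>i. F i 0) \<rho>"
proof (induction m arbitrary: F)
  case 0
  then show ?case by (intro sq_int_UNIV_sobolev_bigo_0[OF R]) auto
next
  case (Suc m)
  show ?case
  proof (rule sobolev_bigo_SucI)
    show "sup_bigo I c (\<lambda>_. R) (\<lambda>i. F i 0) \<rho>"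
    proof (rule sup_bigoI)
      fix i x assume i: "i \<in> I"
      have "(F i 0 x)\<^sup>2 \<le> 2 * (LINT y|lborel. (F i 0 y)\<^sup>2) + (LINT y|lborel. (F i (Suc 0) y)\<^sup>2)"
        by (rule primitive_on_power2_le) (use Suc.prems i in auto)
      also have "\<dots> \<le> (2 * \<bar>\<rho> i\<bar>)\<^sup>2"
      proof -
        have "(2 * \<bar>\<rho> i\<bar>)\<^sup>2 = 4 * (\<rho> i)\<^sup>2" by (simp add: power_mult_distrib)
        then show ?thesis
          using Suc.prems(3)[OF i, of 0] Suc.prems(3)[OF i, of "Suc 0"] zero_le_power2[of "\<rho> i"] by linarith
      qed
      finally have "\<bar>F i 0 x\<bar> \<le> \<bar>2 * \<bar>\<rho> i\<bar>\<bar>" unfolding abs_le_square_iff .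
      then show "\<bar>F i 0 x\<bar> \<le> 2 * \<bar>\<rho> i\<bar>" by simp
    qed
    show "primitive_on (ball (c i) R) (F i 0) (F i (Suc 0))" if "i \<in> I" for i
      using Suc.prems(1)[OF that, of 0] by (auto intro: primitive_on_subset)
    have "sobolev_bigo I c (\<lambda>_. R) m (\<lambda>i. F i (Suc 0)) \<rho>"
      by (rule Suc.IH[of "\<lambda>i j. F i (Suc j)"]) (use Suc.prems in auto)
    then show "sobolev_bigo I c (\<lambda>_. R) m (\<lambda>i. F i (Suc 0)) (\<lambda>i. \<rho> i / R)"
      by (rule sobolev_bigo_trans) (use R in \<open>auto intro: principal_bigoI[of _ _ R]\<close>)
  qed
qed

lemma H_witness_sobolev_bigo:
  assumes R: "R > 0" and H: "\<And>i. i \<in> I \<Longrightarrow> H_witness m (f i) (D i)" "\<And>i. i \<in> I \<Longrightarrow> H_sq m (D i) \<le> (\<rho> i)\<^sup>2"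
  obtains h where "\<forall>i\<in>I. AE x in lborel. f i x = h i x" "sobolev_bigo I c (\<lambda>_. R) m h \<rho>"
proof -
  define chain where "chain i F \<longleftrightarrow> (AE x in lborel. f i x = F 0 x) \<and> (\<forall>j<m. primitive_on UNIV (F j) (F (Suc j))) \<and>
      (\<forall>j\<le>m. sq_int UNIV (F j) \<and> (LINT x|lborel. (F j x)\<^sup>2) \<le> H_sq m (D i))" for i F
  have "\<exists>F. chain i F" if "i \<in> I" for i
    unfolding chain_def by (rule H_witness_primitive_chain[OF H(1)[OF that]])
  then obtain F where "\<And>i. i \<in> I \<Longrightarrow> chain i (F i)"
    by metis
  then have F: "\<And>i. i \<in> I \<Longrightarrow> AE x in lborel. f i x = F i 0 x"
      "\<And>i j. i \<in> I \<Longrightarrow> j < m \<Longrightarrow> primitive_on UNIV (F i j) (F i (Suc j))"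
      "\<And>i j. i \<in> I \<Longrightarrow> j \<le> m \<Longrightarrow> sq_int UNIV (F i j)"
      "\<And>i j. i \<in> I \<Longrightarrow> j \<le> m \<Longrightarrow> (LINT x|lborel. (F i j x)\<^sup>2) \<le> (\<rho> i)\<^sup>2"
    unfolding chain_def using order_trans[OF _ H(2)] by blast+
  show thesis
  proof (rule that)
    show "\<forall>i\<in>I. AE x in lborel. f i x = F i 0 x" using F(1) by blast
    show "sobolev_bigo I c (\<lambda>_. R) m (\<lambda>i. F i 0) \<rho>"
      by (rule sobolev_bigo_primitive_chain[OF R, where F = F]) (use F in blast)+
  qed
qed

lemma data_small_imp_H_sq_le:
  assumes "data_small k f g \<epsilon>"
  shows "\<exists>D. H_witness (Suc k) f D \<and> H_sq (Suc k) D \<le> \<epsilon>\<^sup>2" "\<exists>D. H_witness k g D \<and> H_sq k D \<le> \<epsilon>\<^sup>2"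
proof -
  obtain Df Dg where D: "H_witness (Suc k) f Df" "H_witness k g Dg" "sqrt (H_sq (Suc k) Df + H_sq k Dg) \<le> \<epsilon>"
    using assms unfolding data_small_def by auto
  have nonneg: "0 \<le> H_sq n D" for n D
    unfolding H_sq_def by (intro sum_nonneg) auto
  have "H_sq (Suc k) Df + H_sq k Dg \<le> \<epsilon>\<^sup>2" by (rule sqrt_le_D[OF D(3)])
  then have "H_sq (Suc k) Df \<le> \<epsilon>\<^sup>2" "H_sq k Dg \<le> \<epsilon>\<^sup>2"
    using nonneg[of "Suc k" Df] nonneg[of k Dg] by linarith+
  then show "\<exists>D. H_witness (Suc k) f D \<and> H_sq (Suc k) D \<le> \<epsilon>\<^sup>2" "\<exists>D. H_witness k g D \<and> H_sq k D \<le> \<epsilon>\<^sup>2"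
    using D by blast+
qed

lemma data_small_sobolev_bigo:
  assumes R: "R > 0" and small: "\<And>i. i \<in> I \<Longrightarrow> data_small k (f i) (g i) (\<epsilon> i)"
  obtains h l where "\<forall>i\<in>I. AE x in lborel. f i x = h i x" "\<forall>i\<in>I. AE x in lborel. g i x = l i x"
    "sobolev_bigo I c (\<lambda>_. R) (Suc k) h \<epsilon>" "sobolev_bigo I c (\<lambda>_. R) k l \<epsilon>"
proof -
  obtain Df where Df: "\<And>i. i \<in> I \<Longrightarrow> H_witness (Suc k) (f i) (Df i)" "\<And>i. i \<in> I \<Longrightarrow> H_sq (Suc k) (Df i) \<le> (\<epsilon> i)\<^sup>2"
    using data_small_imp_H_sq_le(1)[OF small] by metis
  obtain Dg where Dg: "\<And>i. i \<in> I \<Longrightarrow> H_witness k (g i) (Dg i)" "\<And>i. i \<in> I \<Longrightarrow> H_sq k (Dg i) \<le> (\<epsilon> i)\<^sup>2"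
    using data_small_imp_H_sq_le(2)[OF small] by metis
  obtain h where h: "\<forall>i\<in>I. AE x in lborel. f i x = h i x" "sobolev_bigo I c (\<lambda>_. R) (Suc k) h \<epsilon>"
    by (rule H_witness_sobolev_bigo[OF R Df])
  obtain l where l: "\<forall>i\<in>I. AE x in lborel. g i x = l i x" "sobolev_bigo I c (\<lambda>_. R) k l \<epsilon>"
    by (rule H_witness_sobolev_bigo[OF R Dg])
  show thesis by (rule that[OF h(1) l(1) h(2) l(2)])
qed

subsection \<open>Twice continuously differentiable functions\<close>

definition C2_on ::
  "'a::real_inner set \<Rightarrow> ('a \<Rightarrow> real) \<Rightarrow> ('a \<Rightarrow> 'a) \<Rightarrow> ('a \<Rightarrow> 'a \<Rightarrow> 'a) \<Rightarrow> bool" where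
  "C2_on S u Du D2u \<longleftrightarrow>
     (\<forall>z\<in>S. (u has_derivative (\<lambda>h. Du z \<bullet> h)) (at z within S)) \<and>
     (\<forall>z\<in>S. (Du has_derivative D2u z) (at z within S)) \<and>
     (\<forall>h. continuous_on S (\<lambda>z. D2u z h))"

lemma C2_onD:
  assumes "C2_on S u Du D2u"
  shows "\<And>z. z \<in> S \<Longrightarrow> (u has_derivative (\<lambda>h. Du z \<bullet> h)) (at z within S)"
    "\<And>z. z \<in> S \<Longrightarrow> (Du has_derivative D2u z) (at z within S)"
    "\<And>h. continuous_on S (\<lambda>z. D2u z h)"
  using assms by (auto simp: C2_on_def)

lemma C2_on_continuous:
  assumes "C2_on S u Du D2u"
  shows "continuous_on S u" "continuous_on S Du"
  by (rule has_derivative_continuous_on, erule C2_onD[OF assms])+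

lemma C2_on_diff:
  assumes u: "C2_on S u Du D2u" and v: "C2_on S v Dv D2v"
  shows "C2_on S (\<lambda>z. u z - v z) (\<lambda>z. Du z - Dv z) (\<lambda>z h. D2u z h - D2v z h)"
  unfolding C2_on_def
proof (intro conjI ballI allI)
  fix z assume z: "z \<in> S"
  show "((\<lambda>z. u z - v z) has_derivative (\<lambda>h. (Du z - Dv z) \<bullet> h)) (at z within S)"
    unfolding inner_diff_left by (intro has_derivative_diff C2_onD(1)[OF u z] C2_onD(1)[OF v z])
  show "((\<lambda>z. Du z - Dv z) has_derivative (\<lambda>h. D2u z h - D2v z h)) (at z within S)"
    by (intro has_derivative_diff C2_onD(2)[OF u z] C2_onD(2)[OF v z])
qed (intro continuous_intros C2_onD(3)[OF u] C2_onD(3)[OF v])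

lemma C2_on_comp:
  fixes \<phi> \<phi>' \<phi>'' :: "real \<Rightarrow> real"
  assumes u: "C2_on S u Du D2u" and uJ: "\<And>z. z \<in> S \<Longrightarrow> u z \<in> J"
    and \<phi>: "\<And>y. y \<in> J \<Longrightarrow> (\<phi> has_real_derivative \<phi>' y) (at y)"
    and \<phi>': "\<And>y. y \<in> J \<Longrightarrow> (\<phi>' has_real_derivative \<phi>'' y) (at y)" and \<phi>'': "continuous_on J \<phi>''"
  shows "C2_on S (\<lambda>z. \<phi> (u z)) (\<lambda>z. \<phi>' (u z) *\<^sub>R Du z)
    (\<lambda>z h. \<phi>' (u z) *\<^sub>R D2u z h + (\<phi>'' (u z) * (Du z \<bullet> h)) *\<^sub>R Du z)"
  unfolding C2_on_def
proof (intro conjI ballI allI)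
  have chain: "((\<lambda>z. \<psi> (u z)) has_derivative (\<lambda>h. \<psi>' (u z) * (Du z \<bullet> h))) (at z within S)"
    if z: "z \<in> S" and \<psi>: "\<And>y. y \<in> J \<Longrightarrow> (\<psi> has_real_derivative \<psi>' y) (at y)" for \<psi> \<psi>' z
    using has_derivative_compose[OF C2_onD(1)[OF u z] \<psi>[OF uJ[OF z], unfolded has_field_derivative_def]]
    by simp
  fix z assume z: "z \<in> S"
  show "((\<lambda>z. \<phi> (u z)) has_derivative (\<lambda>h. (\<phi>' (u z) *\<^sub>R Du z) \<bullet> h)) (at z within S)"
    using chain[OF z \<phi>] by simp
  show "((\<lambda>z. \<phi>' (u z) *\<^sub>R Du z) has_derivative
      (\<lambda>h. \<phi>' (u z) *\<^sub>R D2u z h + (\<phi>'' (u z) * (Du z \<bullet> h)) *\<^sub>R Du z)) (at z within S)"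
    by (rule has_derivative_scaleR[OF chain[OF z \<phi>'] C2_onD(2)[OF u z]])
next
  fix h
  have "continuous_on J \<phi>'"
    by (rule DERIV_continuous_on[OF has_field_derivative_at_within[OF \<phi>']])
  then have "continuous_on S (\<lambda>z. \<phi>' (u z))" "continuous_on S (\<lambda>z. \<phi>'' (u z))"
    using \<phi>'' C2_on_continuous(1)[OF u] uJ by (auto intro: continuous_on_compose2)
  then show "continuous_on S (\<lambda>z. \<phi>' (u z) *\<^sub>R D2u z h + (\<phi>'' (u z) * (Du z \<bullet> h)) *\<^sub>R Du z)"
    by (intro continuous_intros C2_onD(3)[OF u] C2_on_continuous(2)[OF u])
qed

lemma has_derivative_along_line:
  fixes U :: "'a::real_normed_vector \<Rightarrow> 'b::real_normed_vector"
  assumes U: "(U has_derivative L) (at (p + s *\<^sub>R d) within S)" and I: "\<And>\<sigma>. \<sigma> \<in> I \<Longrightarrow> p + \<sigma> *\<^sub>R d \<in> S"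
  shows "((\<lambda>\<sigma>. U (p + \<sigma> *\<^sub>R d)) has_vector_derivative L d) (at s within I)"
proof -
  have line: "((\<lambda>\<sigma>. p + \<sigma> *\<^sub>R d) has_derivative (\<lambda>h. h *\<^sub>R d)) (at s within I)"
    by (auto intro!: derivative_eq_intros)
  have "(U has_derivative L) (at (p + s *\<^sub>R d) within (\<lambda>\<sigma>. p + \<sigma> *\<^sub>R d) ` I)"
    using U I by (auto intro: has_derivative_subset)
  from has_derivative_in_compose[OF line this] show ?thesis
    unfolding has_vector_derivative_def using linear_cmul[OF has_derivative_linear[OF U]] by simp
qed

lemma mixed_difference_quotient:
  fixes u :: "'a::real_inner \<Rightarrow> real"
  assumes h: "0 < h"
    and u: "\<And>z. z \<in> S \<Longrightarrow> (u has_derivative (\<lambda>k. Du z \<bullet> k)) (at z)"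
    and Du: "\<And>z. z \<in> S \<Longrightarrow> (Du has_derivative D2u z) (at z)"
    and square: "\<And>a b. a \<in> {0..h} \<Longrightarrow> b \<in> {0..h} \<Longrightarrow> p + a *\<^sub>R d + b *\<^sub>R e \<in> S"
  obtains a b where "a \<in> {0..h}" "b \<in> {0..h}"
    "u (p + h *\<^sub>R d + h *\<^sub>R e) - u (p + h *\<^sub>R d) - u (p + h *\<^sub>R e) + u p
       = h * h * (D2u (p + a *\<^sub>R d + b *\<^sub>R e) e \<bullet> d)"
proof -
  define \<phi> where "\<phi> a = u ((p + h *\<^sub>R e) + a *\<^sub>R d) - u (p + a *\<^sub>R d)" for a
  have d\<phi>: "(\<phi> has_real_derivative Du ((p + h *\<^sub>R e) + a *\<^sub>R d) \<bullet> d - Du (p + a *\<^sub>R d) \<bullet> d) (at a)"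
    if a: "0 \<le> a" "a \<le> h" for a
  proof -
    have "(p + h *\<^sub>R e) + a *\<^sub>R d \<in> S" "p + a *\<^sub>R d \<in> S"
      using square[of a h] square[of a 0] a h by (simp_all add: add_ac)
    then show ?thesis
      unfolding \<phi>_def has_real_derivative_iff_has_vector_derivative
      by (intro has_vector_derivative_diff has_derivative_along_line[where S = UNIV] u) auto
  qed
  obtain a where a: "0 < a" "a < h"
      "\<phi> h - \<phi> 0 = (h - 0) * (Du ((p + h *\<^sub>R e) + a *\<^sub>R d) \<bullet> d - Du (p + a *\<^sub>R d) \<bullet> d)"
    using MVT2[OF h d\<phi>] by blast
  define \<psi> where "\<psi> b = Du ((p + a *\<^sub>R d) + b *\<^sub>R e) \<bullet> d" for b
  have d\<psi>: "(\<psi> has_real_derivative D2u ((p + a *\<^sub>R d) + b *\<^sub>R e) e \<bullet> d) (at b)" if "0 \<le> b" "b \<le> h" for b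
  proof -
    have "((\<lambda>b. Du ((p + a *\<^sub>R d) + b *\<^sub>R e)) has_vector_derivative D2u ((p + a *\<^sub>R d) + b *\<^sub>R e) e) (at b)"
      using that a by (intro has_derivative_along_line[where S = UNIV] Du square) auto
    then show ?thesis
      unfolding \<psi>_def has_real_derivative_iff_has_vector_derivative
      by (rule bounded_linear.has_vector_derivative[OF bounded_linear_inner_left])
  qed
  obtain b where b: "0 < b" "b < h" "\<psi> h - \<psi> 0 = (h - 0) * (D2u ((p + a *\<^sub>R d) + b *\<^sub>R e) e \<bullet> d)"
    using MVT2[OF h d\<psi>] by blast
  have "u (p + h *\<^sub>R d + h *\<^sub>R e) - u (p + h *\<^sub>R d) - u (p + h *\<^sub>R e) + u p = \<phi> h - \<phi> 0"
    by (simp add: \<phi>_def add_ac)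
  also have "\<dots> = h * (\<psi> h - \<psi> 0)"
    using a(3) by (simp add: \<psi>_def add_ac)
  also have "\<dots> = h * h * (D2u (p + a *\<^sub>R d + b *\<^sub>R e) e \<bullet> d)"
    using b(3) by simp
  finally show thesis
    using that[of a b] a(1,2) b(1,2) by simp
qed

lemma eventually_nhds_parallelogram:
  fixes p d e :: "'a::real_normed_vector"
  assumes "\<forall>\<^sub>F z in nhds p. P z"
  obtains h where "h > 0" "\<forall>a\<in>{0..h}. \<forall>b\<in>{0..h}. P (p + a *\<^sub>R d + b *\<^sub>R e)"
proof -
  obtain \<rho> where \<rho>: "\<rho> > 0" "\<And>z. dist z p < \<rho> \<Longrightarrow> P z"
    using assms unfolding eventually_nhds_metric by blast
  define h where "h = \<rho> / (norm d + norm e + 1)"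
  have denominator_pos: "norm d + norm e + 1 > 0" by (simp add: add_nonneg_pos)
  then have h: "h > 0" using \<rho>(1) by (simp add: h_def)
  have "dist (p + a *\<^sub>R d + b *\<^sub>R e) p < \<rho>" if "a \<in> {0..h}" "b \<in> {0..h}" for a b
  proof -
    have "dist (p + a *\<^sub>R d + b *\<^sub>R e) p = norm (a *\<^sub>R d + b *\<^sub>R e)" by (simp add: dist_norm add.assoc)
    also have "\<dots> \<le> a * norm d + b * norm e" using norm_triangle_ineq[of "a *\<^sub>R d" "b *\<^sub>R e"] that by simp
    also have "\<dots> \<le> h * norm d + h * norm e" using that by (intro add_mono mult_right_mono) auto
    also have "\<dots> < h * (norm d + norm e + 1)" using h by (simp add: distrib_left)
    also have "\<dots> = \<rho>" using denominator_pos by (simp add: h_def)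
    finally show ?thesis .
  qed
  then show thesis using that[OF h] \<rho>(2) by blast
qed

lemma C2_on_second_derivative_tendsto:
  assumes S: "open S" "p \<in> S" and u: "C2_on S u Du D2u"
  shows "((\<lambda>z. D2u z d \<bullet> e) \<longlongrightarrow> D2u p d \<bullet> e) (nhds p)"
proof -
  have "continuous_on S (\<lambda>z. D2u z d \<bullet> e)"
    by (intro continuous_intros C2_onD(3)[OF u])
  then have "isCont (\<lambda>z. D2u z d \<bullet> e) p"
    using S by (simp add: continuous_on_eq_continuous_at)
  then show ?thesis
    using tendsto_at_iff_tendsto_nhds[of "\<lambda>z. D2u z d \<bullet> e" p] by (simp add: isCont_def)
qed

lemma second_derivative_symmetric:
  fixes u :: "'a::real_inner \<Rightarrow> real"
  assumes S: "open S" "p \<in> S" and u: "C2_on S u Du D2u"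
  shows "D2u p d \<bullet> e = D2u p e \<bullet> d"
proof -
  have u': "(u has_derivative (\<lambda>k. Du z \<bullet> k)) (at z)" "(Du has_derivative D2u z) (at z)" if "z \<in> S" for z
    using C2_onD(1,2)[OF u that] at_within_open[OF that S(1)] by simp_all
  have "\<bar>D2u p d \<bullet> e - D2u p e \<bullet> d\<bar> \<le> 0 + \<epsilon>" if \<epsilon>: "\<epsilon> > 0" for \<epsilon>
  proof -
    have near: "\<forall>\<^sub>F z in nhds p. \<bar>D2u z d' \<bullet> e' - D2u p d' \<bullet> e'\<bar> < \<epsilon> / 2" for d' e'
      using tendstoD[OF C2_on_second_derivative_tendsto[OF S u], of "\<epsilon> / 2"] \<epsilon> by (simp add: dist_real_def)
    have "\<forall>\<^sub>F z in nhds p. z \<in> S \<and> \<bar>D2u z d \<bullet> e - D2u p d \<bullet> e\<bar> < \<epsilon> / 2 \<and> \<bar>D2u z e \<bullet> d - D2u p e \<bullet> d\<bar> < \<epsilon> / 2"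
      by (intro eventually_conj eventually_nhds_in_open S near)
    then obtain h where h: "h > 0" and square: "\<forall>a\<in>{0..h}. \<forall>b\<in>{0..h}. p + a *\<^sub>R d + b *\<^sub>R e \<in> S \<and>
        \<bar>D2u (p + a *\<^sub>R d + b *\<^sub>R e) d \<bullet> e - D2u p d \<bullet> e\<bar> < \<epsilon> / 2 \<and>
        \<bar>D2u (p + a *\<^sub>R d + b *\<^sub>R e) e \<bullet> d - D2u p e \<bullet> d\<bar> < \<epsilon> / 2"
      by (rule eventually_nhds_parallelogram)
    have swap: "p + b *\<^sub>R e + a *\<^sub>R d = p + a *\<^sub>R d + b *\<^sub>R e" for a b
      by (simp add: add_ac)
    have in_S: "p + b *\<^sub>R e + a *\<^sub>R d \<in> S" if "b \<in> {0..h}" "a \<in> {0..h}" for a b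
      unfolding swap using square that by blast
    obtain a b where ab: "a \<in> {0..h}" "b \<in> {0..h}"
        "u (p + h *\<^sub>R d + h *\<^sub>R e) - u (p + h *\<^sub>R d) - u (p + h *\<^sub>R e) + u p
         = h * h * (D2u (p + a *\<^sub>R d + b *\<^sub>R e) e \<bullet> d)"
      by (rule mixed_difference_quotient[OF h u', where p = p and d = d and e = e]) (use square in auto)
    obtain b' a' where ba: "b' \<in> {0..h}" "a' \<in> {0..h}"
        "u (p + h *\<^sub>R e + h *\<^sub>R d) - u (p + h *\<^sub>R e) - u (p + h *\<^sub>R d) + u p
         = h * h * (D2u (p + b' *\<^sub>R e + a' *\<^sub>R d) d \<bullet> e)"
      by (rule mixed_difference_quotient[OF h u' in_S])
    have "h * h * (D2u (p + a *\<^sub>R d + b *\<^sub>R e) e \<bullet> d) = h * h * (D2u (p + a' *\<^sub>R d + b' *\<^sub>R e) d \<bullet> e)"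
      using ab(3) ba(3) unfolding swap by linarith
    then have "D2u (p + a *\<^sub>R d + b *\<^sub>R e) e \<bullet> d = D2u (p + a' *\<^sub>R d + b' *\<^sub>R e) d \<bullet> e"
      using h by simp
    moreover have "\<bar>D2u (p + a *\<^sub>R d + b *\<^sub>R e) e \<bullet> d - D2u p e \<bullet> d\<bar> < \<epsilon> / 2"
      using square ab(1,2) by blast
    moreover have "\<bar>D2u (p + a' *\<^sub>R d + b' *\<^sub>R e) d \<bullet> e - D2u p d \<bullet> e\<bar> < \<epsilon> / 2"
      using square ba(1,2) by blast
    ultimately show ?thesis by linarith
  qed
  then have "\<bar>D2u p d \<bullet> e - D2u p e \<bullet> d\<bar> \<le> 0" by (rule field_le_epsilon)
  then show ?thesis by simp
qed

lemma C2_on_interior: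
  assumes u: "C2_on S u Du D2u"
  shows "C2_on (interior S) u Du D2u"
  unfolding C2_on_def
  using C2_onD(1,2)[OF u, THEN has_derivative_subset[OF _ interior_subset]]
    continuous_on_subset[OF C2_onD(3)[OF u] interior_subset] interior_subset by blast

lemma continuous_eq_on_dense_subset:
  fixes f g :: "'a::topological_space \<Rightarrow> real"
  assumes f: "continuous_on S f" and g: "continuous_on S g" and A: "A \<subseteq> S" "S \<subseteq> closure A"
    and eq: "\<And>x. x \<in> A \<Longrightarrow> f x = g x" and x: "x \<in> S"
  shows "f x = g x"
proof -
  have "closedin (top_of_set S) {x \<in> S. f x - g x = 0}"
    by (intro continuous_closedin_preimage_constant continuous_intros f g)
  then obtain K where K: "closed K" "{x \<in> S. f x - g x = 0} = S \<inter> K"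
    unfolding closedin_closed by auto
  then have "A \<subseteq> K" using A eq by auto
  then have "closure A \<subseteq> K" using K(1) by (rule closure_minimal)
  then show ?thesis using A(2) x K(2) by auto
qed

lemma C2_on_second_derivative_symmetric:
  assumes u: "C2_on S u Du D2u" and S: "S \<subseteq> closure (interior S)" and z: "z \<in> S"
  shows "D2u z d \<bullet> e = D2u z e \<bullet> d"
proof (rule continuous_eq_on_dense_subset[OF _ _ interior_subset S _ z])
  show "continuous_on S (\<lambda>z. D2u z d \<bullet> e)" "continuous_on S (\<lambda>z. D2u z e \<bullet> d)"
    by (intro continuous_intros C2_onD(3)[OF u])+
  show "D2u z d \<bullet> e = D2u z e \<bullet> d" if "z \<in> interior S" for z
    by (rule second_derivative_symmetric[OF open_interior that C2_on_interior[OF u]])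
qed

subsection \<open>The wave equation in a light cone\<close>

definition dalembertian :: "(real \<times> real \<Rightarrow> real \<times> real \<Rightarrow> real \<times> real) \<Rightarrow> real \<times> real \<Rightarrow> real" where
  "dalembertian D2u z = fst (D2u z (1, 0)) - snd (D2u z (0, 1))"

lemma dalembertian_comp:
  "dalembertian (\<lambda>z h. a z *\<^sub>R D2u z h + (b z * (Du z \<bullet> h)) *\<^sub>R Du z) z
     = a z * dalembertian D2u z + b z * ((fst (Du z))\<^sup>2 - (snd (Du z))\<^sup>2)"
  by (simp add: dalembertian_def inner_prod_def power2_eq_square algebra_simps)

lemma light_cone_iff: "(t, x) \<in> light_cone T x0 \<longleftrightarrow> 0 \<le> t \<and> t < T \<and> \<bar>x - x0\<bar> \<le> T - t"
  by (simp add: light_cone_def)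

lemma light_cone_subset_closure_interior:
  assumes "T > 0"
  shows "light_cone T x0 \<subseteq> closure (interior (light_cone T x0))"
proof -
  have "light_cone T x0 = {z. (-1, 0) \<bullet> z \<le> 0} \<inter> {z. (1, 0) \<bullet> z < T} \<inter> {z. (1, 1) \<bullet> z \<le> T + x0} \<inter> {z. (1, -1) \<bullet> z \<le> T - x0}"
    by (auto simp: light_cone_def)
  then have "convex (light_cone T x0)"
    by (simp add: convex_Int convex_halfspace_le convex_halfspace_lt)
  moreover let ?O = "{z. (-1, 0) \<bullet> z < 0} \<inter> {z. (1, 0) \<bullet> z < T} \<inter> {z. (1, 1) \<bullet> z < T + x0} \<inter> {z. (1, -1) \<bullet> z < T - x0}"
  have "?O \<subseteq> interior (light_cone T x0)"
    by (rule interior_maximal) (auto simp: light_cone_def intro!: open_Int open_halfspace_lt)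
  moreover have "(T / 2, x0) \<in> ?O" using assms by auto
  ultimately show ?thesis
    using convex_closure_interior closure_subset by blast
qed

lemma linear_real_prod:
  fixes L :: "real \<times> real \<Rightarrow> 'b::real_vector"
  assumes "linear L"
  shows "L (a, b) = a *\<^sub>R L (1, 0) + b *\<^sub>R L (0, 1)"
  using linear_add[OF assms, of "a *\<^sub>R (1, 0)" "b *\<^sub>R (0, 1)"]
    linear_cmul[OF assms, of a "(1, 0)"] linear_cmul[OF assms, of b "(0, 1)"] by simp

lemma is_solution_iff:
  "is_solution T x0 u u0 u1 \<longleftrightarrow>
     (\<exists>Du D2u. C2_on (light_cone T x0) (\<lambda>(t, x). u t x) Du D2u \<and>
        (\<forall>z\<in>light_cone T x0. dalembertian D2u z = (fst (Du z))\<^sup>2 - (snd (Du z))\<^sup>2) \<and>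
        (AE x in lborel. x \<in> ball x0 T \<longrightarrow> u 0 x = u0 x \<and> fst (Du (0, x)) = u1 x))"
  (is "_ \<longleftrightarrow> (\<exists>Du D2u. C2_on ?S ?u Du D2u \<and> ?eq Du D2u \<and> ?data Du)")
proof
  assume "is_solution T x0 u u0 u1"
  then obtain Du D2u where cont: "continuous_on ?S (\<lambda>z. D2u z (1, 0))" "continuous_on ?S (\<lambda>z. D2u z (0, 1))"
    and deriv: "\<And>z. z \<in> ?S \<Longrightarrow> (?u has_derivative (\<lambda>h. Du z \<bullet> h)) (at z within ?S)"
      "\<And>z. z \<in> ?S \<Longrightarrow> (Du has_derivative D2u z) (at z within ?S)"
    and eq: "?eq Du D2u" and data: "?data Du"
    unfolding is_solution_def dalembertian_def by blast
  have "continuous_on ?S (\<lambda>z. D2u z h)" for h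
  proof (rule continuous_on_eq)
    show "continuous_on ?S (\<lambda>z. fst h *\<^sub>R D2u z (1, 0) + snd h *\<^sub>R D2u z (0, 1))"
      by (intro continuous_intros cont)
    show "fst h *\<^sub>R D2u z (1, 0) + snd h *\<^sub>R D2u z (0, 1) = D2u z h" if "z \<in> ?S" for z
      using linear_real_prod[OF has_derivative_linear[OF deriv(2)[OF that]], of "fst h" "snd h"] by simp
  qed
  then have "C2_on ?S ?u Du D2u"
    using deriv by (auto simp: C2_on_def)
  then show "\<exists>Du D2u. C2_on ?S ?u Du D2u \<and> ?eq Du D2u \<and> ?data Du"
    using eq data by blast
next
  assume "\<exists>Du D2u. C2_on ?S ?u Du D2u \<and> ?eq Du D2u \<and> ?data Du"
  then obtain Du D2u where u: "C2_on ?S ?u Du D2u" and "?eq Du D2u" "?data Du" by blast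
  then show "is_solution T x0 u u0 u1"
    unfolding is_solution_def dalembertian_def
    using C2_on_continuous(2)[OF u] C2_onD[OF u] by blast
qed

lemma null_derivative_transport:
  assumes w: "C2_on (light_cone T x0) W DW D2W" and wave: "\<And>z. z \<in> light_cone T x0 \<Longrightarrow> dalembertian D2W z = 0"
    and tx: "(t, x) \<in> light_cone T x0" and \<sigma>: "\<sigma> \<in> {1, -1}"
  shows "DW (t, x) \<bullet> (1, - \<sigma>) = DW (0, x - \<sigma> * t) \<bullet> (1, - \<sigma>)"
proof -
  let ?S = "light_cone T x0"
  define \<gamma> :: "real \<Rightarrow> real \<times> real" where "\<gamma> s = (0, x - \<sigma> * t) + s *\<^sub>R (1, \<sigma>)" for s
  have \<gamma>: "\<gamma> s \<in> ?S" if "s \<in> {0..t}" for s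
    using that tx \<sigma> by (auto simp: \<gamma>_def light_cone_iff)
  have "((\<lambda>s. DW (\<gamma> s) \<bullet> (1, - \<sigma>)) has_vector_derivative 0) (at s within {0..t})" if s: "s \<in> {0..t}" for s
  proof -
    note D2 = C2_onD(2)[OF w \<gamma>[OF s]]
    have "((\<lambda>s. DW (\<gamma> s)) has_vector_derivative D2W (\<gamma> s) (1, \<sigma>)) (at s within {0..t})"
      using has_derivative_along_line[OF D2[unfolded \<gamma>_def]] \<gamma> unfolding \<gamma>_def by blast
    then have "((\<lambda>s. DW (\<gamma> s) \<bullet> (1, - \<sigma>)) has_vector_derivative D2W (\<gamma> s) (1, \<sigma>) \<bullet> (1, - \<sigma>)) (at s within {0..t})"
      by (rule bounded_linear.has_vector_derivative[OF bounded_linear_inner_left])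
    moreover have "D2W (\<gamma> s) (1, \<sigma>) \<bullet> (1, - \<sigma>) = 0"
    proof -
      have "T > 0" using tx by (auto simp: light_cone_iff)
      then have "D2W (\<gamma> s) (1, 0) \<bullet> (0, 1) = D2W (\<gamma> s) (0, 1) \<bullet> (1, 0)"
        by (rule C2_on_second_derivative_symmetric[OF w light_cone_subset_closure_interior \<gamma>[OF s]])
      moreover have "D2W (\<gamma> s) (1, \<sigma>) = D2W (\<gamma> s) (1, 0) + \<sigma> *\<^sub>R D2W (\<gamma> s) (0, 1)"
        using linear_real_prod[OF has_derivative_linear[OF D2], of 1 \<sigma>] by simp
      ultimately show ?thesis
        using wave[OF \<gamma>[OF s]] \<sigma> by (auto simp: dalembertian_def inner_prod_def)
    qed
    ultimately show ?thesis by simp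
  qed
  then have "DW (\<gamma> t) \<bullet> (1, - \<sigma>) = DW (\<gamma> 0) \<bullet> (1, - \<sigma>)"
    using has_vector_derivative_zero_constant[of "{0..t}" "\<lambda>s. DW (\<gamma> s) \<bullet> (1, - \<sigma>)"] tx
    by (metis atLeastAtMost_iff convex_real_interval(5) light_cone_iff order_refl)
  then show ?thesis by (simp add: \<gamma>_def)
qed

lemma linear_wave_eq_0:
  assumes w: "C2_on (light_cone T x0) W DW D2W" and wave: "\<And>z. z \<in> light_cone T x0 \<Longrightarrow> dalembertian D2W z = 0"
    and data: "\<And>x. x \<in> {x0 - T..x0 + T} \<Longrightarrow> W (0, x) = 0" "\<And>x. x \<in> {x0 - T..x0 + T} \<Longrightarrow> DW (0, x) = 0"
    and tx: "(t, x) \<in> light_cone T x0"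
  shows "W (t, x) = 0"
proof -
  have cone: "(s, x) \<in> light_cone T x0" if "s \<in> {0..t}" for s
    using that tx by (auto simp: light_cone_iff)
  have "((\<lambda>s. W (s, x)) has_vector_derivative 0) (at s within {0..t})" if s: "s \<in> {0..t}" for s
  proof -
    have "DW (s, x) \<bullet> (1, - \<sigma>) = 0" if \<sigma>: "\<sigma> \<in> {1, -1}" for \<sigma>
    proof -
      have "x - \<sigma> * s \<in> {x0 - T..x0 + T}"
        using \<sigma> cone[OF s] by (auto simp: light_cone_iff abs_le_iff)
      then show ?thesis
        using null_derivative_transport[OF w wave cone[OF s] \<sigma>] data(2) by simp
    qed
    from this[of 1] this[of "-1"] have "DW (s, x) \<bullet> (1, 0) = 0"
      by (cases "DW (s, x)") simp
    moreover have "((\<lambda>\<sigma>. W ((0, x) + \<sigma> *\<^sub>R (1, 0))) has_vector_derivative DW (s, x) \<bullet> (1, 0)) (at s within {0..t})"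
      by (rule has_derivative_along_line[of W "\<lambda>h. DW (s, x) \<bullet> h" "(0, x)" s "(1, 0)" "light_cone T x0"])
        (use C2_onD(1)[OF w cone[OF s]] cone in simp_all)
    ultimately show ?thesis by simp
  qed
  then have "W (t, x) = W (0, x)"
    using has_vector_derivative_zero_constant[of "{0..t}" "\<lambda>s. W (s, x)"] tx
    by (metis atLeastAtMost_iff convex_real_interval(5) light_cone_iff order_refl)
  moreover have "x \<in> {x0 - T..x0 + T}"
    using tx by (auto simp: light_cone_iff abs_le_iff)
  ultimately show ?thesis using data(1) by simp
qed

lemma continuous_AE_eq_0:
  fixes f :: "real \<Rightarrow> real"
  assumes f: "continuous_on {a..b} f" and zero: "AE x in lborel. x \<in> {a<..<b} \<longrightarrow> f x = 0"
    and ab: "a < b" and x: "x \<in> {a..b}"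
  shows "f x = 0"
proof -
  define U where "U = {x \<in> {a<..<b}. f x \<noteq> 0}"
  have "open U"
  proof -
    have "U = {a<..<b} - {x \<in> {a<..<b}. f x = 0}" by (auto simp: U_def)
    moreover have "openin (top_of_set {a<..<b}) ({a<..<b} - {x \<in> {a<..<b}. f x = 0})"
      using continuous_closedin_preimage_constant[OF continuous_on_subset[OF f greaterThanLessThan_subseteq_atLeastAtMost_iff[THEN iffD2]], of a b 0]
      by (intro openin_diff) auto
    ultimately show ?thesis by (simp add: openin_open_eq)
  qed
  moreover have "negligible U"
  proof -
    obtain N where N: "N \<in> null_sets lborel" "U \<subseteq> N"
      using zero by (auto simp: eventually_ae_filter U_def)
    then show ?thesis
      using negligible_subset null_sets_completionI by (metis negligible_iff_null_sets)
  qed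
  ultimately have "U = {}" using open_not_negligible by blast
  moreover have "closure {a<..<b} = {a..b}" using ab by simp
  ultimately show ?thesis
    using continuous_constant_on_closure[of "{a<..<b}" f 0 x] f x by (auto simp: U_def)
qed

lemma C2_on_light_cone_space_derivative_eq_0:
  assumes w: "C2_on (light_cone T x0) W DW D2W" and T: "T > 0"
    and zero: "\<And>x. x \<in> {x0 - T..x0 + T} \<Longrightarrow> W (0, x) = 0" and x: "x \<in> {x0 - T..x0 + T}"
  shows "snd (DW (0, x)) = 0"
proof -
  have cone: "(0, y) \<in> light_cone T x0" if "y \<in> {x0 - T..x0 + T}" for y
    using that T by (auto simp: light_cone_iff)
  have "((\<lambda>y. W ((0, 0) + y *\<^sub>R (0, 1))) has_vector_derivative DW (0, x) \<bullet> (0, 1)) (at x within {x0 - T..x0 + T})"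
    by (rule has_derivative_along_line[of W "\<lambda>h. DW (0, x) \<bullet> h" "(0, 0)" x "(0, 1)" "light_cone T x0"])
      (use C2_onD(1)[OF w cone[OF x]] cone in simp_all)
  then have "((\<lambda>_. 0) has_vector_derivative DW (0, x) \<bullet> (0, 1)) (at x within {x0 - T..x0 + T})"
    by (rule has_vector_derivative_transform[OF x, rotated]) (use zero in simp)
  moreover have "at x within {x0 - T..x0 + T} \<noteq> bot"
    using islimpt_Icc[of "x0 - T" "x0 + T" x] x T by (simp add: trivial_limit_within)
  ultimately have "DW (0, x) \<bullet> (0, 1) = 0"
    by (intro vector_derivative_unique_within[of _ _ "\<lambda>_. 0"]) auto
  then show ?thesis by (simp add: inner_prod_def)
qed

lemma is_solution_exp_minus:
  assumes "is_solution T x0 u u0 u1"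
  obtains DW D2W where "C2_on (light_cone T x0) (\<lambda>(t, x). exp (- u t x)) DW D2W"
    "\<forall>z\<in>light_cone T x0. dalembertian D2W z = 0"
    "AE x in lborel. x \<in> ball x0 T \<longrightarrow> exp (- u 0 x) = exp (- u0 x) \<and> fst (DW (0, x)) = - exp (- u0 x) * u1 x"
proof -
  let ?S = "light_cone T x0" and ?u = "\<lambda>(t, x). u t x"
  obtain Du D2u where u: "C2_on ?S ?u Du D2u"
    and eq: "\<And>z. z \<in> ?S \<Longrightarrow> dalembertian D2u z = (fst (Du z))\<^sup>2 - (snd (Du z))\<^sup>2"
    and data: "AE x in lborel. x \<in> ball x0 T \<longrightarrow> u 0 x = u0 x \<and> fst (Du (0, x)) = u1 x"
    using assms unfolding is_solution_iff by blast
  let ?DW = "\<lambda>z. - exp (- ?u z) *\<^sub>R Du z"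
  let ?D2W = "\<lambda>z h. - exp (- ?u z) *\<^sub>R D2u z h + (exp (- ?u z) * (Du z \<bullet> h)) *\<^sub>R Du z"
  have "C2_on ?S (\<lambda>z. exp (- ?u z)) ?DW ?D2W"
    by (rule C2_on_comp[OF u, of UNIV]) (auto intro!: derivative_eq_intros continuous_intros)
  moreover have "(\<lambda>z. exp (- ?u z)) = (\<lambda>(t, x). exp (- u t x))" by auto
  ultimately show thesis
  proof (intro that[of ?DW ?D2W])
    show "\<forall>z\<in>?S. dalembertian ?D2W z = 0"
      unfolding dalembertian_comp using eq by simp
    show "AE x in lborel. x \<in> ball x0 T \<longrightarrow> exp (- u 0 x) = exp (- u0 x) \<and> fst (?DW (0, x)) = - exp (- u0 x) * u1 x"
      using data by eventually_elim simp
  qed simp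
qed

lemma is_solution_minus_ln:
  assumes w: "C2_on (light_cone T x0) W DW D2W" and pos: "\<And>z. z \<in> light_cone T x0 \<Longrightarrow> 0 < W z"
    and wave: "\<And>z. z \<in> light_cone T x0 \<Longrightarrow> dalembertian D2W z = 0"
    and data: "AE x in lborel. x \<in> ball x0 T \<longrightarrow> - ln (W (0, x)) = u0 x \<and> - (fst (DW (0, x)) / W (0, x)) = u1 x"
  shows "is_solution T x0 (\<lambda>t x. - ln (W (t, x))) u0 u1"
proof -
  let ?Du = "\<lambda>z. - inverse (W z) *\<^sub>R DW z"
  let ?D2u = "\<lambda>z h. - inverse (W z) *\<^sub>R D2W z h + ((inverse (W z))\<^sup>2 * (DW z \<bullet> h)) *\<^sub>R DW z"
  have "C2_on (light_cone T x0) (\<lambda>z. - ln (W z)) ?Du ?D2u"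
    by (rule C2_on_comp[OF w, of "{0<..}"])
      (auto intro!: pos derivative_eq_intros continuous_intros simp: divide_inverse power2_eq_square)
  moreover have "(\<lambda>z. - ln (W z)) = (\<lambda>(t, x). - ln (W (t, x)))" by auto
  moreover have "dalembertian ?D2u z = (fst (?Du z))\<^sup>2 - (snd (?Du z))\<^sup>2" if "z \<in> light_cone T x0" for z
    unfolding dalembertian_comp using wave[OF that] by (simp add: power_mult_distrib right_diff_distrib)
  moreover have "AE x in lborel. x \<in> ball x0 T \<longrightarrow> - ln (W (0, x)) = u0 x \<and> fst (?Du (0, x)) = u1 x"
    using data by eventually_elim (simp add: divide_inverse mult.commute)
  ultimately show ?thesis
    unfolding is_solution_iff by (intro exI[of _ ?Du] exI[of _ ?D2u]) simp
qed

lemma is_solution_unique: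
  assumes u: "is_solution T x0 u u0 u1" and v: "is_solution T x0 v u0 u1"
  shows "\<forall>(t, x)\<in>light_cone T x0. v t x = u t x"
proof clarify
  fix t x assume tx: "(t, x) \<in> light_cone T x0"
  let ?S = "light_cone T x0" and ?I = "{x0 - T..x0 + T}"
  have T: "T > 0" using tx by (auto simp: light_cone_iff)
  obtain DU D2U where U: "C2_on ?S (\<lambda>(t, x). exp (- u t x)) DU D2U" "\<forall>z\<in>?S. dalembertian D2U z = 0"
      "AE x in lborel. x \<in> ball x0 T \<longrightarrow> exp (- u 0 x) = exp (- u0 x) \<and> fst (DU (0, x)) = - exp (- u0 x) * u1 x"
    by (rule is_solution_exp_minus[OF u])
  obtain DV D2V where V: "C2_on ?S (\<lambda>(t, x). exp (- v t x)) DV D2V" "\<forall>z\<in>?S. dalembertian D2V z = 0"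
      "AE x in lborel. x \<in> ball x0 T \<longrightarrow> exp (- v 0 x) = exp (- u0 x) \<and> fst (DV (0, x)) = - exp (- u0 x) * u1 x"
    by (rule is_solution_exp_minus[OF v])
  define W where "W z = (case z of (t, x) \<Rightarrow> exp (- u t x)) - (case z of (t, x) \<Rightarrow> exp (- v t x))" for z
  define DW where "DW z = DU z - DV z" for z
  have w: "C2_on ?S W DW (\<lambda>z h. D2U z h - D2V z h)"
    unfolding W_def[abs_def] DW_def[abs_def] by (rule C2_on_diff[OF U(1) V(1)])
  have ball: "ball x0 T = {x0 - T<..<x0 + T}" by (simp add: ball_eq_greaterThanLessThan)
  have slice: "continuous_on ?I (\<lambda>x. (0, x))" "(\<lambda>x. (0, x)) ` ?I \<subseteq> ?S"
    using T by (auto simp: light_cone_iff intro!: continuous_intros)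
  have zero: "W (0, y) = 0" "fst (DW (0, y)) = 0" if y: "y \<in> ?I" for y
  proof -
    have "AE x in lborel. x \<in> {x0 - T<..<x0 + T} \<longrightarrow> W (0, x) = 0" "AE x in lborel. x \<in> {x0 - T<..<x0 + T} \<longrightarrow> fst (DW (0, x)) = 0"
      using U(3) V(3) unfolding ball by (eventually_elim, simp add: W_def DW_def)+
    moreover have "continuous_on ?I (\<lambda>x. W (0, x))" "continuous_on ?I (\<lambda>x. fst (DW (0, x)))"
      using C2_on_continuous[OF w] slice by (auto intro!: continuous_on_fst intro: continuous_on_compose2)
    ultimately show "W (0, y) = 0" "fst (DW (0, y)) = 0"
      using continuous_AE_eq_0[where a = "x0 - T" and b = "x0 + T"] y T by fastforce+
  qed
  then have "DW (0, y) = 0" if "y \<in> ?I" for y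
    using C2_on_light_cone_space_derivative_eq_0[OF w T zero(1) that] that by (simp add: prod_eq_iff)
  moreover have "dalembertian (\<lambda>z h. D2U z h - D2V z h) z = 0" if "z \<in> ?S" for z
    using U(2) V(2) that by (simp add: dalembertian_def)
  ultimately have "W (t, x) = 0"
    using linear_wave_eq_0[OF w _ zero(1) _ tx] by blast
  then show "v t x = u t x" by (simp add: W_def)
qed

subsection \<open>D'Alembert's formula\<close>

definition dalembert :: "(real \<Rightarrow> real) \<Rightarrow> (real \<Rightarrow> real) \<Rightarrow> real \<times> real \<Rightarrow> real" where
  "dalembert F G z = F (snd z + fst z) + G (snd z - fst z)"

lemma dalembert_has_derivative:
  assumes F: "(F has_real_derivative F') (at (snd z + fst z))" and G: "(G has_real_derivative G') (at (snd z - fst z))"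
  shows "(dalembert F G has_derivative (\<lambda>h. F' * (snd h + fst h) + G' * (snd h - fst h))) (at z within S)"
proof -
  have "((\<lambda>z. F (snd z + fst z)) has_derivative (\<lambda>h. F' * (snd h + fst h))) (at z within S)"
    by (rule has_derivative_compose[where g = F and f = "\<lambda>z. snd z + fst z", OF _ F[unfolded has_field_derivative_def]])
      (auto intro!: derivative_eq_intros)
  moreover have "((\<lambda>z. G (snd z - fst z)) has_derivative (\<lambda>h. G' * (snd h - fst h))) (at z within S)"
    by (rule has_derivative_compose[where g = G and f = "\<lambda>z. snd z - fst z", OF _ G[unfolded has_field_derivative_def]])
      (auto intro!: derivative_eq_intros)
  ultimately show ?thesis
    unfolding dalembert_def[abs_def] by (rule has_derivative_add)
qed

lemma C2_on_dalembert:
  fixes F F' F'' G G' G'' :: "real \<Rightarrow> real"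
  assumes B: "\<And>z. z \<in> S \<Longrightarrow> snd z + fst z \<in> B" "\<And>z. z \<in> S \<Longrightarrow> snd z - fst z \<in> B"
    and F: "\<And>y. y \<in> B \<Longrightarrow> (F has_real_derivative F' y) (at y)" "\<And>y. y \<in> B \<Longrightarrow> (F' has_real_derivative F'' y) (at y)"
      "continuous_on B F''"
    and G: "\<And>y. y \<in> B \<Longrightarrow> (G has_real_derivative G' y) (at y)" "\<And>y. y \<in> B \<Longrightarrow> (G' has_real_derivative G'' y) (at y)"
      "continuous_on B G''"
  obtains D2W where "C2_on S (dalembert F G) (\<lambda>z. (dalembert F' (\<lambda>y. - G' y) z, dalembert F' G' z)) D2W"
    "\<forall>z. dalembertian D2W z = 0"
proof -
  define D where "D A C z h = A (snd z + fst z) * (snd h + fst h) + C (snd z - fst z) * (snd h - fst h)"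
    for A C :: "real \<Rightarrow> real" and z h :: "real \<times> real"
  have chain: "(dalembert A C has_derivative D A' C' z) (at z within S)"
    if "z \<in> S" "\<And>y. y \<in> B \<Longrightarrow> (A has_real_derivative A' y) (at y)" "\<And>y. y \<in> B \<Longrightarrow> (C has_real_derivative C' y) (at y)"
    for A A' C C' z
    using dalembert_has_derivative[OF that(2)[OF B(1)[OF that(1)]] that(3)[OF B(2)[OF that(1)]]] by (simp add: D_def[abs_def])
  have cont: "continuous_on S (\<lambda>z. D A C z h)" if "continuous_on B A" "continuous_on B C" for A C h
    unfolding D_def
    by (intro continuous_intros continuous_on_compose2[OF that(1)] continuous_on_compose2[OF that(2)]) (use B in auto)
  have neg: "((\<lambda>y. - G' y) has_real_derivative - G'' y) (at y)" if "y \<in> B" for y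
    by (rule DERIV_minus[OF G(2)[OF that]])
  let ?D2W = "\<lambda>z h. (D F'' (\<lambda>y. - G'' y) z h, D F'' G'' z h)"
  show thesis
  proof (rule that)
    show "C2_on S (dalembert F G) (\<lambda>z. (dalembert F' (\<lambda>y. - G' y) z, dalembert F' G' z)) ?D2W"
      unfolding C2_on_def
    proof (intro conjI ballI allI)
      fix z assume z: "z \<in> S"
      have "D F' G' z = (\<lambda>h. (dalembert F' (\<lambda>y. - G' y) z, dalembert F' G' z) \<bullet> h)"
        by (auto simp: D_def dalembert_def inner_prod_def algebra_simps)
      then show "(dalembert F G has_derivative (\<lambda>h. (dalembert F' (\<lambda>y. - G' y) z, dalembert F' G' z) \<bullet> h)) (at z within S)"
        using chain[OF z F(1) G(1)] by simp
      show "((\<lambda>z. (dalembert F' (\<lambda>y. - G' y) z, dalembert F' G' z)) has_derivative ?D2W z) (at z within S)"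
        by (intro has_derivative_Pair chain[OF z F(2) neg] chain[OF z F(2) G(2)])
    qed (intro continuous_on_Pair cont F(3) G(3) continuous_on_minus)
    show "\<forall>z. dalembertian ?D2W z = 0"
      by (simp add: dalembertian_def D_def)
  qed
qed

lemma dalembert_lower_bound:
  fixes F G F' G' :: "real \<Rightarrow> real"
  assumes B: "convex B" "x0 + T \<in> B" "x0 - T \<in> B"
    and F: "\<And>y. y \<in> B \<Longrightarrow> (F has_real_derivative F' y) (at y)" "\<And>y. y \<in> B \<Longrightarrow> F' y \<le> - \<mu>"
    and G: "\<And>y. y \<in> B \<Longrightarrow> (G has_real_derivative G' y) (at y)" "\<And>y. y \<in> B \<Longrightarrow> \<mu> \<le> G' y"
    and vertex: "dalembert F G (T, x0) = 0" and tx: "(t, x) \<in> light_cone T x0"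
  shows "2 * \<mu> * (T - t) \<le> dalembert F G (t, x)"
proof -
  have T: "0 \<le> t" "t < T" "\<bar>x - x0\<bar> \<le> T - t" using tx by (auto simp: light_cone_iff)
  then have "x + t \<in> closed_segment (x0 - T) (x0 + T)" "x - t \<in> closed_segment (x0 - T) (x0 + T)"
    by (auto simp: closed_segment_eq_real_ivl abs_le_iff)
  then have in_B: "x + t \<in> B" "x - t \<in> B"
    using closed_segment_subset[OF B(3,2,1)] by auto
  obtain \<xi> where \<xi>: "\<xi> \<in> closed_segment (x0 + T) (x + t)" "F (x + t) - F (x0 + T) = F' \<xi> * ((x + t) - (x0 + T))"
    using MVT_closed_segment[of "x0 + T" "x + t" F F'] F(1) closed_segment_subset[OF B(2) in_B(1) B(1)] by blast
  obtain \<eta> where \<eta>: "\<eta> \<in> closed_segment (x0 - T) (x - t)" "G (x - t) - G (x0 - T) = G' \<eta> * ((x - t) - (x0 - T))"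
    using MVT_closed_segment[of "x0 - T" "x - t" G G'] G(1) closed_segment_subset[OF B(3) in_B(2) B(1)] by blast
  have "(- \<mu>) * ((x + t) - (x0 + T)) \<le> F' \<xi> * ((x + t) - (x0 + T))"
    using F(2)[of \<xi>] \<xi>(1) closed_segment_subset[OF B(2) in_B(1) B(1)] T by (intro mult_right_mono_neg) auto
  moreover have "\<mu> * ((x - t) - (x0 - T)) \<le> G' \<eta> * ((x - t) - (x0 - T))"
    using G(2)[of \<eta>] \<eta>(1) closed_segment_subset[OF B(3) in_B(2) B(1)] T by (intro mult_right_mono) auto
  moreover have "(- \<mu>) * ((x + t) - (x0 + T)) + \<mu> * ((x - t) - (x0 - T)) = 2 * \<mu> * (T - t)"
    by (simp add: algebra_simps)
  ultimately show ?thesis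
    using \<xi>(2) \<eta>(2) vertex by (simp add: dalembert_def)
qed

subsection \<open>The explicit solutions\<close>

definition vertex_wave :: "real \<Rightarrow> real \<Rightarrow> real \<Rightarrow> real \<Rightarrow> real \<times> real \<Rightarrow> real" where
  "vertex_wave p q T x0 = dalembert (\<lambda>y. p * (y - (x0 + T))) (\<lambda>y. q * (y - (x0 - T)))"

lemma vertex_wave_eq: "vertex_wave p q T x0 (t, x) = (q - p) * (T - t) + (p + q) * (x - x0)"
  by (simp add: vertex_wave_def dalembert_def algebra_simps)

lemma ubl_eq_minus_ln_vertex_wave:
  assumes pq: "p < 0" "0 < q" and T: "0 < T" "t < T" and pos: "0 < vertex_wave p q T x0 (t, x)"
  shows "ubl (- p / q) (- ln (T * (q - p))) T x0 t x = - ln (vertex_wave p q T x0 (t, x))"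
proof -
  let ?w = "vertex_wave p q T x0 (t, x)" and ?y = "(x - x0) / (T - t)"
  have "(1 + z / r) + (- p / q) * (1 - z / r) = ((q - p) * r + (p + q) * z) / (q * r)" if "r > 0" for z r
    using pq that by (simp add: field_simps)
  from this[of "T - t" "x - x0"] T have "(1 + ?y) + (- p / q) * (1 - ?y) = ?w / (q * (T - t))"
    by (simp add: vertex_wave_eq)
  moreover have "1 + - p / q = (q - p) / q" "1 - t / T = (T - t) / T"
    using pq T by (simp_all add: field_simps)
  ultimately show ?thesis
    using pq T pos by (simp add: ubl_def Let_def ln_div ln_mult)
qed

lemma dt_eqI:
  assumes d: "((\<lambda>s. u s x) has_real_derivative D) (at t within {0..})" and t: "0 \<le> t"
  shows "dt u t x = D"
proof -
  have "{t<..} \<subseteq> {0..}" using t by auto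
  then have "at t within {0..} \<noteq> bot"
    using trivial_limit_at_right_real[of t] at_le[of "{t<..}" "{0..}" t] by (metis bot_unique)
  then show ?thesis
    unfolding dt_def using d by (simp add: vector_derivative_within has_real_derivative_iff_has_vector_derivative)
qed

lemma dt_minus_ln:
  assumes u: "\<forall>\<^sub>F s in nhds t. u s x = - ln (w s)" and w: "(w has_real_derivative w') (at t)" "0 < w t" and t: "0 \<le> t"
  shows "dt u t x = - (w' / w t)"
proof (rule dt_eqI)
  have "((\<lambda>s. - ln (w s)) has_real_derivative - (w' / w t)) (at t)"
    using w by (auto intro!: derivative_eq_intros)
  then have "((\<lambda>s. u s x) has_real_derivative - (w' / w t)) (at t)"
    using u by (subst DERIV_cong_ev[OF refl _ refl])
  then show "((\<lambda>s. u s x) has_real_derivative - (w' / w t)) (at t within {0..})"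
    by (rule has_field_derivative_at_within)
qed (rule t)

lemma dt_ubl_eq:
  assumes pq: "p < 0" "0 < q" and T: "0 < T" "0 \<le> t" "t < T" and pos: "0 < vertex_wave p q T x0 (t, x)"
  shows "dt (ubl (- p / q) (- ln (T * (q - p))) T x0) t x = - ((p - q) / vertex_wave p q T x0 (t, x))"
proof (rule dt_minus_ln[where w = "\<lambda>s. vertex_wave p q T x0 (s, x)"])
  have "continuous_on UNIV (\<lambda>s. vertex_wave p q T x0 (s, x))"
    unfolding vertex_wave_eq by (intro continuous_intros)
  then have "open {s. s < T \<and> 0 < vertex_wave p q T x0 (s, x)}"
    by (intro open_Collect_conj open_Collect_less continuous_intros)
  then have "\<forall>\<^sub>F s in nhds t. s \<in> {s. s < T \<and> 0 < vertex_wave p q T x0 (s, x)}"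
    by (rule eventually_nhds_in_open) (use T pos in simp)
  then show "\<forall>\<^sub>F s in nhds t. ubl (- p / q) (- ln (T * (q - p))) T x0 s x = - ln (vertex_wave p q T x0 (s, x))"
    by eventually_elim (use ubl_eq_minus_ln_vertex_wave[OF pq T(1)] in simp)
  show "((\<lambda>s. vertex_wave p q T x0 (s, x)) has_real_derivative p - q) (at t)"
    unfolding vertex_wave_eq by (auto intro!: derivative_eq_intros)
qed (use pos T in auto)

lemma ubl_parameters_from_slopes:
  fixes \<beta> T \<kappa> :: real
  assumes "\<beta> > 0" "T > 0"
  obtains p q where "p < 0" "0 < q" "\<beta> = - p / q" "\<kappa> = - ln (T * (q - p))"
proof
  define q where "q = exp (- \<kappa>) / (T * (1 + \<beta>))"
  show "0 < q" "- \<beta> * q < 0" "\<beta> = - (- \<beta> * q) / q"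
    using assms by (auto simp: q_def)
  have "T * (q - - \<beta> * q) = (T * (1 + \<beta>)) * q"
    by (simp add: algebra_simps)
  also have "\<dots> = exp (- \<kappa>)"
    using assms by (simp add: q_def)
  finally show "\<kappa> = - ln (T * (q - - \<beta> * q))" by simp
qed

subsection \<open>First order Taylor remainders\<close>

lemma taylor_remainder_le:
  fixes F F' F'' :: "real \<Rightarrow> real"
  assumes B: "convex B" "p \<in> B" "y \<in> B"
    and F: "\<And>y. y \<in> B \<Longrightarrow> (F has_real_derivative F' y) (at y)"
    and F': "\<And>y. y \<in> B \<Longrightarrow> (F' has_real_derivative F'' y) (at y)" and M: "\<And>y. y \<in> B \<Longrightarrow> \<bar>F'' y\<bar> \<le> M"
  shows "\<bar>F y - F p - F' p * (y - p)\<bar> \<le> M * (y - p)\<^sup>2"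
proof -
  have seg: "z \<in> B" "\<bar>z - p\<bar> \<le> \<bar>y - p\<bar>" if "z \<in> closed_segment p y" for z
    using that closed_segment_subset[OF B(2,3,1)] segment_bound1[OF that] by (auto simp: norm_minus_commute)
  have "norm ((F y - F' p * y) - (F p - F' p * p)) \<le> (M * \<bar>y - p\<bar>) * norm (y - p)"
  proof (rule field_differentiable_bound[where S = "closed_segment p y" and f = "\<lambda>z. F z - F' p * z" and f' = "\<lambda>z. F' z - F' p"])
    show "((\<lambda>z. F z - F' p * z) has_real_derivative F' z - F' p) (at z within closed_segment p y)"
      if "z \<in> closed_segment p y" for z
      by (rule has_field_derivative_at_within, rule DERIV_diff[OF F[OF seg(1)[OF that]]])
        (auto intro!: derivative_eq_intros)
    show "norm (F' z - F' p) \<le> M * \<bar>y - p\<bar>" if z: "z \<in> closed_segment p y" for z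
    proof -
      have "norm (F' z - F' p) \<le> M * norm (z - p)"
        by (rule field_differentiable_bound[OF B(1) has_field_derivative_at_within[OF F'] _ seg(1)[OF z] B(2)])
          (use M in auto)
      also have "\<dots> \<le> M * \<bar>y - p\<bar>"
        using seg(2)[OF z] M[OF B(2)] by (intro mult_left_mono) auto
      finally show ?thesis .
    qed
  qed auto
  then show ?thesis
    by (simp add: power2_eq_square algebra_simps)
qed

lemma sobolev_bigo_increment:
  fixes \<pi> :: "'j \<Rightarrow> 'i"
  assumes F: "\<And>i. i \<in> I \<Longrightarrow> primitive_on (ball x0 R) (F i) (F' i)"
    and F': "sobolev_bigo I (\<lambda>_. x0) (\<lambda>_. R) (Suc n) F' (\<lambda>_. 1)"
    and \<pi>: "\<And>j. j \<in> J \<Longrightarrow> \<pi> j \<in> I" and s: "\<And>j. j \<in> J \<Longrightarrow> 0 < s j" "\<And>j. j \<in> J \<Longrightarrow> s j \<le> R"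
    and p: "\<And>j. j \<in> J \<Longrightarrow> p j \<in> ball x0 R"
    and \<tau>: "\<And>j x. j \<in> J \<Longrightarrow> x \<in> ball x0 (s j) \<Longrightarrow> x + \<tau> j \<in> ball x0 R"
      "\<And>j x. j \<in> J \<Longrightarrow> x \<in> ball x0 (s j) \<Longrightarrow> \<bar>x + \<tau> j - p j\<bar> \<le> 2 * s j"
  shows "sobolev_bigo J (\<lambda>_. x0) s (Suc (Suc n)) (\<lambda>j x. F (\<pi> j) (x + \<tau> j) - F (\<pi> j) (p j)) s"
proof (rule sobolev_bigo_SucI)
  obtain C where "C > 0" and C: "\<forall>i\<in>I. \<forall>y\<in>ball x0 R. \<bar>F' i y\<bar> \<le> C"
    using sobolev_bigo_sup[OF F'] unfolding sup_bigo_iff by auto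
  have dF: "(F i has_real_derivative F' i y) (at y)" if "i \<in> I" "y \<in> ball x0 R" for i y
    using sobolev_bigo_has_real_derivative[OF F' F that] .
  show "sup_bigo J (\<lambda>_. x0) s (\<lambda>j x. F (\<pi> j) (x + \<tau> j) - F (\<pi> j) (p j)) s"
  proof (rule sup_bigoI)
    fix j x assume j: "j \<in> J" and x: "x \<in> ball x0 (s j)"
    have "norm (F (\<pi> j) (x + \<tau> j) - F (\<pi> j) (p j)) \<le> C * norm (x + \<tau> j - p j)"
      by (rule field_differentiable_bound[OF convex_ball has_field_derivative_at_within[OF dF[OF \<pi>[OF j]]] _ \<tau>(1)[OF j x] p[OF j]])
        (use C \<pi>[OF j] in auto)
    also have "\<dots> \<le> C * (2 * s j)"
      using \<tau>(2)[OF j x] \<open>C > 0\<close> by simp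
    finally show "\<bar>F (\<pi> j) (x + \<tau> j) - F (\<pi> j) (p j)\<bar> \<le> (2 * C) * \<bar>s j\<bar>"
      using s(1)[OF j] by simp
  qed
  show "primitive_on (ball x0 (s j)) (\<lambda>x. F (\<pi> j) (x + \<tau> j) - F (\<pi> j) (p j)) (\<lambda>x. F' (\<pi> j) (x + \<tau> j))" if j: "j \<in> J" for j
  proof -
    have "primitive_on (ball x0 (s j)) (\<lambda>x. F (\<pi> j) (x + \<tau> j)) (\<lambda>x. F' (\<pi> j) (x + \<tau> j))"
      by (rule primitive_on_shift[OF F[OF \<pi>[OF j]] \<tau>(1)[OF j]])
    from primitive_on_add_const[OF this, of "- F (\<pi> j) (p j)"] show ?thesis by simp
  qed
  have "sobolev_bigo J (\<lambda>_. x0) s (Suc n) (\<lambda>j x. F' (\<pi> j) (x + \<tau> j)) (\<lambda>_. 1)"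
    by (rule sobolev_bigo_localize[OF \<pi> s \<tau>(1) F']) auto
  then show "sobolev_bigo J (\<lambda>_. x0) s (Suc n) (\<lambda>j x. F' (\<pi> j) (x + \<tau> j)) (\<lambda>j. s j / s j)"
    by (rule sobolev_bigo_trans) (use s in \<open>force intro: principal_bigoI[of _ _ 1]\<close>)
qed

lemma sobolev_bigo_taylor_remainder:
  fixes \<pi> :: "'j \<Rightarrow> 'i"
  assumes F: "\<And>i. i \<in> I \<Longrightarrow> primitive_on (ball x0 R) (F i) (F' i)"
    and F': "sobolev_bigo I (\<lambda>_. x0) (\<lambda>_. R) (Suc (Suc n)) F' (\<lambda>_. 1)"
    and \<pi>: "\<And>j. j \<in> J \<Longrightarrow> \<pi> j \<in> I" and s: "\<And>j. j \<in> J \<Longrightarrow> 0 < s j" "\<And>j. j \<in> J \<Longrightarrow> s j \<le> R"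
    and p: "\<And>j. j \<in> J \<Longrightarrow> p j \<in> ball x0 R"
    and \<tau>: "\<And>j x. j \<in> J \<Longrightarrow> x \<in> ball x0 (s j) \<Longrightarrow> x + \<tau> j \<in> ball x0 R"
      "\<And>j x. j \<in> J \<Longrightarrow> x \<in> ball x0 (s j) \<Longrightarrow> \<bar>x + \<tau> j - p j\<bar> \<le> 2 * s j"
  shows "sobolev_bigo J (\<lambda>_. x0) s (Suc (Suc n)) (\<lambda>j x. F' (\<pi> j) (x + \<tau> j) - F' (\<pi> j) (p j)) s" (is ?deriv)
    and "sobolev_bigo J (\<lambda>_. x0) s (Suc (Suc (Suc n)))
      (\<lambda>j x. F (\<pi> j) (x + \<tau> j) - F (\<pi> j) (p j) - F' (\<pi> j) (p j) * (x + \<tau> j - p j)) (\<lambda>j. (s j)\<^sup>2)"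
proof -
  obtain F'' where primitive_F': "\<And>i. i \<in> I \<Longrightarrow> primitive_on (ball x0 R) (F' i) (F'' i)"
    and F''_bigo_R: "sobolev_bigo I (\<lambda>_. x0) (\<lambda>_. R) (Suc n) F'' (\<lambda>_. 1 / R)"
    using sobolev_bigo_SucE[OF F'] by blast
  have F''_bigo: "sobolev_bigo I (\<lambda>_. x0) (\<lambda>_. R) (Suc n) F'' (\<lambda>_. 1)"
    by (rule sobolev_bigo_trans[OF F''_bigo_R]) (rule principal_bigoI[of _ _ "\<bar>1 / R\<bar>"], simp)
  show deriv: ?deriv
    by (rule sobolev_bigo_increment[OF primitive_F' F''_bigo \<pi> s p \<tau>])
  obtain M where "M > 0" and M: "\<forall>i\<in>I. \<forall>y\<in>ball x0 R. \<bar>F'' i y\<bar> \<le> M"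
    using sobolev_bigo_sup[OF F''_bigo] unfolding sup_bigo_iff by auto
  show "sobolev_bigo J (\<lambda>_. x0) s (Suc (Suc (Suc n)))
      (\<lambda>j x. F (\<pi> j) (x + \<tau> j) - F (\<pi> j) (p j) - F' (\<pi> j) (p j) * (x + \<tau> j - p j)) (\<lambda>j. (s j)\<^sup>2)"
  proof (rule sobolev_bigo_SucI)
    show "sup_bigo J (\<lambda>_. x0) s
        (\<lambda>j x. F (\<pi> j) (x + \<tau> j) - F (\<pi> j) (p j) - F' (\<pi> j) (p j) * (x + \<tau> j - p j)) (\<lambda>j. (s j)\<^sup>2)"
    proof (rule sup_bigoI)
      fix j x assume j: "j \<in> J" and x: "x \<in> ball x0 (s j)"
      have "\<bar>F (\<pi> j) (x + \<tau> j) - F (\<pi> j) (p j) - F' (\<pi> j) (p j) * (x + \<tau> j - p j)\<bar> \<le> M * (x + \<tau> j - p j)\<^sup>2"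
        using sobolev_bigo_has_real_derivative[OF F' F \<pi>[OF j]]
          sobolev_bigo_has_real_derivative[OF F''_bigo primitive_F' \<pi>[OF j]] M \<pi>[OF j]
        by (intro taylor_remainder_le[OF convex_ball p[OF j] \<tau>(1)[OF j x]]) auto
      also have "\<dots> \<le> M * (2 * s j)\<^sup>2"
        using power_mono[OF \<tau>(2)[OF j x], of 2] \<open>M > 0\<close> by simp
      finally show "\<bar>F (\<pi> j) (x + \<tau> j) - F (\<pi> j) (p j) - F' (\<pi> j) (p j) * (x + \<tau> j - p j)\<bar> \<le> (4 * M) * \<bar>(s j)\<^sup>2\<bar>"
        by (simp add: power_mult_distrib)
    qed
    show "primitive_on (ball x0 (s j)) (\<lambda>x. F (\<pi> j) (x + \<tau> j) - F (\<pi> j) (p j) - F' (\<pi> j) (p j) * (x + \<tau> j - p j))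
        (\<lambda>x. F' (\<pi> j) (x + \<tau> j) - F' (\<pi> j) (p j))" if j: "j \<in> J" for j
    proof -
      have "primitive_on (ball x0 (s j)) (\<lambda>x. F (\<pi> j) (x + \<tau> j)) (\<lambda>x. F' (\<pi> j) (x + \<tau> j))"
        by (rule primitive_on_shift[OF F[OF \<pi>[OF j]] \<tau>(1)[OF j]])
      moreover have "primitive_on (ball x0 (s j)) (\<lambda>x. - F (\<pi> j) (p j) - F' (\<pi> j) (p j) * (x + \<tau> j - p j)) (\<lambda>x. - F' (\<pi> j) (p j))"
        by (rule primitive_on_FTC) (auto intro!: derivative_eq_intros)
      ultimately show ?thesis
        by (rule primitive_on_cong[OF primitive_on_add]) auto
    qed
    show "sobolev_bigo J (\<lambda>_. x0) s (Suc (Suc n)) (\<lambda>j x. F' (\<pi> j) (x + \<tau> j) - F' (\<pi> j) (p j)) (\<lambda>j. (s j)\<^sup>2 / s j)"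
      by (rule sobolev_bigo_trans[OF deriv]) (auto intro!: principal_bigoI[of _ _ 1] simp: power2_eq_square)
  qed
qed

subsection \<open>Families of null profiles meeting at a vertex\<close>

locale blowup_family =
  fixes I :: "'i set" and x0 R \<mu> :: real and n :: nat and T :: "'i \<Rightarrow> real" and F F' G G' :: "'i \<Rightarrow> real \<Rightarrow> real"
  assumes \<mu>_pos: "0 < \<mu>" and T_pos: "\<And>i. i \<in> I \<Longrightarrow> 0 < T i" and T_less: "\<And>i. i \<in> I \<Longrightarrow> T i < R"
    and primitive_F: "\<And>i. i \<in> I \<Longrightarrow> primitive_on (ball x0 R) (F i) (F' i)"
    and primitive_G: "\<And>i. i \<in> I \<Longrightarrow> primitive_on (ball x0 R) (G i) (G' i)"
    and sobolev_F': "sobolev_bigo I (\<lambda>_. x0) (\<lambda>_. R) (Suc (Suc n)) F' (\<lambda>_. 1)"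
    and sobolev_G': "sobolev_bigo I (\<lambda>_. x0) (\<lambda>_. R) (Suc (Suc n)) G' (\<lambda>_. 1)"
    and F'_le: "\<And>i y. i \<in> I \<Longrightarrow> y \<in> ball x0 R \<Longrightarrow> F' i y \<le> - \<mu>"
    and G'_ge: "\<And>i y. i \<in> I \<Longrightarrow> y \<in> ball x0 R \<Longrightarrow> \<mu> \<le> G' i y"
    and vertex: "\<And>i. i \<in> I \<Longrightarrow> dalembert (F i) (G i) (T i, x0) = 0"
begin

definition slope_F :: "'i \<Rightarrow> real" where "slope_F i = F' i (x0 + T i)"

definition slope_G :: "'i \<Rightarrow> real" where "slope_G i = G' i (x0 - T i)"

definition slices :: "('i \<times> real) set" where "slices = (SIGMA i:I. {0..<T i})"

definition radius :: "'i \<times> real \<Rightarrow> real" where "radius j = T (fst j) - snd j"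

definition wave :: "'i \<times> real \<Rightarrow> real \<Rightarrow> real" where
  "wave j x = dalembert (F (fst j)) (G (fst j)) (snd j, x)"

definition wave_dt :: "'i \<times> real \<Rightarrow> real \<Rightarrow> real" where
  "wave_dt j x = dalembert (F' (fst j)) (\<lambda>y. - G' (fst j) y) (snd j, x)"

definition model :: "'i \<times> real \<Rightarrow> real \<Rightarrow> real" where
  "model j x = vertex_wave (slope_F (fst j)) (slope_G (fst j)) (T (fst j)) x0 (snd j, x)"

lemma vertex_endpoints_in_ball:
  assumes "i \<in> I"
  shows "x0 + T i \<in> ball x0 R" "x0 - T i \<in> ball x0 R"
  using T_pos[OF assms] T_less[OF assms] by (auto simp: dist_real_def)

lemma slope_F_le: "i \<in> I \<Longrightarrow> slope_F i \<le> - \<mu>"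
  unfolding slope_F_def by (intro F'_le vertex_endpoints_in_ball)

lemma slope_G_ge: "i \<in> I \<Longrightarrow> \<mu> \<le> slope_G i"
  unfolding slope_G_def by (intro G'_ge vertex_endpoints_in_ball)

lemma slope_bigo: "slope_F \<in> O[principal I](\<lambda>_. 1)" "slope_G \<in> O[principal I](\<lambda>_. 1)"
proof -
  obtain C where "\<forall>i\<in>I. \<forall>y\<in>ball x0 R. \<bar>F' i y\<bar> \<le> C * \<bar>1\<bar>"
    using sobolev_bigo_sup[OF sobolev_F'] unfolding sup_bigo_iff by blast
  then show "slope_F \<in> O[principal I](\<lambda>_. 1)"
    unfolding slope_F_def[abs_def] using vertex_endpoints_in_ball by (intro principal_bigoI[of _ _ C]) blast
  obtain C where "\<forall>i\<in>I. \<forall>y\<in>ball x0 R. \<bar>G' i y\<bar> \<le> C * \<bar>1\<bar>"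
    using sobolev_bigo_sup[OF sobolev_G'] unfolding sup_bigo_iff by blast
  then show "slope_G \<in> O[principal I](\<lambda>_. 1)"
    unfolding slope_G_def[abs_def] using vertex_endpoints_in_ball by (intro principal_bigoI[of _ _ C]) blast
qed

lemma slicesD:
  assumes "j \<in> slices"
  shows "fst j \<in> I" "0 \<le> snd j" "snd j < T (fst j)" "0 < radius j" "radius j \<le> R"
  using assms T_less[of "fst j"] by (auto simp: slices_def radius_def)

lemma slice_ballD:
  assumes j: "j \<in> slices" and x: "x \<in> ball x0 (radius j)"
  shows "(snd j, x) \<in> light_cone (T (fst j)) x0" "x + snd j \<in> ball x0 R" "x + - snd j \<in> ball x0 R"
    "\<bar>x + snd j - (x0 + T (fst j))\<bar> \<le> 2 * radius j" "\<bar>x + - snd j - (x0 - T (fst j))\<bar> \<le> 2 * radius j"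
  using slicesD[OF j] x T_less[of "fst j"] by (auto simp: light_cone_iff radius_def dist_real_def)

lemma F_has_real_derivative: "i \<in> I \<Longrightarrow> y \<in> ball x0 R \<Longrightarrow> (F i has_real_derivative F' i y) (at y)"
  by (rule sobolev_bigo_has_real_derivative[OF sobolev_F' primitive_F])

lemma G_has_real_derivative: "i \<in> I \<Longrightarrow> y \<in> ball x0 R \<Longrightarrow> (G i has_real_derivative G' i y) (at y)"
  by (rule sobolev_bigo_has_real_derivative[OF sobolev_G' primitive_G])

lemma dalembert_ge:
  assumes i: "i \<in> I" and tx: "(t, x) \<in> light_cone (T i) x0"
  shows "2 * \<mu> * (T i - t) \<le> dalembert (F i) (G i) (t, x)"
  by (rule dalembert_lower_bound[OF convex_ball vertex_endpoints_in_ball[OF i] F_has_real_derivative[OF i] F'_le[OF i]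
        G_has_real_derivative[OF i] G'_ge[OF i] vertex[OF i] tx])

lemma vertex_wave_ge:
  assumes i: "i \<in> I" and tx: "(t, x) \<in> light_cone (T i) x0"
  shows "2 * \<mu> * (T i - t) \<le> vertex_wave (slope_F i) (slope_G i) (T i) x0 (t, x)"
  unfolding vertex_wave_def
proof (rule dalembert_lower_bound[where B = UNIV and F' = "\<lambda>_. slope_F i" and G' = "\<lambda>_. slope_G i"])
  show "dalembert (\<lambda>y. slope_F i * (y - (x0 + T i))) (\<lambda>y. slope_G i * (y - (x0 - T i))) (T i, x0) = 0"
    by (simp add: dalembert_def)
qed (use slope_F_le slope_G_ge i tx in \<open>auto intro!: derivative_eq_intros\<close>)

lemma dalembert_pos:
  assumes i: "i \<in> I" and tx: "(t, x) \<in> light_cone (T i) x0"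
  shows "0 < dalembert (F i) (G i) (t, x)" "0 < vertex_wave (slope_F i) (slope_G i) (T i) x0 (t, x)"
proof -
  have "0 < 2 * \<mu> * (T i - t)" using \<mu>_pos tx by (simp add: light_cone_iff)
  then show "0 < dalembert (F i) (G i) (t, x)" "0 < vertex_wave (slope_F i) (slope_G i) (T i) x0 (t, x)"
    using dalembert_ge[OF assms] vertex_wave_ge[OF assms] by auto
qed

lemma wave_model_pos:
  assumes "j \<in> slices" "x \<in> ball x0 (radius j)"
  shows "0 < wave j x" "0 < model j x"
  unfolding wave_def model_def using dalembert_pos[OF slicesD(1)[OF assms(1)] slice_ballD(1)[OF assms]] by auto

lemma sobolev_bigo_wave_minus_model:
  "sobolev_bigo slices (\<lambda>_. x0) radius (Suc (Suc (Suc n))) (\<lambda>j x. wave j x - model j x) (\<lambda>j. (radius j)\<^sup>2)"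
  "sobolev_bigo slices (\<lambda>_. x0) radius (Suc (Suc n)) (\<lambda>j x. wave_dt j x - (slope_F (fst j) - slope_G (fst j))) radius"
proof -
  note slices_in = slicesD(1,4,5) vertex_endpoints_in_ball(1)[OF slicesD(1)] slice_ballD(2,4)
  note slices_in' = slicesD(1,4,5) vertex_endpoints_in_ball(2)[OF slicesD(1)] slice_ballD(3,5)
  have F: "sobolev_bigo slices (\<lambda>_. x0) radius (Suc (Suc (Suc n)))
      (\<lambda>j x. F (fst j) (x + snd j) - F (fst j) (x0 + T (fst j)) - slope_F (fst j) * (x + snd j - (x0 + T (fst j))))
      (\<lambda>j. (radius j)\<^sup>2)"
    "sobolev_bigo slices (\<lambda>_. x0) radius (Suc (Suc n)) (\<lambda>j x. F' (fst j) (x + snd j) - slope_F (fst j)) radius"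
    using sobolev_bigo_taylor_remainder[OF primitive_F sobolev_F' slices_in] by (simp_all add: slope_F_def)
  have G: "sobolev_bigo slices (\<lambda>_. x0) radius (Suc (Suc (Suc n)))
      (\<lambda>j x. G (fst j) (x + - snd j) - G (fst j) (x0 - T (fst j)) - slope_G (fst j) * (x + - snd j - (x0 - T (fst j))))
      (\<lambda>j. (radius j)\<^sup>2)"
    "sobolev_bigo slices (\<lambda>_. x0) radius (Suc (Suc n)) (\<lambda>j x. G' (fst j) (x + - snd j) - slope_G (fst j)) radius"
    using sobolev_bigo_taylor_remainder[OF primitive_G sobolev_G' slices_in'] by (simp_all add: slope_G_def)
  show "sobolev_bigo slices (\<lambda>_. x0) radius (Suc (Suc (Suc n))) (\<lambda>j x. wave j x - model j x) (\<lambda>j. (radius j)\<^sup>2)"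
    by (rule sobolev_bigo_cong[OF sobolev_bigo_add[OF F(1) G(1)]])
      (use vertex[OF slicesD(1)] in \<open>simp add: wave_def model_def vertex_wave_def dalembert_def algebra_simps\<close>)
  show "sobolev_bigo slices (\<lambda>_. x0) radius (Suc (Suc n)) (\<lambda>j x. wave_dt j x - (slope_F (fst j) - slope_G (fst j))) radius"
    by (rule sobolev_bigo_cong[OF sobolev_bigo_diff[OF F(2) G(2)]]) (simp add: wave_dt_def dalembert_def)
qed

lemma slope_bigo_slices:
  "(\<lambda>j. slope_F (fst j)) \<in> O[principal slices](\<lambda>_. 1)" "(\<lambda>j. slope_G (fst j)) \<in> O[principal slices](\<lambda>_. 1)"
  using principal_bigo_reindex[where \<pi> = fst, OF slope_bigo(1), of slices]
    principal_bigo_reindex[where \<pi> = fst, OF slope_bigo(2), of slices] slicesD(1) by auto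

lemma sobolev_bigo_model: "sobolev_bigo slices (\<lambda>_. x0) radius m model radius"
proof -
  have "(\<lambda>j. (slope_G (fst j) - slope_F (fst j)) * radius j) \<in> O[principal slices](\<lambda>j. 1 * radius j)"
    "(\<lambda>j. (slope_F (fst j) + slope_G (fst j)) * radius j) \<in> O[principal slices](\<lambda>j. 1 * radius j)"
    by (intro landau_o.big.mult_right sum_in_bigo slope_bigo_slices)+
  then show ?thesis
    unfolding model_def[abs_def] vertex_wave_eq radius_def[symmetric] by (intro sobolev_bigo_affine slicesD(4)) auto
qed

lemma sobolev_bigo_wave: "sobolev_bigo slices (\<lambda>_. x0) radius (Suc (Suc (Suc n))) wave radius"
proof -
  have "(\<lambda>j. (radius j)\<^sup>2) \<in> O[principal slices](radius)"
    by (rule principal_bigoI[of _ _ R]) (use slicesD in \<open>force simp: power2_eq_square\<close>)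
  from sobolev_bigo_add[OF sobolev_bigo_trans[OF sobolev_bigo_wave_minus_model(1) this] sobolev_bigo_model]
  show ?thesis by simp
qed

lemma sobolev_bigo_inverse_wave_model:
  "sobolev_bigo slices (\<lambda>_. x0) radius (Suc (Suc (Suc n))) (\<lambda>j x. inverse (wave j x)) (\<lambda>j. inverse (radius j))"
  "sobolev_bigo slices (\<lambda>_. x0) radius (Suc m) (\<lambda>j x. inverse (model j x)) (\<lambda>j. inverse (radius j))"
proof -
  have lower: "2 * \<mu> * radius j \<le> wave j x" "2 * \<mu> * radius j \<le> model j x"
    if "j \<in> slices" "x \<in> ball x0 (radius j)" for j x
    unfolding wave_def model_def radius_def
    using dalembert_ge[OF slicesD(1)[OF that(1)] slice_ballD(1)[OF that]]
      vertex_wave_ge[OF slicesD(1)[OF that(1)] slice_ballD(1)[OF that]] .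
  have two_\<mu>_pos: "0 < 2 * \<mu>" using \<mu>_pos by simp
  show "sobolev_bigo slices (\<lambda>_. x0) radius (Suc (Suc (Suc n))) (\<lambda>j x. inverse (wave j x)) (\<lambda>j. inverse (radius j))"
    by (rule sobolev_bigo_inverse[OF slicesD(4) sobolev_bigo_wave slicesD(4) two_\<mu>_pos lower(1)])
  show "sobolev_bigo slices (\<lambda>_. x0) radius (Suc m) (\<lambda>j x. inverse (model j x)) (\<lambda>j. inverse (radius j))"
    by (rule sobolev_bigo_inverse[OF slicesD(4) sobolev_bigo_model slicesD(4) two_\<mu>_pos lower(2)])
qed

lemma model_le:
  obtains C where "C > 0" "\<forall>j\<in>slices. \<forall>x\<in>ball x0 (radius j). model j x \<le> C * radius j"
proof -
  obtain C where C: "C > 0" "\<forall>j\<in>slices. \<forall>x\<in>ball x0 (radius j). \<bar>model j x\<bar> \<le> C * \<bar>radius j\<bar>"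
    using sobolev_bigo_sup[OF sobolev_bigo_model[of "Suc 0"]] unfolding sup_bigo_iff by blast
  then show thesis using slicesD(4) by (intro that[OF C(1)]) fastforce
qed

lemma sobolev_bigo_ln_wave_minus_ln_model:
  "sobolev_bigo slices (\<lambda>_. x0) radius (Suc (Suc (Suc n))) (\<lambda>j x. ln (wave j x) - ln (model j x)) radius"
proof -
  define v where "v j x = (wave j x - model j x) * inverse (model j x)" for j x
  have "sobolev_bigo slices (\<lambda>_. x0) radius (Suc (Suc (Suc n))) v (\<lambda>j. (radius j)\<^sup>2 * inverse (radius j))"
    unfolding v_def[abs_def]
    by (rule sobolev_bigo_mult[OF slicesD(4) sobolev_bigo_wave_minus_model(1) sobolev_bigo_inverse_wave_model(2)])
  then have v: "sobolev_bigo slices (\<lambda>_. x0) radius (Suc (Suc (Suc n))) v radius"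
    by (rule sobolev_bigo_trans) (rule principal_bigoI[of _ _ 1], drule slicesD(4), simp add: power2_eq_square)
  have one_plus_v: "1 + v j x = wave j x / model j x" if "j \<in> slices" "x \<in> ball x0 (radius j)" for j x
    using wave_model_pos(2)[OF that] by (simp add: v_def divide_inverse[symmetric] diff_divide_distrib)
  obtain C where C: "C > 0" "\<forall>j\<in>slices. \<forall>x\<in>ball x0 (radius j). model j x \<le> C * radius j"
    by (rule model_le)
  have lower: "2 * \<mu> / C \<le> 1 + v j x" if jx: "j \<in> slices" "x \<in> ball x0 (radius j)" for j x
  proof -
    have "2 * \<mu> / C * model j x \<le> 2 * \<mu> / C * (C * radius j)"
      using C \<mu>_pos jx by (intro mult_left_mono) auto
    also have "\<dots> \<le> wave j x"
      using C(1) dalembert_ge[OF slicesD(1)[OF jx(1)] slice_ballD(1)[OF jx]] by (simp add: wave_def radius_def)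
    finally show ?thesis
      using wave_model_pos[OF jx] by (simp add: one_plus_v[OF jx] pos_le_divide_eq)
  qed
  have "radius \<in> O[principal slices](\<lambda>_. 1)"
    by (rule principal_bigoI[of _ _ R]) (use slicesD in force)
  from sobolev_bigo_ln_1_plus[OF slicesD(4) v this _ lower]
  have "sobolev_bigo slices (\<lambda>_. x0) radius (Suc (Suc (Suc n))) (\<lambda>j x. ln (1 + v j x)) radius"
    using \<mu>_pos C(1) by simp
  then show ?thesis
    by (rule sobolev_bigo_cong) (metis ln_divide_pos one_plus_v wave_model_pos)
qed

lemma sobolev_bigo_wave_dt_quotient_minus_model:
  "sobolev_bigo slices (\<lambda>_. x0) radius (Suc (Suc n))
     (\<lambda>j x. wave_dt j x / wave j x - (slope_F (fst j) - slope_G (fst j)) / model j x) (\<lambda>_. 1)"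
proof -
  define d where "d j = slope_F (fst j) - slope_G (fst j)" for j :: "'i \<times> real"
  have d_mult: "sobolev_bigo slices (\<lambda>_. x0) radius (Suc (Suc n)) (\<lambda>j x. d j * (wave j x - model j x)) (\<lambda>j. (radius j)\<^sup>2)"
  proof (rule sobolev_bigo_trans[OF sobolev_bigo_scale[OF sobolev_bigo_lower[OF slicesD(4) sobolev_bigo_wave_minus_model(1)]]])
    have "(\<lambda>j. d j * (radius j)\<^sup>2) \<in> O[principal slices](\<lambda>j. 1 * (radius j)\<^sup>2)"
      unfolding d_def by (intro landau_o.big.mult_right sum_in_bigo slope_bigo_slices)
    then show "(\<lambda>j. d j * (radius j)\<^sup>2) \<in> O[principal slices](\<lambda>j. (radius j)\<^sup>2)" by simp
  qed
  have "sobolev_bigo slices (\<lambda>_. x0) radius (Suc (Suc n)) (\<lambda>j x. (wave_dt j x - d j) * model j x) (\<lambda>j. (radius j)\<^sup>2)"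
    using sobolev_bigo_mult[OF slicesD(4) sobolev_bigo_wave_minus_model(2) sobolev_bigo_model]
    by (simp add: d_def power2_eq_square)
  from sobolev_bigo_mult[OF slicesD(4) sobolev_bigo_diff[OF this d_mult]
      sobolev_bigo_mult[OF slicesD(4) sobolev_bigo_lower[OF slicesD(4) sobolev_bigo_inverse_wave_model(1)] sobolev_bigo_inverse_wave_model(2)]]
  have "sobolev_bigo slices (\<lambda>_. x0) radius (Suc (Suc n))
      (\<lambda>j x. ((wave_dt j x - d j) * model j x - d j * (wave j x - model j x)) * (inverse (wave j x) * inverse (model j x)))
      (\<lambda>j. (radius j)\<^sup>2 * (inverse (radius j) * inverse (radius j)))" .
  then have "sobolev_bigo slices (\<lambda>_. x0) radius (Suc (Suc n))
      (\<lambda>j x. ((wave_dt j x - d j) * model j x - d j * (wave j x - model j x)) * (inverse (wave j x) * inverse (model j x)))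
      (\<lambda>_. 1)"
    by (rule sobolev_bigo_trans) (rule principal_bigoI[of _ _ 1], drule slicesD(4), simp add: power2_eq_square divide_inverse[symmetric] field_simps)
  then show ?thesis
  proof (rule sobolev_bigo_cong)
    fix j x assume jx: "j \<in> slices" "x \<in> ball x0 (radius j)"
    show "((wave_dt j x - d j) * model j x - d j * (wave j x - model j x)) * (inverse (wave j x) * inverse (model j x))
        = wave_dt j x / wave j x - (slope_F (fst j) - slope_G (fst j)) / model j x"
      unfolding d_def[symmetric] using wave_model_pos[OF jx] by (simp add: field_simps)
  qed
qed

definition \<beta> :: "'i \<Rightarrow> real" where "\<beta> i = - slope_F i / slope_G i"

definition \<kappa> :: "'i \<Rightarrow> real" where "\<kappa> i = - ln (T i * (slope_G i - slope_F i))"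

definition solution :: "'i \<Rightarrow> real \<Rightarrow> real \<Rightarrow> real" where
  "solution i t x = - ln (dalembert (F i) (G i) (t, x))"

lemma \<beta>_pos: "i \<in> I \<Longrightarrow> 0 < \<beta> i"
  using slope_F_le[of i] slope_G_ge[of i] \<mu>_pos by (simp add: \<beta>_def divide_neg_pos)

lemma sobolev_bigo_solution_minus_ubl:
  "sobolev_bigo slices (\<lambda>_. x0) radius (Suc (Suc (Suc n)))
     (\<lambda>(i, t) x. solution i t x - ubl (\<beta> i) (\<kappa> i) (T i) x0 t x) radius"
proof (rule sobolev_bigo_cong)
  show "sobolev_bigo slices (\<lambda>_. x0) radius (Suc (Suc (Suc n))) (\<lambda>j x. (- 1) * (ln (wave j x) - ln (model j x))) radius"
    by (rule sobolev_bigo_trans[OF sobolev_bigo_scale[OF sobolev_bigo_ln_wave_minus_ln_model]])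
      (auto intro: principal_bigoI[of _ _ 1])
next
  fix j x assume jx: "j \<in> slices" "x \<in> ball x0 (radius j)"
  have "ubl (\<beta> (fst j)) (\<kappa> (fst j)) (T (fst j)) x0 (snd j) x = - ln (model j x)"
    unfolding \<beta>_def \<kappa>_def model_def
    using slicesD[OF jx(1)] slope_F_le[OF slicesD(1)[OF jx(1)]] slope_G_ge[OF slicesD(1)[OF jx(1)]] \<mu>_pos T_pos
    by (intro ubl_eq_minus_ln_vertex_wave dalembert_pos(2)[OF slicesD(1)[OF jx(1)] slice_ballD(1)[OF jx]]) auto
  then show "- 1 * (ln (wave j x) - ln (model j x)) = (\<lambda>(i, t) x. solution i t x - ubl (\<beta> i) (\<kappa> i) (T i) x0 t x) j x"
    by (simp add: solution_def wave_def case_prod_beta)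
qed

lemma sobolev_bigo_dt_solution_minus_dt_ubl:
  "sobolev_bigo slices (\<lambda>_. x0) radius (Suc (Suc n))
     (\<lambda>(i, t) x. dt (solution i) t x - dt (ubl (\<beta> i) (\<kappa> i) (T i) x0) t x) (\<lambda>_. 1)"
proof (rule sobolev_bigo_cong)
  show "sobolev_bigo slices (\<lambda>_. x0) radius (Suc (Suc n))
      (\<lambda>j x. (- 1) * (wave_dt j x / wave j x - (slope_F (fst j) - slope_G (fst j)) / model j x)) (\<lambda>_. 1)"
    by (rule sobolev_bigo_trans[OF sobolev_bigo_scale[OF sobolev_bigo_wave_dt_quotient_minus_model]])
      (auto intro: principal_bigoI[of _ _ 1])
next
  fix j x assume jx: "j \<in> slices" "x \<in> ball x0 (radius j)"
  obtain i t where [simp]: "j = (i, t)" by (cases j)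
  have pos: "0 < dalembert (F i) (G i) (t, x)" "0 < vertex_wave (slope_F i) (slope_G i) (T i) x0 (t, x)"
    using dalembert_pos[OF slicesD(1)[OF jx(1)] slice_ballD(1)[OF jx]] by auto
  have "((\<lambda>s. dalembert (F i) (G i) (s, x)) has_real_derivative F' i (x + t) * 1 + G' i (x - t) * (- 1)) (at t)"
    unfolding dalembert_def fst_conv snd_conv
    by (intro DERIV_add DERIV_chain2[OF F_has_real_derivative] DERIV_chain2[OF G_has_real_derivative])
      (use slicesD(1)[OF jx(1)] slice_ballD[OF jx] in \<open>auto intro!: derivative_eq_intros\<close>)
  then have "dt (solution i) t x = - (wave_dt j x / wave j x)"
    using slicesD(2)[OF jx(1)] pos(1)
    by (subst dt_minus_ln[where w = "\<lambda>s. dalembert (F i) (G i) (s, x)" and w' = "wave_dt j x"])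
      (auto simp: solution_def wave_dt_def wave_def dalembert_def)
  moreover have "dt (ubl (\<beta> i) (\<kappa> i) (T i) x0) t x = - ((slope_F i - slope_G i) / model j x)"
    using dt_ubl_eq[OF _ _ T_pos _ _ pos(2)] slicesD[OF jx(1)] slope_F_le[of i] slope_G_ge[of i] \<mu>_pos
    by (simp add: \<beta>_def \<kappa>_def model_def)
  ultimately show "- 1 * (wave_dt j x / wave j x - (slope_F (fst j) - slope_G (fst j)) / model j x)
      = (\<lambda>(i, t) x. dt (solution i) t x - dt (ubl (\<beta> i) (\<kappa> i) (T i) x0) t x) j x"
    by simp
qed

lemma is_solution_solution:
  assumes i: "i \<in> I"
    and data: "AE x in lborel. x \<in> ball x0 (T i) \<longrightarrow>
      - ln (F i x + G i x) = u0 x \<and> - ((F' i x - G' i x) / (F i x + G i x)) = u1 x"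
  shows "is_solution (T i) x0 (solution i) u0 u1"
proof -
  obtain F'' where F'': "\<And>i. i \<in> I \<Longrightarrow> primitive_on (ball x0 R) (F' i) (F'' i)"
    "sobolev_bigo I (\<lambda>_. x0) (\<lambda>_. R) (Suc n) F'' (\<lambda>_. 1 / R)"
    using sobolev_bigo_SucE[OF sobolev_F'] by blast
  obtain G'' where G'': "\<And>i. i \<in> I \<Longrightarrow> primitive_on (ball x0 R) (G' i) (G'' i)"
    "sobolev_bigo I (\<lambda>_. x0) (\<lambda>_. R) (Suc n) G'' (\<lambda>_. 1 / R)"
    using sobolev_bigo_SucE[OF sobolev_G'] by blast
  have cone: "snd z + fst z \<in> ball x0 R" "snd z - fst z \<in> ball x0 R" if "z \<in> light_cone (T i) x0" for z
    using that T_less[OF i] by (cases z; auto simp: light_cone_iff dist_real_def)+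
  obtain D2W where D2W: "C2_on (light_cone (T i) x0) (dalembert (F i) (G i))
      (\<lambda>z. (dalembert (F' i) (\<lambda>y. - G' i y) z, dalembert (F' i) (G' i) z)) D2W" "\<forall>z. dalembertian D2W z = 0"
    by (rule C2_on_dalembert[OF cone F_has_real_derivative[OF i] sobolev_bigo_has_real_derivative[OF F''(2,1) i]
          sobolev_bigo_continuous[OF F''(2) i] G_has_real_derivative[OF i]
          sobolev_bigo_has_real_derivative[OF G''(2,1) i] sobolev_bigo_continuous[OF G''(2) i]]) blast
  show ?thesis
    unfolding solution_def[abs_def]
    by (rule is_solution_minus_ln[OF D2W(1)])
      (use dalembert_pos(1)[OF i] D2W(2) data in \<open>auto simp: dalembert_def\<close>)
qed

end

subsection \<open>Null profiles of perturbed data\<close>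

text \<open>If \<open>u = - ln a + h\<close> and \<open>u_t = - (p - q) / a + l\<close> at time \<open>0\<close>, where \<open>a\<close> has slope \<open>p + q\<close>, then the null
  profiles of \<open>w = exp (- u)\<close> satisfy \<open>F' = (w_x + w_t) / 2 = null_slope a h h' l p 1\<close> and
  \<open>G' = (w_x - w_t) / 2 = null_slope a h h' l q (- 1)\<close>.\<close>

definition null_slope ::
  "(real \<Rightarrow> real) \<Rightarrow> (real \<Rightarrow> real) \<Rightarrow> (real \<Rightarrow> real) \<Rightarrow> (real \<Rightarrow> real) \<Rightarrow> real \<Rightarrow> real \<Rightarrow> real \<Rightarrow> real" where
  "null_slope a h h' l c s x = exp (- h x) * (c - a x * (h' x + s * l x) / 2)"

lemma null_slope_diff:
  "null_slope a h h' l p 1 x - null_slope a h h' l q (- 1) x = exp (- h x) * (p - q - a x * l x)"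
  by (simp add: null_slope_def field_simps)

lemma null_profiles_exist:
  assumes a: "\<And>x. (a has_real_derivative p + q) (at x)" and h: "primitive_on B h h'" and B: "convex B" "x0 \<in> B"
    and cont: "continuous_on B (null_slope a h h' l p 1)"
  shows "\<exists>F G. primitive_on B F (null_slope a h h' l p 1) \<and> primitive_on B G (null_slope a h h' l q (- 1)) \<and>
    (\<forall>x. F x + G x = a x * exp (- h x))"
proof -
  have "set_integrable lborel {b..d} (null_slope a h h' l p 1)" if "{b..d} \<subseteq> B" for b d
    by (rule borel_integrable_atLeastAtMost') (rule continuous_on_subset[OF cont that])
  then obtain F where F: "primitive_on B F (null_slope a h h' l p 1)" "F x0 = 0"
    by (rule primitive_on_exists[OF B])
  have "primitive_on B a (\<lambda>_. p + q)"
    by (rule primitive_on_FTC[OF a]) simp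
  moreover have "primitive_on B (\<lambda>x. exp (- h x)) (\<lambda>x. - exp (- h x) * h' x)"
    by (rule primitive_on_comp[OF h convex_UNIV, where H = "\<lambda>y. exp (- y)"])
      (auto intro!: derivative_eq_intros continuous_intros)
  ultimately have "primitive_on B (\<lambda>x. a x * exp (- h x)) (\<lambda>x. (p + q) * exp (- h x) + a x * (- exp (- h x) * h' x))"
    by (rule primitive_on_mult)
  from primitive_on_add[OF this primitive_on_cmult[OF F(1), of "- 1"]]
  have "primitive_on B (\<lambda>x. a x * exp (- h x) - F x) (null_slope a h h' l q (- 1))"
    by (rule primitive_on_cong) (auto simp: null_slope_def field_simps)
  with F(1) show ?thesis by (intro exI conjI) auto
qed

lemma sobolev_bigo_null_slope:
  assumes r: "\<And>i. i \<in> I \<Longrightarrow> 0 < r i" and a: "sobolev_bigo I c r (Suc m) (\<lambda>_. a) (\<lambda>_. 1)"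
    and h: "sobolev_bigo I c r (Suc m) h \<rho>" and h': "sobolev_bigo I c r (Suc m) h' \<rho>"
    and l: "sobolev_bigo I c r (Suc m) l \<rho>" and \<rho>: "\<rho> \<in> O[principal I](\<lambda>_. 1)"
  shows "sobolev_bigo I c r (Suc m) (\<lambda>i x. null_slope a (h i) (h' i) (l i) b s x - b) \<rho>"
proof -
  have const_mult: "sobolev_bigo I c r (Suc m) (\<lambda>i x. d * v i x) \<rho>" if "sobolev_bigo I c r (Suc m) v \<rho>" for d v
    by (rule sobolev_bigo_trans[OF sobolev_bigo_scale[OF that]]) simp
  have "sobolev_bigo I c r (Suc m) (\<lambda>i x. - h i x) \<rho>"
    using const_mult[OF h, of "- 1"] by simp
  from sobolev_bigo_exp_minus_1[OF r this \<rho>]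
  have exp_minus_1_bigo: "sobolev_bigo I c r (Suc m) (\<lambda>i x. exp (- h i x) - 1) \<rho>" .
  have "sobolev_bigo I c r (Suc m) (\<lambda>i x. (exp (- h i x) - 1) + 1) (\<lambda>_. 1)"
    by (rule sobolev_bigo_add[OF sobolev_bigo_trans[OF exp_minus_1_bigo \<rho>] sobolev_bigo_const[OF r]])
  then have exp_bigo: "sobolev_bigo I c r (Suc m) (\<lambda>i x. exp (- h i x)) (\<lambda>_. 1)" by simp
  have "sobolev_bigo I c r (Suc m) (\<lambda>i x. exp (- h i x) * (a x * (h' i x + s * l i x))) (\<lambda>i. 1 * (1 * \<rho> i))"
    by (intro sobolev_bigo_mult r exp_bigo a sobolev_bigo_add h' const_mult l)
  then have "sobolev_bigo I c r (Suc m) (\<lambda>i x. b * (exp (- h i x) - 1) +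
      (- 1 / 2) * (exp (- h i x) * (a x * (h' i x + s * l i x)))) \<rho>"
    by (intro sobolev_bigo_add const_mult exp_minus_1_bigo) simp
  then show ?thesis
    by (rule sobolev_bigo_cong) (simp add: null_slope_def field_simps)
qed

lemma null_profiles_of_regular_data:
  assumes R: "0 < R" and \<epsilon>: "\<epsilon> \<in> O[principal I](\<lambda>_. 1)"
    and h: "sobolev_bigo I (\<lambda>_. x0) (\<lambda>_. R) (Suc (Suc m)) h \<epsilon>" and l: "sobolev_bigo I (\<lambda>_. x0) (\<lambda>_. R) (Suc m) l \<epsilon>"
  obtains F F' G G' where
    "\<forall>i\<in>I. primitive_on (ball x0 R) (F i) (F' i)" "\<forall>i\<in>I. primitive_on (ball x0 R) (G i) (G' i)"
    "sobolev_bigo I (\<lambda>_. x0) (\<lambda>_. R) (Suc m) (\<lambda>i x. F' i x - p) \<epsilon>"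
    "sobolev_bigo I (\<lambda>_. x0) (\<lambda>_. R) (Suc m) (\<lambda>i x. G' i x - q) \<epsilon>"
    "\<forall>i\<in>I. \<forall>x. F i x + G i x = vertex_wave p q T0 x0 (0, x) * exp (- h i x) \<and>
      F' i x - G' i x = exp (- h i x) * (p - q - vertex_wave p q T0 x0 (0, x) * l i x)"
proof -
  define a where "a x = vertex_wave p q T0 x0 (0, x)" for x
  obtain h' where h': "\<And>i. i \<in> I \<Longrightarrow> primitive_on (ball x0 R) (h i) (h' i)"
    "sobolev_bigo I (\<lambda>_. x0) (\<lambda>_. R) (Suc m) h' (\<lambda>i. \<epsilon> i / R)"
    using sobolev_bigo_SucE[OF h] by blast
  have h'_bigo: "sobolev_bigo I (\<lambda>_. x0) (\<lambda>_. R) (Suc m) h' \<epsilon>"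
    by (rule sobolev_bigo_trans[OF h'(2)]) (auto intro: principal_bigoI[of _ _ "\<bar>1 / R\<bar>"])
  have a_eq: "a = (\<lambda>x. (q - p) * T0 + (p + q) * (x - x0))"
    by (simp add: a_def vertex_wave_eq fun_eq_iff)
  have a_bigo: "sobolev_bigo I (\<lambda>_. x0) (\<lambda>_. R) (Suc m) (\<lambda>_. a) (\<lambda>_. 1)"
    unfolding a_eq using R
    by (intro sobolev_bigo_affine principal_bigoI[of _ _ "\<bar>(q - p) * T0\<bar>"] principal_bigoI[of _ _ "\<bar>(p + q) * R\<bar>"]) auto
  define F' where "F' i = null_slope a (h i) (h' i) (l i) p 1" for i
  define G' where "G' i = null_slope a (h i) (h' i) (l i) q (- 1)" for i
  have slope: "sobolev_bigo I (\<lambda>_. x0) (\<lambda>_. R) (Suc m) (\<lambda>i x. null_slope a (h i) (h' i) (l i) b s x - b) \<epsilon>" for b s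
    by (rule sobolev_bigo_null_slope[OF R a_bigo sobolev_bigo_lower[OF R h] h'_bigo l \<epsilon>])
  have "\<exists>F G. primitive_on (ball x0 R) F (F' i) \<and> primitive_on (ball x0 R) G (G' i) \<and> (\<forall>x. F x + G x = a x * exp (- h i x))"
    if i: "i \<in> I" for i
    unfolding F'_def G'_def
  proof (rule null_profiles_exist[OF _ h'(1)[OF i] convex_ball])
    show "(a has_real_derivative p + q) (at x)" for x
      unfolding a_eq by (auto intro!: derivative_eq_intros)
    show "x0 \<in> ball x0 R" using R by simp
    show "continuous_on (ball x0 R) (null_slope a (h i) (h' i) (l i) p 1)"
      using sobolev_bigo_continuous[OF sobolev_bigo_if_minus_const[OF R slope \<epsilon>] i] .
  qed
  then obtain F G where FG: "\<forall>i\<in>I. primitive_on (ball x0 R) (F i) (F' i)" "\<forall>i\<in>I. primitive_on (ball x0 R) (G i) (G' i)"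
    and sum: "\<forall>i\<in>I. \<forall>x. F i x + G i x = a x * exp (- h i x)"
    by metis
  show thesis
  proof (rule that[OF FG])
    show "sobolev_bigo I (\<lambda>_. x0) (\<lambda>_. R) (Suc m) (\<lambda>i x. F' i x - p) \<epsilon>"
      "sobolev_bigo I (\<lambda>_. x0) (\<lambda>_. R) (Suc m) (\<lambda>i x. G' i x - q) \<epsilon>"
      unfolding F'_def G'_def by (rule slope)+
    show "\<forall>i\<in>I. \<forall>x. F i x + G i x = vertex_wave p q T0 x0 (0, x) * exp (- h i x) \<and>
        F' i x - G' i x = exp (- h i x) * (p - q - vertex_wave p q T0 x0 (0, x) * l i x)"
      using sum null_slope_diff unfolding F'_def G'_def a_def[symmetric] by blast
  qed
qed

lemma null_profiles_of_small_data:
  assumes R: "0 < R" and \<epsilon>: "\<epsilon> \<in> O[principal I](\<lambda>_. 1)"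
    and small: "\<And>i. i \<in> I \<Longrightarrow> data_small (Suc m) (f i) (g i) (\<epsilon> i)"
  obtains F F' G G' where
    "\<forall>i\<in>I. primitive_on (ball x0 R) (F i) (F' i)" "\<forall>i\<in>I. primitive_on (ball x0 R) (G i) (G' i)"
    "sobolev_bigo I (\<lambda>_. x0) (\<lambda>_. R) (Suc m) (\<lambda>i x. F' i x - p) \<epsilon>"
    "sobolev_bigo I (\<lambda>_. x0) (\<lambda>_. R) (Suc m) (\<lambda>i x. G' i x - q) \<epsilon>"
    "(\<lambda>i. F i x0 + G i x0 - (q - p) * T0) \<in> O[principal I](\<epsilon>)"
    "\<forall>i\<in>I. AE x in lborel. F i x + G i x = vertex_wave p q T0 x0 (0, x) * exp (- f i x) \<and>
      F' i x - G' i x = exp (- f i x) * (p - q - vertex_wave p q T0 x0 (0, x) * g i x)"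
proof -
  obtain h l where h: "\<forall>i\<in>I. AE x in lborel. f i x = h i x" "sobolev_bigo I (\<lambda>_. x0) (\<lambda>_. R) (Suc (Suc m)) h \<epsilon>"
    and l: "\<forall>i\<in>I. AE x in lborel. g i x = l i x" "sobolev_bigo I (\<lambda>_. x0) (\<lambda>_. R) (Suc m) l \<epsilon>"
    by (rule data_small_sobolev_bigo[OF R small])
  obtain F F' G G' where FG: "\<forall>i\<in>I. primitive_on (ball x0 R) (F i) (F' i)" "\<forall>i\<in>I. primitive_on (ball x0 R) (G i) (G' i)"
      "sobolev_bigo I (\<lambda>_. x0) (\<lambda>_. R) (Suc m) (\<lambda>i x. F' i x - p) \<epsilon>"
      "sobolev_bigo I (\<lambda>_. x0) (\<lambda>_. R) (Suc m) (\<lambda>i x. G' i x - q) \<epsilon>"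
    and data: "\<forall>i\<in>I. \<forall>x. F i x + G i x = vertex_wave p q T0 x0 (0, x) * exp (- h i x) \<and>
      F' i x - G' i x = exp (- h i x) * (p - q - vertex_wave p q T0 x0 (0, x) * l i x)"
    by (rule null_profiles_of_regular_data[OF R \<epsilon> h(2) l(2)])
  show thesis
  proof (rule that[OF FG])
    have "sobolev_bigo I (\<lambda>_. x0) (\<lambda>_. R) (Suc (Suc m)) (\<lambda>i x. - h i x) \<epsilon>"
      using sobolev_bigo_trans[OF sobolev_bigo_scale[OF h(2), of "\<lambda>_. - 1"], of \<epsilon>] by simp
    from sobolev_bigo_sup[OF sobolev_bigo_exp_minus_1[OF R this \<epsilon>]]
    have "(\<lambda>i. exp (- h i x0) - 1) \<in> O[principal I](\<epsilon>)"
      unfolding sup_bigo_iff principal_bigo_iff using R by (meson centre_in_ball)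
    then have "(\<lambda>i. (q - p) * T0 * (exp (- h i x0) - 1)) \<in> O[principal I](\<epsilon>)"
      by (simp add: mult.assoc)
    moreover have "(\<lambda>i. F i x0 + G i x0 - (q - p) * T0) \<in> O[principal I](\<lambda>i. (q - p) * T0 * (exp (- h i x0) - 1))"
      by (rule principal_bigoI[of _ _ 1]) (use data in \<open>simp add: vertex_wave_eq right_diff_distrib\<close>)
    ultimately show "(\<lambda>i. F i x0 + G i x0 - (q - p) * T0) \<in> O[principal I](\<epsilon>)"
      using landau_o.big_trans by blast
    show "\<forall>i\<in>I. AE x in lborel. F i x + G i x = vertex_wave p q T0 x0 (0, x) * exp (- f i x) \<and>
        F' i x - G' i x = exp (- f i x) * (p - q - vertex_wave p q T0 x0 (0, x) * g i x)"
    proof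
      fix i assume i: "i \<in> I"
      show "AE x in lborel. F i x + G i x = vertex_wave p q T0 x0 (0, x) * exp (- f i x) \<and>
          F' i x - G' i x = exp (- f i x) * (p - q - vertex_wave p q T0 x0 (0, x) * g i x)"
        using h(1)[rule_format, OF i] l(1)[rule_format, OF i] by eventually_elim (use data i in simp)
    qed
  qed
qed

subsection \<open>Existence of the vertex\<close>

lemma dalembert_vertex_exists:
  fixes F F' G G' :: "real \<Rightarrow> real"
  assumes F: "\<And>y. y \<in> ball x0 R \<Longrightarrow> (F has_real_derivative F' y) (at y)" "\<And>y. y \<in> ball x0 R \<Longrightarrow> F' y \<le> - \<mu>"
    and G: "\<And>y. y \<in> ball x0 R \<Longrightarrow> (G has_real_derivative G' y) (at y)" "\<And>y. y \<in> ball x0 R \<Longrightarrow> \<mu> \<le> G' y"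
    and \<mu>: "0 < \<mu>" and d: "\<bar>dalembert F G (T0, x0)\<bar> \<le> 2 * \<mu> * d" "d < T0" "T0 + d < R"
  shows "\<exists>T. \<bar>T - T0\<bar> \<le> d \<and> dalembert F G (T, x0) = 0"
proof -
  define \<phi> where "\<phi> y = dalembert F G (y, x0)" for y
  have "0 \<le> 2 * \<mu> * d" using d(1) by linarith
  then have d0: "0 \<le> d" using \<mu> by (simp add: zero_le_mult_iff)
  have \<phi>: "(\<phi> has_real_derivative F' (x0 + y) * 1 + G' (x0 - y) * (- 1)) (at y)" if "y \<in> {T0 - d..T0 + d}" for y
    unfolding \<phi>_def dalembert_def fst_conv snd_conv
    by (intro DERIV_add DERIV_chain2[OF F(1)] DERIV_chain2[OF G(1)])
      (use that d in \<open>auto intro!: derivative_eq_intros simp: dist_real_def\<close>)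
  have decreasing: "\<phi> z - \<phi> y \<le> - 2 * \<mu> * (z - y)" if "T0 - d \<le> y" "y \<le> z" "z \<le> T0 + d" for y z
  proof -
    have "closed_segment y z \<subseteq> {T0 - d..T0 + d}"
      using that by (auto simp: closed_segment_eq_real_ivl)
    then obtain \<xi> where \<xi>: "\<xi> \<in> closed_segment y z" "\<xi> \<in> {T0 - d..T0 + d}"
      "\<phi> z - \<phi> y = (F' (x0 + \<xi>) * 1 + G' (x0 - \<xi>) * (- 1)) * (z - y)"
      using MVT_closed_segment[of y z \<phi>, OF \<phi>] by blast
    have "F' (x0 + \<xi>) \<le> - \<mu>" "\<mu> \<le> G' (x0 - \<xi>)"
      using \<xi>(2) d by (auto intro!: F(2) G(2) simp: dist_real_def)
    then show ?thesis
      unfolding \<xi>(3) using that by (intro mult_right_mono) auto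
  qed
  have "\<phi> (T0 + d) \<le> 0" "0 \<le> \<phi> (T0 - d)"
    using decreasing[of T0 "T0 + d"] decreasing[of "T0 - d" T0] d(1) d0 by (auto simp: \<phi>_def abs_le_iff)
  moreover have "\<forall>y. T0 - d \<le> y \<and> y \<le> T0 + d \<longrightarrow> isCont \<phi> y"
    using DERIV_isCont[OF \<phi>] by simp
  ultimately obtain T where "T0 - d \<le> T" "T \<le> T0 + d" "\<phi> T = 0"
    using IVT2[of \<phi> "T0 + d" 0 "T0 - d"] d0 by auto
  then show ?thesis
    by (intro exI[of _ T]) (auto simp: \<phi>_def abs_le_iff)
qed

lemma dalembert_center_le:
  fixes F F' G G' :: "real \<Rightarrow> real"
  assumes F: "\<And>y. y \<in> ball x0 R \<Longrightarrow> (F has_real_derivative F' y) (at y)" "\<And>y. y \<in> ball x0 R \<Longrightarrow> \<bar>F' y - p\<bar> \<le> e"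
    and G: "\<And>y. y \<in> ball x0 R \<Longrightarrow> (G has_real_derivative G' y) (at y)" "\<And>y. y \<in> ball x0 R \<Longrightarrow> \<bar>G' y - q\<bar> \<le> e'"
    and t: "0 \<le> t" "t < R"
  shows "\<bar>dalembert F G (t, x0) - (F x0 + G x0 - (q - p) * t)\<bar> \<le> (e + e') * t"
proof -
  have increment: "\<bar>H z - H x0 - s * (z - x0)\<bar> \<le> b * \<bar>z - x0\<bar>"
    if H: "\<And>y. y \<in> ball x0 R \<Longrightarrow> (H has_real_derivative H' y) (at y)" "\<And>y. y \<in> ball x0 R \<Longrightarrow> \<bar>H' y - s\<bar> \<le> b"
      and z: "z \<in> ball x0 R" for H H' :: "real \<Rightarrow> real" and s b z
  proof -
    have "norm ((H z - s * z) - (H x0 - s * x0)) \<le> b * norm (z - x0)"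
    proof (rule field_differentiable_bound[where S = "ball x0 R" and f = "\<lambda>y. H y - s * y" and f' = "\<lambda>y. H' y - s"])
      show "((\<lambda>y. H y - s * y) has_real_derivative H' y - s) (at y within ball x0 R)" if "y \<in> ball x0 R" for y
        by (rule has_field_derivative_at_within, rule DERIV_diff[OF H(1)[OF that]]) (auto intro!: derivative_eq_intros)
    qed (use H(2) z t in auto)
    then show ?thesis by (simp add: algebra_simps)
  qed
  have "\<bar>F (x0 + t) - F x0 - p * t\<bar> \<le> e * t" "\<bar>G (x0 - t) - G x0 - q * (- t)\<bar> \<le> e' * t"
    using increment[OF F, of "x0 + t"] increment[OF G, of "x0 - t"] t by (auto simp: dist_real_def)
  then show ?thesis
    unfolding dalembert_def by (simp add: algebra_simps abs_le_iff)
qed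

lemma dalembert_vertex_near:
  fixes F F' G G' :: "real \<Rightarrow> real"
  assumes F: "\<And>y. y \<in> ball x0 (2 * T0) \<Longrightarrow> (F has_real_derivative F' y) (at y)"
      "\<And>y. y \<in> ball x0 (2 * T0) \<Longrightarrow> \<bar>F' y - p\<bar> \<le> e"
    and G: "\<And>y. y \<in> ball x0 (2 * T0) \<Longrightarrow> (G has_real_derivative G' y) (at y)"
      "\<And>y. y \<in> ball x0 (2 * T0) \<Longrightarrow> \<bar>G' y - q\<bar> \<le> e'"
    and center: "\<bar>F x0 + G x0 - (q - p) * T0\<bar> \<le> e''"
    and \<mu>: "0 < \<mu>" "e \<le> \<mu>" "e' \<le> \<mu>" "2 * \<mu> \<le> - p" "2 * \<mu> \<le> q"
    and d: "(e + e') * T0 + e'' \<le> 2 * \<mu> * d" "d < T0" and T0: "0 < T0"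
  shows "\<exists>T. \<bar>T - T0\<bar> \<le> d \<and> dalembert F G (T, x0) = 0"
proof (rule dalembert_vertex_exists[OF F(1) _ G(1)])
  show "F' y \<le> - \<mu>" "\<mu> \<le> G' y" if "y \<in> ball x0 (2 * T0)" for y
    using F(2)[OF that] G(2)[OF that] \<mu> by (auto simp: abs_le_iff)
  have "\<bar>dalembert F G (T0, x0) - (F x0 + G x0 - (q - p) * T0)\<bar> \<le> (e + e') * T0"
    using T0 by (intro dalembert_center_le[OF F G]) auto
  then show "\<bar>dalembert F G (T0, x0)\<bar> \<le> 2 * \<mu> * d"
    using center d(1) by linarith
qed (use \<mu> d T0 in auto)

lemma dalembert_vertices_near:
  fixes \<epsilon> :: "'i \<Rightarrow> real"
  assumes pq: "p < 0" "0 < q" and T0: "0 < T0" and \<epsilon>: "\<And>i. i \<in> I \<Longrightarrow> 0 < \<epsilon> i"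
    and F: "\<And>i y. i \<in> I \<Longrightarrow> y \<in> ball x0 (2 * T0) \<Longrightarrow> (F i has_real_derivative F' i y) (at y)"
      "sup_bigo I (\<lambda>_. x0) (\<lambda>_. 2 * T0) (\<lambda>i x. F' i x - p) \<epsilon>"
    and G: "\<And>i y. i \<in> I \<Longrightarrow> y \<in> ball x0 (2 * T0) \<Longrightarrow> (G i has_real_derivative G' i y) (at y)"
      "sup_bigo I (\<lambda>_. x0) (\<lambda>_. 2 * T0) (\<lambda>i x. G' i x - q) \<epsilon>"
    and center: "(\<lambda>i. F i x0 + G i x0 - (q - p) * T0) \<in> O[principal I](\<epsilon>)"
  obtains \<epsilon>0 \<mu> K T where "0 < \<epsilon>0" "0 < \<mu>"
    "\<forall>i\<in>{i \<in> I. \<epsilon> i \<le> \<epsilon>0}. (\<forall>y\<in>ball x0 (2 * T0). F' i y \<le> - \<mu> \<and> \<mu> \<le> G' i y) \<and>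
      dalembert (F i) (G i) (T i, x0) = 0 \<and> \<bar>T i - T0\<bar> \<le> K * \<epsilon> i \<and> \<bar>T i - T0\<bar> \<le> T0 / 2"
proof -
  obtain A where A: "A > 0" "\<forall>i\<in>I. \<forall>x\<in>ball x0 (2 * T0). \<bar>F' i x - p\<bar> \<le> A * \<bar>\<epsilon> i\<bar>"
    using F(2) unfolding sup_bigo_iff by blast
  obtain B where B: "B > 0" "\<forall>i\<in>I. \<forall>x\<in>ball x0 (2 * T0). \<bar>G' i x - q\<bar> \<le> B * \<bar>\<epsilon> i\<bar>"
    using G(2) unfolding sup_bigo_iff by blast
  obtain C where C: "C > 0" "\<forall>i\<in>I. \<bar>F i x0 + G i x0 - (q - p) * T0\<bar> \<le> C * \<bar>\<epsilon> i\<bar>"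
    using center unfolding principal_bigo_iff by blast
  define \<mu> where "\<mu> = min (- p) q / 2"
  have \<mu>: "0 < \<mu>" "2 * \<mu> \<le> - p" "2 * \<mu> \<le> q" using pq by (auto simp: \<mu>_def)
  define K where "K = ((A + B) * T0 + C) / (2 * \<mu>)"
  have K: "0 < K" unfolding K_def using A(1) B(1) C(1) T0 \<mu>(1) by (intro divide_pos_pos add_pos_pos mult_pos_pos) auto
  define \<epsilon>0 where "\<epsilon>0 = Min {\<mu> / A, \<mu> / B, T0 / (2 * K)}"
  have \<epsilon>0: "0 < \<epsilon>0" using A(1) B(1) T0 \<mu>(1) K by (simp add: \<epsilon>0_def)
  have "\<exists>T. (\<forall>y\<in>ball x0 (2 * T0). F' i y \<le> - \<mu> \<and> \<mu> \<le> G' i y) \<and>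
      dalembert (F i) (G i) (T, x0) = 0 \<and> \<bar>T - T0\<bar> \<le> K * \<epsilon> i \<and> \<bar>T - T0\<bar> \<le> T0 / 2"
    if i: "i \<in> I" "\<epsilon> i \<le> \<epsilon>0" for i
  proof -
    have small: "A * \<epsilon> i \<le> \<mu>" "B * \<epsilon> i \<le> \<mu>" "K * \<epsilon> i \<le> T0 / 2"
      using i(2) A(1) B(1) K by (auto simp: \<epsilon>0_def field_simps)
    have near: "\<bar>F' i y - p\<bar> \<le> A * \<epsilon> i" "\<bar>G' i y - q\<bar> \<le> B * \<epsilon> i" if "y \<in> ball x0 (2 * T0)" for y
      using A(2) B(2) i(1) \<epsilon>[OF i(1)] that by auto
    have "(A * \<epsilon> i + B * \<epsilon> i) * T0 + C * \<epsilon> i \<le> 2 * \<mu> * (K * \<epsilon> i)"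
      using \<mu>(1) by (simp add: K_def field_simps)
    moreover have "\<bar>F i x0 + G i x0 - (q - p) * T0\<bar> \<le> C * \<epsilon> i"
      using C(2) i(1) \<epsilon>[OF i(1)] by auto
    ultimately have "\<exists>T. \<bar>T - T0\<bar> \<le> K * \<epsilon> i \<and> dalembert (F i) (G i) (T, x0) = 0"
      using small T0
      by (intro dalembert_vertex_near[OF F(1)[OF i(1)] near(1) G(1)[OF i(1)] near(2) _ \<mu>(1) _ _ \<mu>(2,3)]) auto
    moreover have "F' i y \<le> - \<mu> \<and> \<mu> \<le> G' i y" if "y \<in> ball x0 (2 * T0)" for y
      using near[OF that] small(1,2) \<mu> by (simp add: abs_le_iff)
    ultimately show ?thesis using small(3) order_trans by blast
  qed
  then show thesis using that[OF \<epsilon>0 \<mu>(1)] by (simp, metis)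
qed

lemma blowup_family_of_near_affine_profiles:
  assumes pq: "p < 0" "0 < q" and T0: "0 < T0" and \<epsilon>: "\<And>i. i \<in> I \<Longrightarrow> 0 < \<epsilon> i" "\<epsilon> \<in> O[principal I](\<lambda>_. 1)"
    and F: "\<And>i. i \<in> I \<Longrightarrow> primitive_on (ball x0 (2 * T0)) (F i) (F' i)"
      "sobolev_bigo I (\<lambda>_. x0) (\<lambda>_. 2 * T0) (Suc (Suc n)) (\<lambda>i x. F' i x - p) \<epsilon>"
    and G: "\<And>i. i \<in> I \<Longrightarrow> primitive_on (ball x0 (2 * T0)) (G i) (G' i)"
      "sobolev_bigo I (\<lambda>_. x0) (\<lambda>_. 2 * T0) (Suc (Suc n)) (\<lambda>i x. G' i x - q) \<epsilon>"
    and center: "(\<lambda>i. F i x0 + G i x0 - (q - p) * T0) \<in> O[principal I](\<epsilon>)"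
  shows "\<exists>\<epsilon>0>0. \<exists>\<mu> T. blowup_family {i \<in> I. \<epsilon> i \<le> \<epsilon>0} x0 (2 * T0) \<mu> n T F F' G G' \<and>
    (\<lambda>i. T i - T0) \<in> O[principal {i \<in> I. \<epsilon> i \<le> \<epsilon>0}](\<epsilon>) \<and> (\<forall>i\<in>{i \<in> I. \<epsilon> i \<le> \<epsilon>0}. T0 / 2 \<le> T i)"
proof -
  have R: "0 < 2 * T0" using T0 by simp
  note F'_bigo = sobolev_bigo_if_minus_const[OF R F(2) \<epsilon>(2)] and G'_bigo = sobolev_bigo_if_minus_const[OF R G(2) \<epsilon>(2)]
  obtain \<epsilon>0 \<mu> K T where \<epsilon>0: "0 < \<epsilon>0" and \<mu>: "0 < \<mu>"
    and T: "\<forall>i\<in>{i \<in> I. \<epsilon> i \<le> \<epsilon>0}. (\<forall>y\<in>ball x0 (2 * T0). F' i y \<le> - \<mu> \<and> \<mu> \<le> G' i y) \<and>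
      dalembert (F i) (G i) (T i, x0) = 0 \<and> \<bar>T i - T0\<bar> \<le> K * \<epsilon> i \<and> \<bar>T i - T0\<bar> \<le> T0 / 2"
    by (rule dalembert_vertices_near[OF pq T0 \<epsilon>(1) sobolev_bigo_has_real_derivative[OF F'_bigo F(1)] sobolev_bigo_sup[OF F(2)]
          sobolev_bigo_has_real_derivative[OF G'_bigo G(1)] sobolev_bigo_sup[OF G(2)] center])
  define I' where "I' = {i \<in> I. \<epsilon> i \<le> \<epsilon>0}"
  have I': "I' \<subseteq> I" by (auto simp: I'_def)
  have T_near: "\<bar>T i - T0\<bar> \<le> K * \<epsilon> i" "T0 / 2 \<le> T i" "T i \<le> 3 / 2 * T0" if "i \<in> I'" for i
  proof -
    have "\<bar>T i - T0\<bar> \<le> K * \<epsilon> i" "\<bar>T i - T0\<bar> \<le> T0 / 2"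
      using T that unfolding I'_def by blast+
    then show "\<bar>T i - T0\<bar> \<le> K * \<epsilon> i" "T0 / 2 \<le> T i" "T i \<le> 3 / 2 * T0"
      by linarith+
  qed
  have "blowup_family I' x0 (2 * T0) \<mu> n T F F' G G'"
  proof
    show "sobolev_bigo I' (\<lambda>_. x0) (\<lambda>_. 2 * T0) (Suc (Suc n)) F' (\<lambda>_. 1)"
      by (rule sobolev_bigo_subset[OF R F'_bigo I'])
    show "sobolev_bigo I' (\<lambda>_. x0) (\<lambda>_. 2 * T0) (Suc (Suc n)) G' (\<lambda>_. 1)"
      by (rule sobolev_bigo_subset[OF R G'_bigo I'])
    show "0 < T i" "T i < 2 * T0" if "i \<in> I'" for i
      using T_near(2,3)[OF that] T0 by auto
  qed (use T \<mu> F(1) G(1) I' in \<open>auto simp: I'_def\<close>)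
  moreover have "(\<lambda>i. T i - T0) \<in> O[principal I'](\<epsilon>)"
    by (rule principal_bigoI[of _ _ K]) (use T_near(1) \<epsilon>(1) I' in force)
  ultimately show ?thesis
    using \<epsilon>0 T_near(2) unfolding I'_def by blast
qed

subsection \<open>Closeness of the parameters\<close>

lemma principal_ln_minus_bigo:
  fixes a \<epsilon> :: "'i \<Rightarrow> real"
  assumes a: "\<And>i. i \<in> I \<Longrightarrow> c \<le> a i" and c: "0 < c" "0 < b" and diff: "(\<lambda>i. a i - b) \<in> O[principal I](\<epsilon>)"
  shows "(\<lambda>i. ln (a i) - ln b) \<in> O[principal I](\<epsilon>)"
proof (rule landau_o.big_trans[OF principal_bigoI diff])
  fix i assume i: "i \<in> I"
  have pos: "0 < a i" "0 < min b c" "min b c \<le> a i" using a[OF i] c by auto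
  have "ln (a i) - ln b \<le> (a i - b) / b" "ln b - ln (a i) \<le> (b - a i) / a i"
    using ln_diff_le pos(1) c(2) by auto
  moreover have "(a i - b) / b \<le> \<bar>a i - b\<bar> / min b c" "(b - a i) / a i \<le> \<bar>a i - b\<bar> / min b c"
    using pos c by (auto intro!: frac_le)
  ultimately show "\<bar>ln (a i) - ln b\<bar> \<le> 1 / min b c * \<bar>a i - b\<bar>"
    by (simp add: abs_le_iff)
qed

context blowup_family
begin

lemma slope_minus_bigo:
  assumes "sup_bigo I (\<lambda>_. x0) (\<lambda>_. R) (\<lambda>i x. F' i x - p) \<epsilon>" "sup_bigo I (\<lambda>_. x0) (\<lambda>_. R) (\<lambda>i x. G' i x - q) \<epsilon>"
  shows "(\<lambda>i. slope_F i - p) \<in> O[principal I](\<epsilon>)" "(\<lambda>i. slope_G i - q) \<in> O[principal I](\<epsilon>)"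
  using assms vertex_endpoints_in_ball unfolding slope_F_def slope_G_def sup_bigo_iff principal_bigo_iff by blast+

lemma \<beta>_minus_bigo:
  assumes p: "(\<lambda>i. slope_F i - p) \<in> O[principal I](\<epsilon>)" and q: "(\<lambda>i. slope_G i - q) \<in> O[principal I](\<epsilon>)" and q0: "0 < q"
  shows "(\<lambda>i. \<beta> i - (- p / q)) \<in> O[principal I](\<epsilon>)"
proof -
  have difference_eq: "\<beta> i - (- p / q) = (p / q * (slope_G i - q) - (slope_F i - p)) * inverse (slope_G i)" if "i \<in> I" for i
    using slope_G_ge[OF that] \<mu>_pos q0 by (simp add: \<beta>_def field_simps)
  have "(\<lambda>i. inverse (slope_G i)) \<in> O[principal I](\<lambda>_. 1)"
  proof (rule principal_bigoI)
    show "\<bar>inverse (slope_G i)\<bar> \<le> inverse \<mu> * \<bar>1\<bar>" if "i \<in> I" for i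
      using slope_G_ge[OF that] \<mu>_pos by (simp add: le_imp_inverse_le)
  qed
  moreover have cmult: "(\<lambda>i. c * (slope_G i - q)) \<in> O[principal I](\<epsilon>)" for c
    using q by simp
  ultimately have "(\<lambda>i. (p / q * (slope_G i - q) - (slope_F i - p)) * inverse (slope_G i)) \<in> O[principal I](\<lambda>i. \<epsilon> i * 1)"
    by (intro landau_o.big.mult sum_in_bigo(2) p)
  moreover have "(\<lambda>i. \<beta> i - (- p / q)) \<in> O[principal I](\<lambda>i. (p / q * (slope_G i - q) - (slope_F i - p)) * inverse (slope_G i))"
    by (rule principal_bigoI[of _ _ 1]) (use difference_eq in simp)
  ultimately show ?thesis
    using landau_o.big_trans by auto
qed

lemma \<kappa>_minus_bigo:
  assumes p: "(\<lambda>i. slope_F i - p) \<in> O[principal I](\<epsilon>)" and q: "(\<lambda>i. slope_G i - q) \<in> O[principal I](\<epsilon>)"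
    and T: "(\<lambda>i. T i - T0) \<in> O[principal I](\<epsilon>)" and T0: "0 < T0" "\<And>i. i \<in> I \<Longrightarrow> T0 / 2 \<le> T i" and pq: "p < q"
  shows "(\<lambda>i. \<kappa> i - (- ln (T0 * (q - p)))) \<in> O[principal I](\<epsilon>)"
proof -
  have diff: "(\<lambda>i. slope_G i - slope_F i) \<in> O[principal I](\<lambda>_. 1)"
    by (intro sum_in_bigo slope_bigo)
  have "(\<lambda>i. (T i - T0) * (slope_G i - slope_F i) + T0 * ((slope_G i - q) - (slope_F i - p))) \<in> O[principal I](\<epsilon>)"
    using landau_o.big.mult[OF T diff] sum_in_bigo(2)[OF q p] by (intro sum_in_bigo(1)) simp_all
  then have "(\<lambda>i. T i * (slope_G i - slope_F i) - T0 * (q - p)) \<in> O[principal I](\<epsilon>)"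
    by (simp add: algebra_simps)
  moreover have "T0 / 2 * (2 * \<mu>) \<le> T i * (slope_G i - slope_F i)" if "i \<in> I" for i
    using T0 T_pos[OF that] slope_F_le[OF that] slope_G_ge[OF that] \<mu>_pos that by (intro mult_mono) auto
  ultimately have "(\<lambda>i. ln (T i * (slope_G i - slope_F i)) - ln (T0 * (q - p))) \<in> O[principal I](\<epsilon>)"
    using T0(1) \<mu>_pos pq by (intro principal_ln_minus_bigo[of I "T0 / 2 * (2 * \<mu>)"]) auto
  then show ?thesis
    by (subst landau_o.big.uminus_in_iff[symmetric]) (simp add: \<kappa>_def)
qed

lemma parameters_bigo:
  assumes F': "sup_bigo I (\<lambda>_. x0) (\<lambda>_. R) (\<lambda>i x. F' i x - p) \<epsilon>" and G': "sup_bigo I (\<lambda>_. x0) (\<lambda>_. R) (\<lambda>i x. G' i x - q) \<epsilon>"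
    and pq: "p < 0" "0 < q" and T: "(\<lambda>i. T i - T0) \<in> O[principal I](\<epsilon>)" and T0: "0 < T0" "\<And>i. i \<in> I \<Longrightarrow> T0 / 2 \<le> T i"
  shows "(\<lambda>i. \<bar>\<beta> i - (- p / q)\<bar> + \<bar>\<kappa> i - (- ln (T0 * (q - p)))\<bar> + \<bar>T i / T0 - 1\<bar>) \<in> O[principal I](\<epsilon>)"
proof -
  have "(\<lambda>i. T i / T0 - 1) \<in> O[principal I](\<lambda>i. T i - T0)"
    by (rule principal_bigoI[of _ _ "1 / T0"]) (use T0(1) in \<open>auto simp: field_simps abs_if\<close>)
  moreover have "(\<lambda>i. \<beta> i - (- p / q)) \<in> O[principal I](\<epsilon>)"
    by (rule \<beta>_minus_bigo[OF slope_minus_bigo[OF F' G'] pq(2)])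
  moreover have "(\<lambda>i. \<kappa> i - (- ln (T0 * (q - p)))) \<in> O[principal I](\<epsilon>)"
    by (rule \<kappa>_minus_bigo[OF slope_minus_bigo[OF F' G'] T T0]) (use pq in simp_all)
  ultimately show ?thesis
    by (intro sum_in_bigo) (simp_all only: landau_o.big.abs_in_iff landau_o.big_trans[OF _ T])
qed

end

subsection \<open>Stability of the blow-up\<close>

lemma ubl_perturbed_data:
  assumes pq: "p < 0" "0 < q" and T0: "0 < T0"
    and W: "W = vertex_wave p q T0 x0 (0, x) * exp (- y)" "0 < W"
  shows "- ln W = ubl (- p / q) (- ln (T0 * (q - p))) T0 x0 0 x + y"
    and "- (exp (- y) * (p - q - vertex_wave p q T0 x0 (0, x) * z) / W) = dt (ubl (- p / q) (- ln (T0 * (q - p))) T0 x0) 0 x + z"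
proof -
  have pos: "0 < vertex_wave p q T0 x0 (0, x)"
    using W by (simp add: zero_less_mult_iff)
  show "- ln W = ubl (- p / q) (- ln (T0 * (q - p))) T0 x0 0 x + y"
    using ubl_eq_minus_ln_vertex_wave[OF pq T0 T0 pos] pos by (simp add: W(1) ln_mult)
  show "- (exp (- y) * (p - q - vertex_wave p q T0 x0 (0, x) * z) / W) = dt (ubl (- p / q) (- ln (T0 * (q - p))) T0 x0) 0 x + z"
    unfolding dt_ubl_eq[OF pq T0 order_refl T0 pos] W(1) using pos by (simp add: field_simps)
qed

lemma (in blowup_family) is_solution_perturbed_ubl:
  assumes pq: "p < 0" "0 < q" and T0: "0 < T0" and i: "i \<in> I"
    and data: "AE x in lborel. F i x + G i x = vertex_wave p q T0 x0 (0, x) * exp (- f x) \<and>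
      F' i x - G' i x = exp (- f x) * (p - q - vertex_wave p q T0 x0 (0, x) * g x)"
  shows "is_solution (T i) x0 (solution i) (\<lambda>x. ubl (- p / q) (- ln (T0 * (q - p))) T0 x0 0 x + f x)
    (\<lambda>x. dt (ubl (- p / q) (- ln (T0 * (q - p))) T0 x0) 0 x + g x)"
proof (rule is_solution_solution[OF i])
  have pos: "0 < F i x + G i x" if "x \<in> ball x0 (T i)" for x
    using dalembert_pos(1)[OF i, of 0 x] that T_pos[OF i] by (auto simp: light_cone_iff dalembert_def dist_real_def)
  show "AE x in lborel. x \<in> ball x0 (T i) \<longrightarrow>
      - ln (F i x + G i x) = ubl (- p / q) (- ln (T0 * (q - p))) T0 x0 0 x + f x \<and>
      - ((F' i x - G' i x) / (F i x + G i x)) = dt (ubl (- p / q) (- ln (T0 * (q - p))) T0 x0) 0 x + g x"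
    using data by eventually_elim (metis ubl_perturbed_data[OF pq T0] pos)
qed

lemma ubl_blowup_stability:
  fixes \<epsilon> :: "'i \<Rightarrow> real"
  assumes \<beta>0: "0 < \<beta>0" and T0: "0 < T0" and \<epsilon>: "\<And>i. i \<in> I \<Longrightarrow> 0 < \<epsilon> i" "\<epsilon> \<in> O[principal I](\<lambda>_. 1)"
    and small: "\<And>i. i \<in> I \<Longrightarrow> data_small (Suc (Suc n)) (f i) (g i) (\<epsilon> i)"
  obtains \<epsilon>0 \<beta> \<kappa> T u I' where "0 < \<epsilon>0" "I' = {i \<in> I. \<epsilon> i \<le> \<epsilon>0}"
    "\<forall>i\<in>I'. 0 < \<beta> i \<and> 0 < T i \<and> T i < 2 * T0 \<and> is_solution (T i) x0 (u i)
      (\<lambda>x. ubl \<beta>0 \<kappa>0 T0 x0 0 x + f i x) (\<lambda>x. dt (ubl \<beta>0 \<kappa>0 T0 x0) 0 x + g i x)"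
    "sobolev_bigo (SIGMA i:I'. {0..<T i}) (\<lambda>_. x0) (\<lambda>(i, t). T i - t) (Suc (Suc (Suc n)))
      (\<lambda>(i, t) x. u i t x - ubl (\<beta> i) (\<kappa> i) (T i) x0 t x) (\<lambda>(i, t). T i - t)"
    "sobolev_bigo (SIGMA i:I'. {0..<T i}) (\<lambda>_. x0) (\<lambda>(i, t). T i - t) (Suc (Suc n))
      (\<lambda>(i, t) x. dt (u i) t x - dt (ubl (\<beta> i) (\<kappa> i) (T i) x0) t x) (\<lambda>_. 1)"
    "(\<lambda>i. \<bar>\<beta> i - \<beta>0\<bar> + \<bar>\<kappa> i - \<kappa>0\<bar> + \<bar>T i / T0 - 1\<bar>) \<in> O[principal I'](\<epsilon>)"
proof -
  obtain p q where pq: "p < 0" "0 < q" and \<beta>0_eq: "\<beta>0 = - p / q" and \<kappa>0_eq: "\<kappa>0 = - ln (T0 * (q - p))"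
    by (rule ubl_parameters_from_slopes[OF \<beta>0 T0])
  have R: "0 < 2 * T0" using T0 by simp
  obtain F F' G G' where
    FG: "\<forall>i\<in>I. primitive_on (ball x0 (2 * T0)) (F i) (F' i)" "\<forall>i\<in>I. primitive_on (ball x0 (2 * T0)) (G i) (G' i)"
    and F': "sobolev_bigo I (\<lambda>_. x0) (\<lambda>_. 2 * T0) (Suc (Suc n)) (\<lambda>i x. F' i x - p) \<epsilon>"
    and G': "sobolev_bigo I (\<lambda>_. x0) (\<lambda>_. 2 * T0) (Suc (Suc n)) (\<lambda>i x. G' i x - q) \<epsilon>"
    and center: "(\<lambda>i. F i x0 + G i x0 - (q - p) * T0) \<in> O[principal I](\<epsilon>)"
    and data: "\<forall>i\<in>I. AE x in lborel. F i x + G i x = vertex_wave p q T0 x0 (0, x) * exp (- f i x) \<and>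
      F' i x - G' i x = exp (- f i x) * (p - q - vertex_wave p q T0 x0 (0, x) * g i x)"
    by (rule null_profiles_of_small_data[OF R \<epsilon>(2) small])
  obtain \<epsilon>0 \<mu> T I' where \<epsilon>0: "0 < \<epsilon>0" "I' = {i \<in> I. \<epsilon> i \<le> \<epsilon>0}" and family: "blowup_family I' x0 (2 * T0) \<mu> n T F F' G G'"
    and T: "(\<lambda>i. T i - T0) \<in> O[principal I'](\<epsilon>)" "\<forall>i\<in>I'. T0 / 2 \<le> T i"
    using blowup_family_of_near_affine_profiles[OF pq T0 \<epsilon> FG(1)[rule_format] F' FG(2)[rule_format] G' center] by blast
  interpret blowup_family I' x0 "2 * T0" \<mu> n T F F' G G' by (rule family)
  have I': "I' \<subseteq> I" using \<epsilon>0(2) by blast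
  have slices_eq: "slices = (SIGMA i:I'. {0..<T i})" "radius = (\<lambda>(i, t). T i - t)"
    by (auto simp: slices_def radius_def)
  show thesis
  proof (rule that[OF \<epsilon>0, of \<beta> T solution \<kappa>])
    show "\<forall>i\<in>I'. 0 < \<beta> i \<and> 0 < T i \<and> T i < 2 * T0 \<and> is_solution (T i) x0 (solution i)
        (\<lambda>x. ubl \<beta>0 \<kappa>0 T0 x0 0 x + f i x) (\<lambda>x. dt (ubl \<beta>0 \<kappa>0 T0 x0) 0 x + g i x)"
      unfolding \<beta>0_eq \<kappa>0_eq using \<beta>_pos T_pos T_less is_solution_perturbed_ubl[OF pq T0] data I' by blast
    show "(\<lambda>i. \<bar>\<beta> i - \<beta>0\<bar> + \<bar>\<kappa> i - \<kappa>0\<bar> + \<bar>T i / T0 - 1\<bar>) \<in> O[principal I'](\<epsilon>)"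
      unfolding \<beta>0_eq \<kappa>0_eq
      by (rule parameters_bigo[OF sobolev_bigo_sup[OF sobolev_bigo_subset[OF R F' I']]
            sobolev_bigo_sup[OF sobolev_bigo_subset[OF R G' I']] pq T(1) T0]) (use T(2) in blast)
  qed (use sobolev_bigo_solution_minus_ubl sobolev_bigo_dt_solution_minus_dt_ubl in \<open>simp_all only: slices_eq\<close>)
qed

definition Hdot_decay :: "real \<Rightarrow> real \<Rightarrow> nat \<Rightarrow> real \<Rightarrow> real \<Rightarrow> real \<Rightarrow> (real \<Rightarrow> real \<Rightarrow> real) \<Rightarrow> bool" where
  "Hdot_decay T x0 m \<gamma> \<alpha> C v \<longleftrightarrow> (\<forall>t\<in>{0..<T}. \<forall>s\<le>m. has_Hdot (ball x0 (T - t)) s (v t) \<and>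
     (T - t) powr (real s + \<gamma> - 1 / 2) * Hdot_norm (ball x0 (T - t)) s (v t) \<le> C * (T - t) powr \<alpha>)"

lemma Hdot_decay_mono:
  assumes v: "Hdot_decay T x0 m \<gamma> \<alpha> C v" and C: "C \<le> C'"
  shows "Hdot_decay T x0 m \<gamma> \<alpha> C' v"
proof -
  have "C * (T - t) powr \<alpha> \<le> C' * (T - t) powr \<alpha>" for t
    using C by (rule mult_right_mono) simp
  then show ?thesis
    using v order_trans unfolding Hdot_decay_def by blast
qed

lemma Hdot_decay_imp_bounds:
  assumes v: "Hdot_decay T x0 (m + 1) 0 \<alpha> C v" and w: "Hdot_decay T x0 m 1 \<alpha> C w"
  shows "\<forall>t\<in>{0..<T}.
    (\<forall>s\<le>m + 1. has_Hdot (ball x0 (T - t)) s (v t) \<and>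
      (T - t) powr (real s - 1 / 2) * Hdot_norm (ball x0 (T - t)) s (v t) \<le> C * (T - t) powr \<alpha>) \<and>
    (\<forall>s\<in>{1..m + 1}. has_Hdot (ball x0 (T - t)) (s - 1) (w t) \<and>
      (T - t) powr (real s - 1 / 2) * Hdot_norm (ball x0 (T - t)) (s - 1) (w t) \<le> C * (T - t) powr \<alpha>)"
proof (intro ballI conjI allI impI)
  fix t s assume "t \<in> {0..<T}" "s \<le> m + 1"
  then show "has_Hdot (ball x0 (T - t)) s (v t)"
    "(T - t) powr (real s - 1 / 2) * Hdot_norm (ball x0 (T - t)) s (v t) \<le> C * (T - t) powr \<alpha>"
    using v unfolding Hdot_decay_def by (simp_all del: atLeastLessThan_iff)
next
  fix t s assume "t \<in> {0..<T}" "s \<in> {1..m + 1}"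
  then show "has_Hdot (ball x0 (T - t)) (s - 1) (w t)"
    "(T - t) powr (real s - 1 / 2) * Hdot_norm (ball x0 (T - t)) (s - 1) (w t) \<le> C * (T - t) powr \<alpha>"
    using w[unfolded Hdot_decay_def, rule_format, of t "s - 1"] by (auto simp: of_nat_diff)
qed

lemma sobolev_bigo_Hdot_decay:
  assumes T: "\<And>i. i \<in> I \<Longrightarrow> T i \<le> R" and \<delta>: "0 \<le> \<delta>"
    and v: "sobolev_bigo (SIGMA i:I. {0..<T i}) (\<lambda>_. x0) (\<lambda>(i, t). T i - t) m (\<lambda>(i, t). v i t)
      (\<lambda>(i, t). (T i - t) powr (1 - \<gamma>))"
  obtains C where "\<forall>i\<in>I. Hdot_decay (T i) x0 m \<gamma> (1 - \<delta>) C (v i)"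
proof -
  obtain C where H: "\<And>j s. j \<in> (SIGMA i:I. {0..<T i}) \<Longrightarrow> s \<le> m \<Longrightarrow> has_Hdot (ball x0 (case j of (i, t) \<Rightarrow> T i - t)) s (case j of (i, t) \<Rightarrow> v i t)"
    and C: "\<And>j s. j \<in> (SIGMA i:I. {0..<T i}) \<Longrightarrow> s \<le> m \<Longrightarrow> (case j of (i, t) \<Rightarrow> T i - t) powr (real s - 1 / 2) *
      Hdot_norm (ball x0 (case j of (i, t) \<Rightarrow> T i - t)) s (case j of (i, t) \<Rightarrow> v i t) \<le> C * \<bar>case j of (i, t) \<Rightarrow> (T i - t) powr (1 - \<gamma>)\<bar>"
    by (rule sobolev_bigo_Hdot[OF _ v]) auto
  have "(T i - t) powr (real s + \<gamma> - 1 / 2) * Hdot_norm (ball x0 (T i - t)) s (v i t) \<le> (\<bar>C\<bar> * R powr \<delta>) * (T i - t) powr (1 - \<delta>)"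
    if i: "i \<in> I" and t: "t \<in> {0..<T i}" and s: "s \<le> m" for i t s
  proof -
    let ?r = "T i - t" and ?N = "Hdot_norm (ball x0 (T i - t)) s (v i t)"
    have r: "0 < ?r" "?r \<le> R" using t T[OF i] by auto
    have "?r powr (real s + \<gamma> - 1 / 2) * ?N = ?r powr \<gamma> * (?r powr (real s - 1 / 2) * ?N)"
      by (simp add: powr_add[symmetric] mult.assoc[symmetric] algebra_simps)
    also have "\<dots> \<le> ?r powr \<gamma> * (\<bar>C\<bar> * ?r powr (1 - \<gamma>))"
    proof (rule mult_left_mono)
      have "?r powr (real s - 1 / 2) * ?N \<le> C * ?r powr (1 - \<gamma>)"
        using C[of "(i, t)" s] i t s by simp
      also have "\<dots> \<le> \<bar>C\<bar> * ?r powr (1 - \<gamma>)"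
        by (rule mult_right_mono) auto
      finally show "?r powr (real s - 1 / 2) * ?N \<le> \<bar>C\<bar> * ?r powr (1 - \<gamma>)" .
    qed simp
    also have "\<dots> = \<bar>C\<bar> * (?r powr \<delta> * ?r powr (1 - \<delta>))"
      using r by (simp add: powr_add[symmetric])
    also have "\<dots> \<le> \<bar>C\<bar> * (R powr \<delta> * ?r powr (1 - \<delta>))"
      using r \<delta> by (intro mult_left_mono mult_right_mono powr_mono2) auto
    finally show ?thesis by (simp add: mult.assoc)
  qed
  moreover have "has_Hdot (ball x0 (T i - t)) s (v i t)" if "i \<in> I" "t \<in> {0..<T i}" "s \<le> m" for i t s
    using H[of "(i, t)" s] that by simp
  ultimately show thesis
    by (intro that[of "\<bar>C\<bar> * R powr \<delta>"]) (simp add: Hdot_decay_def)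
qed

lemma ubl_blowup_stability_Hdot:
  fixes \<epsilon> :: "'i \<Rightarrow> real"
  assumes \<beta>0: "0 < \<beta>0" and T0: "0 < T0" and \<epsilon>: "\<And>i. i \<in> I \<Longrightarrow> 0 < \<epsilon> i" "\<epsilon> \<in> O[principal I](\<lambda>_. 1)"
    and k: "2 \<le> k" and small: "\<And>i. i \<in> I \<Longrightarrow> data_small k (f i) (g i) (\<epsilon> i)" and \<delta>: "0 \<le> \<delta>"
  obtains \<epsilon>0 C \<beta> \<kappa> T u where "0 < \<epsilon>0" "0 < C"
    "\<forall>i\<in>I. \<epsilon> i \<le> \<epsilon>0 \<longrightarrow> 0 < \<beta> i \<and> 0 < T i \<and>
      is_solution (T i) x0 (u i) (\<lambda>x. ubl \<beta>0 \<kappa>0 T0 x0 0 x + f i x) (\<lambda>x. dt (ubl \<beta>0 \<kappa>0 T0 x0) 0 x + g i x) \<and>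
      Hdot_decay (T i) x0 (k + 1) 0 (1 - \<delta>) C (\<lambda>t x. u i t x - ubl (\<beta> i) (\<kappa> i) (T i) x0 t x) \<and>
      Hdot_decay (T i) x0 k 1 (1 - \<delta>) C (\<lambda>t x. dt (u i) t x - dt (ubl (\<beta> i) (\<kappa> i) (T i) x0) t x) \<and>
      \<bar>\<beta> i - \<beta>0\<bar> + \<bar>\<kappa> i - \<kappa>0\<bar> + \<bar>T i / T0 - 1\<bar> \<le> C * \<epsilon> i"
proof -
  obtain n where n: "k = Suc (Suc n)"
    using k by (metis add_2_eq_Suc le_Suc_ex)
  obtain \<epsilon>0 \<beta> \<kappa> T u I' where \<epsilon>0: "0 < \<epsilon>0" and I': "I' = {i \<in> I. \<epsilon> i \<le> \<epsilon>0}"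
    and solution: "\<forall>i\<in>I'. 0 < \<beta> i \<and> 0 < T i \<and> T i < 2 * T0 \<and> is_solution (T i) x0 (u i)
      (\<lambda>x. ubl \<beta>0 \<kappa>0 T0 x0 0 x + f i x) (\<lambda>x. dt (ubl \<beta>0 \<kappa>0 T0 x0) 0 x + g i x)"
    and u: "sobolev_bigo (SIGMA i:I'. {0..<T i}) (\<lambda>_. x0) (\<lambda>(i, t). T i - t) (Suc (Suc (Suc n)))
      (\<lambda>(i, t) x. u i t x - ubl (\<beta> i) (\<kappa> i) (T i) x0 t x) (\<lambda>(i, t). T i - t)"
    and dt_u: "sobolev_bigo (SIGMA i:I'. {0..<T i}) (\<lambda>_. x0) (\<lambda>(i, t). T i - t) (Suc (Suc n))
      (\<lambda>(i, t) x. dt (u i) t x - dt (ubl (\<beta> i) (\<kappa> i) (T i) x0) t x) (\<lambda>_. 1)"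
    and parameters: "(\<lambda>i. \<bar>\<beta> i - \<beta>0\<bar> + \<bar>\<kappa> i - \<kappa>0\<bar> + \<bar>T i / T0 - 1\<bar>) \<in> O[principal I'](\<epsilon>)"
    by (rule ubl_blowup_stability[OF \<beta>0 T0 \<epsilon> small[unfolded n]])
  have T: "T i \<le> 2 * T0" if "i \<in> I'" for i
    using that solution by (auto dest!: bspec)
  obtain A where A: "\<forall>i\<in>I'. Hdot_decay (T i) x0 (Suc (Suc (Suc n))) 0 (1 - \<delta>) A
      (\<lambda>t x. u i t x - ubl (\<beta> i) (\<kappa> i) (T i) x0 t x)"
    by (rule sobolev_bigo_Hdot_decay[OF T \<delta> sobolev_bigo_trans[OF u]]) (auto intro!: principal_bigoI[of _ _ 1])
  obtain B where B: "\<forall>i\<in>I'. Hdot_decay (T i) x0 (Suc (Suc n)) 1 (1 - \<delta>) B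
      (\<lambda>t x. dt (u i) t x - dt (ubl (\<beta> i) (\<kappa> i) (T i) x0) t x)"
    by (rule sobolev_bigo_Hdot_decay[OF T \<delta> sobolev_bigo_trans[OF dt_u]]) (auto intro!: principal_bigoI[of _ _ 1])
  obtain D where D: "0 < D" "\<forall>i\<in>I'. \<bar>\<beta> i - \<beta>0\<bar> + \<bar>\<kappa> i - \<kappa>0\<bar> + \<bar>T i / T0 - 1\<bar> \<le> D * \<epsilon> i"
    using parameters \<epsilon>(1) unfolding principal_bigo_iff I' by force
  define C where "C = max D (max A B)"
  have C: "0 < C" "D \<le> C" "A \<le> C" "B \<le> C" using D(1) by (auto simp: C_def)
  have "\<bar>\<beta> i - \<beta>0\<bar> + \<bar>\<kappa> i - \<kappa>0\<bar> + \<bar>T i / T0 - 1\<bar> \<le> C * \<epsilon> i" if "i \<in> I'" for i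
    using order_trans[OF D(2)[rule_format, OF that] mult_right_mono[OF C(2)]] \<epsilon>(1)[of i] that by (simp add: I')
  then show thesis
    using solution Hdot_decay_mono[OF A[rule_format] C(3)] Hdot_decay_mono[OF B[rule_format] C(4)]
    by (intro that[OF \<epsilon>0 C(1), of \<beta> T u \<kappa>]) (auto simp: I' n)
qed

theorem theorem1p3:
  fixes \<beta>0 T0 \<kappa>0 x0 \<delta> :: real and k :: nat
  assumes "\<beta>0 > 0" and "T0 > 0"
    and "real k \<ge> 2 + 1 / \<beta>0 + \<beta>0"
    and "0 < \<delta>" and "\<delta> < 1"
  shows "\<exists>\<epsilon>0 > 0. \<exists>C > 0. \<forall>\<epsilon> \<in> {0<..\<epsilon>0}. \<forall>f g :: real \<Rightarrow> real.
     data_small k f g \<epsilon> \<longrightarrow>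
     (\<exists>\<beta>s Ts \<kappa>s u.
        \<beta>s > 0 \<and> Ts > 0 \<and>
        is_solution Ts x0 u (\<lambda>x. ubl \<beta>0 \<kappa>0 T0 x0 0 x + f x)
                            (\<lambda>x. dt (ubl \<beta>0 \<kappa>0 T0 x0) 0 x + g x) \<and>
        (\<forall>v. is_solution Ts x0 v (\<lambda>x. ubl \<beta>0 \<kappa>0 T0 x0 0 x + f x)
                                (\<lambda>x. dt (ubl \<beta>0 \<kappa>0 T0 x0) 0 x + g x)
             \<longrightarrow> (\<forall>(t, x) \<in> light_cone Ts x0. v t x = u t x)) \<and>
        (\<forall>t \<in> {0..<Ts}.
           (\<forall>s \<le> k + 1.
              has_Hdot (ball x0 (Ts - t)) s (\<lambda>x. u t x - ubl \<beta>s \<kappa>s Ts x0 t x) \<and>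
              (Ts - t) powr (real s - 1 / 2) *
                Hdot_norm (ball x0 (Ts - t)) s (\<lambda>x. u t x - ubl \<beta>s \<kappa>s Ts x0 t x)
                \<le> C * (Ts - t) powr (1 - \<delta>)) \<and>
           (\<forall>s \<in> {1..k + 1}.
              has_Hdot (ball x0 (Ts - t)) (s - 1) (\<lambda>x. dt u t x - dt (ubl \<beta>s \<kappa>s Ts x0) t x) \<and>
              (Ts - t) powr (real s - 1 / 2) *
                Hdot_norm (ball x0 (Ts - t)) (s - 1) (\<lambda>x. dt u t x - dt (ubl \<beta>s \<kappa>s Ts x0) t x)
                \<le> C * (Ts - t) powr (1 - \<delta>))) \<and>
        \<bar>\<beta>s - \<beta>0\<bar> + \<bar>\<kappa>s - \<kappa>0\<bar> + \<bar>Ts / T0 - 1\<bar> \<le> C * \<epsilon>)"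
proof -
  have "2 \<le> real k"
    using assms(1,3) zero_le_divide_1_iff[of \<beta>0] by linarith
  then have k: "2 \<le> k" by simp
  define I where "I = {i. 0 < fst i \<and> fst i \<le> 1 \<and> data_small k (fst (snd i)) (snd (snd i)) (fst i)}"
  have I: "0 < fst i" "data_small k (fst (snd i)) (snd (snd i)) (fst i)" if "i \<in> I" for i
    using that by (auto simp: I_def)
  have bounded: "fst \<in> O[principal I](\<lambda>_. 1)"
    by (rule principal_bigoI[of _ _ 1]) (auto simp: I_def)
  obtain \<epsilon>0 C \<beta> \<kappa> T u where "0 < \<epsilon>0" "0 < C" and stable: "\<forall>i\<in>I. fst i \<le> \<epsilon>0 \<longrightarrow> 0 < \<beta> i \<and> 0 < T i \<and>
      is_solution (T i) x0 (u i) (\<lambda>x. ubl \<beta>0 \<kappa>0 T0 x0 0 x + fst (snd i) x) (\<lambda>x. dt (ubl \<beta>0 \<kappa>0 T0 x0) 0 x + snd (snd i) x) \<and>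
      Hdot_decay (T i) x0 (k + 1) 0 (1 - \<delta>) C (\<lambda>t x. u i t x - ubl (\<beta> i) (\<kappa> i) (T i) x0 t x) \<and>
      Hdot_decay (T i) x0 k 1 (1 - \<delta>) C (\<lambda>t x. dt (u i) t x - dt (ubl (\<beta> i) (\<kappa> i) (T i) x0) t x) \<and>
      \<bar>\<beta> i - \<beta>0\<bar> + \<bar>\<kappa> i - \<kappa>0\<bar> + \<bar>T i / T0 - 1\<bar> \<le> C * fst i"
    by (rule ubl_blowup_stability_Hdot[OF assms(1,2) I(1) bounded k I(2) less_imp_le[OF assms(4)]])
  show ?thesis
  proof (rule exI[of _ "min \<epsilon>0 1"], intro conjI, use \<open>0 < \<epsilon>0\<close> in simp, rule exI[of _ C],
      intro conjI \<open>0 < C\<close> ballI allI impI, goal_cases)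
    case (1 \<epsilon> f g)
    then have i: "(\<epsilon>, f, g) \<in> I" "fst (\<epsilon>, f, g) \<le> \<epsilon>0" by (auto simp: I_def)
    from stable[rule_format, OF i, unfolded fst_conv snd_conv] show ?case
      by (intro exI[of _ "\<beta> (\<epsilon>, f, g)"] exI[of _ "T (\<epsilon>, f, g)"] exI[of _ "\<kappa> (\<epsilon>, f, g)"] exI[of _ "u (\<epsilon>, f, g)"], elim conjE)
        (intro conjI allI impI is_solution_unique Hdot_decay_imp_bounds; assumption)
  qed
qed

end
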